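(* Let $d\ge2$. There exists $\eta>0$ such that for every $p\in(2,2+\eta)$ there exists $\varepsilon>0$ with the property that, for all $\theta\in[\vartheta(p,d),\vartheta(p,d)+\varepsilon)$ and all $a\in[\underline a(\theta,p),\underline a(\theta,p)+\varepsilon)$, no extremal for the Caffarelli-Kohn-Nirenberg inequality with parameters $(\theta,p,a)$ is radially symmetric.
   Context: Notation: $2^*=\frac{2d}{d-2}$ if $d\ge3$, $2^*=\infty$ if $d=2$; $a_c=\frac{d-2}{2}$, $\Lambda(a)=(a-a_c)^2$, $\vartheta(p,d)=d\,\frac{p-2}{2p}$, and $$\underline a(\theta,p):=a_c-\frac{2\sqrt{d-1}}{p+2}\sqrt{\frac{2p\theta}{p-2}-1}.$$ For $a<a_c$, $\mathcal D^{1,2}_a(\mathbb R^d)$ is the completion of the set of smooth functions with compact support in $\mathbb R^d\setminus\{0\}$ with respect to the norm given by $\||x|^{-a}\nabla u\|_{L^2(\mathbb R^d)}^2+\||x|^{-(a+1)}u\|_{L^2(\mathbb R^d)}^2$. For $a<a_c$ and $p\in(2,2^* )$, let $b=a-a_c+\frac dp$ (equivalently $p=\frac{2d}{d-2+2(b-a)}$). For $\theta\in[\vartheta(p,d),1]$, $\mathsf C_{\rm CKN}(\theta,p,\Lambda)$ with $\Lambda=\Lambda(a)$ is the optimal (smallest) constant in the Caffarelli-Kohn-Nirenberg inequality with parameters $(\theta,p,a)$: $$\left(\int_{\mathbb R^d}\frac{|u|^p}{|x|^{bp}}\,dx\right)^{2/p}\le \mathsf C_{\rm CKN}(\theta,p,\Lambda)\left(\int_{\mathbb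 R^d}\frac{|\nabla u|^2}{|x|^{2a}}\,dx\right)^{\theta}\left(\int_{\mathbb R^d}\frac{|u|^2}{|x|^{2(a+1)}}\,dx\right)^{1-\theta}\quad\forall\,u\in\mathcal D^{1,2}_a(\mathbb R^d).$$ An extremal is a function $u\not\equiv0$ in $\mathcal D^{1,2}_a(\mathbb R^d)$ for which equality holds (with the optimal constant). *)

theory Defs
  imports "HOL-Analysis.Analysis"
begin

definition a_crit :: "nat \<Rightarrow> real" where
  "a_crit d = (real d - 2) / 2"

definition two_star :: "nat \<Rightarrow> ereal" where
  "two_star d = (if d = 2 then \<infinity> else ereal (2 * real d / (real d - 2)))"

definition vartheta_exp :: "real \<Rightarrow> nat \<Rightarrow> real" where
  "vartheta_exp p d = real d * ((p - 2) / (2 * p))"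

definition a_lower :: "nat \<Rightarrow> real \<Rightarrow> real \<Rightarrow> real" where
  "a_lower d \<theta> p =
     a_crit d - 2 * sqrt (real d - 1) / (p + 2) * sqrt (2 * p * \<theta> / (p - 2) - 1)"

definition b_exp :: "nat \<Rightarrow> real \<Rightarrow> real \<Rightarrow> real" where
  "b_exp d p a = a - a_crit d + real d / p"

definition ckn_admissible :: "nat \<Rightarrow> real \<Rightarrow> real \<Rightarrow> real \<Rightarrow> bool" where
  "ckn_admissible d \<theta> p a \<longleftrightarrow>
     2 < p \<and> ereal p < two_star d \<and> vartheta_exp p d \<le> \<theta> \<and> \<theta> \<le> 1 \<and> a < a_crit d"

definition partial_deriv :: "'n::finite \<Rightarrow> (real ^ 'n \<Rightarrow> real) \<Rightarrow> real ^ 'n \<Rightarrow> real" where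
  "partial_deriv i f x = frechet_derivative f (at x) (axis i 1)"

text \<open>If all iterated partial derivatives are Frechet differentiable everywhere, they are in
  particular all continuous; so this is the usual class of infinitely differentiable functions.\<close>

definition smooth :: "(real ^ 'n::finite \<Rightarrow> real) \<Rightarrow> bool" where
  "smooth f \<longleftrightarrow> (\<forall>is x. fold partial_deriv is f differentiable (at x))"

definition grad :: "(real ^ 'n::finite \<Rightarrow> real) \<Rightarrow> real ^ 'n \<Rightarrow> real ^ 'n" where
  "grad f x = (\<chi> i. partial_deriv i f x)"

text \<open>Functions that are smooth with compact support in the punctured space, extended by \<open>0\<close>
  to the origin.\<close>

definition test_function :: "(real ^ 'n::finite \<Rightarrow> real) \<Rightarrow> bool" where
  "test_function \<phi> \<longleftrightarrow>
     smooth \<phi> \<and> compact (closure {x. \<phi> x \<noteq> 0}) \<and> 0 \<notin> closure {x. \<phi> x \<noteq> 0}"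

text \<open>The norm controls both \<open>u\<close> and its gradient in weighted \<open>L\<^sup>2\<close> spaces, so the completion
  is the closure of the set of pairs \<open>(\<phi>, grad \<phi>)\<close> in the product of these two spaces.
  \<open>D12 a u G\<close> says that \<open>u\<close> represents an element of the completion and that \<open>G\<close> is its
  gradient. Both functions matter only up to null sets, and \<open>G\<close> is determined by \<open>u\<close>, because
  \<open>G\<close> is the distributional gradient of \<open>u\<close> away from the origin.\<close>

definition D12 :: "real \<Rightarrow> (real ^ 'n::finite \<Rightarrow> real) \<Rightarrow> (real ^ 'n \<Rightarrow> real ^ 'n) \<Rightarrow> bool" where
  "D12 a u G \<longleftrightarrow>
     u \<in> borel_measurable borel \<and> G \<in> borel_measurable borel \<and>
     (\<exists>\<phi>. (\<forall>n. test_function (\<phi> n)) \<and>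
        (\<lambda>n::nat.
            (\<integral>\<^sup>+x. ennreal ((norm (grad (\<phi> n) x - G x))\<^sup>2 / norm x powr (2 * a)) \<partial>lborel)
          + (\<integral>\<^sup>+x. ennreal (\<bar>\<phi> n x - u x\<bar>\<^sup>2 / norm x powr (2 * (a + 1))) \<partial>lborel))
        \<longlonglongrightarrow> 0)"

definition ckn_density :: "real \<Rightarrow> real \<Rightarrow> (real ^ 'n::finite \<Rightarrow> real) \<Rightarrow> real ^ 'n \<Rightarrow> real" where
  "ckn_density p a u x = \<bar>u x\<bar> powr p / norm x powr (b_exp CARD('n) p a * p)"

definition ckn_lhs :: "real \<Rightarrow> real \<Rightarrow> (real ^ 'n::finite \<Rightarrow> real) \<Rightarrow> real" where
  "ckn_lhs p a u = (LINT x|lborel. ckn_density p a u x) powr (2 / p)"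

text \<open>For \<open>D12 a u G\<close> both integrals below are finite, so the Bochner integrals are not
  junk values. Where \<open>\<theta> = 1\<close> and the second integral vanishes, \<open>0 powr 0 = 0\<close> is harmless:
  then \<open>u = 0\<close> almost everywhere and all three integrals vanish.\<close>

definition ckn_rhs ::
    "real \<Rightarrow> real \<Rightarrow> (real ^ 'n::finite \<Rightarrow> real) \<Rightarrow> (real ^ 'n \<Rightarrow> real ^ 'n) \<Rightarrow> real" where
  "ckn_rhs \<theta> a u G =
     (LINT x|lborel. (norm (G x))\<^sup>2 / norm x powr (2 * a)) powr \<theta>
     * (LINT x|lborel. \<bar>u x\<bar>\<^sup>2 / norm x powr (2 * (a + 1))) powr (1 - \<theta>)"

text \<open>Integrability is part of the inequality, since a divergent Bochner integral is \<open>0\<close>.\<close>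

definition ckn_inequality :: "'n::finite itself \<Rightarrow> real \<Rightarrow> real \<Rightarrow> real \<Rightarrow> real \<Rightarrow> bool" where
  "ckn_inequality T \<theta> p a C \<longleftrightarrow>
     (\<forall>(u :: real ^ 'n \<Rightarrow> real) G. D12 a u G \<longrightarrow>
        integrable lborel (ckn_density p a u) \<and> ckn_lhs p a u \<le> C * ckn_rhs \<theta> a u G)"

text \<open>Extended real valued, hence \<open>\<infinity>\<close> if no finite constant is valid. If there is one,
  the infimum is itself valid, so it is the smallest constant. On \<open>a < a_crit d\<close> the map
  \<open>a \<mapsto> (a - a_crit d)\<^sup>2\<close> is injective, so indexing by \<open>a\<close> or by its image is the same.\<close>

definition C_CKN :: "'n::finite itself \<Rightarrow> real \<Rightarrow> real \<Rightarrow> real \<Rightarrow> ereal" where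
  "C_CKN T \<theta> p a = (INF C \<in> {C. 0 \<le> C \<and> ckn_inequality T \<theta> p a C}. ereal C)"

definition ckn_extremal :: "real \<Rightarrow> real \<Rightarrow> real \<Rightarrow> (real ^ 'n::finite \<Rightarrow> real) \<Rightarrow> bool" where
  "ckn_extremal \<theta> p a u \<longleftrightarrow>
     \<not> (AE x in lborel. u x = 0) \<and>
     (\<exists>G. D12 a u G \<and> integrable lborel (ckn_density p a u) \<and>
        ereal (ckn_lhs p a u) = C_CKN TYPE('n) \<theta> p a * ereal (ckn_rhs \<theta> a u G))"

definition radially_symmetric :: "(real ^ 'n::finite \<Rightarrow> real) \<Rightarrow> bool" where
  "radially_symmetric u \<longleftrightarrow> (\<exists>f :: real \<Rightarrow> real. AE x in lborel. u x = f (norm x))"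

end

theory Submission
  imports Defs "HOL-Probability.Distributions"
begin

text \<open>
  Why the theorem is true. In the logarithmic variable \<open>s = ln |x|\<close> and after multiplication by
  \<open>|x| powr k\<close> with \<open>k = a_crit - a\<close>, a radial function becomes a function \<open>w\<close> on the real line, the
  gradient term becomes \<open>\<integral>w'\<^sup>2 + k\<^sup>2 \<integral>w\<^sup>2\<close>, and the quotient of the two sides of the inequality is
  controlled by a one-dimensional interpolation inequality. On the other hand, translating and
  concentrating a Gaussian at a point away from the origin makes the weights invisible; for
  \<open>\<theta> = vartheta_exp p d\<close> the quotient is invariant under this concentration and tends to its value
  for a Gaussian in the unweighted Gagliardo-Nirenberg inequality. So the optimal constant is at
  least the Gaussian value, and a radial extremal is impossible as soon as the bound for
  radial functions is strictly smaller.

  Both sides tend to 1 as \<open>p\<close> decreases to 2, so what counts is their first order behaviour, which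
  is a comparison of two logarithmic Sobolev inequalities. With \<open>q = (p - 2) / (2 p)\<close>, both
  sides are \<open>q\<close>-th powers: Gaussians give at least \<open>(2 / (\<pi> e d)) powr (d q)\<close>
  (\<open>concentrated_test_function\<close>), and at the value \<open>k = 2 (d - 1) / (p + 2)\<close> that belongs to \<open>a_lower\<close>, optimising over the ratio of \<open>\<integral>w'\<^sup>2\<close> to \<open>\<integral>w\<^sup>2\<close> gives an explicit bound for radial
  functions that involves the area of the sphere (\<open>radial_quotient_bound\<close>). After an estimate of
  this area (\<open>shell_mass_lower_bound\<close>) the strict inequality between the two follows from
  \<open>((3/2 + sqrt 2) \<pi> / 10) ((p + 2) / 4) ^ (2 (d - 1)) < 1\<close>, which holds at \<open>p = 2\<close> and hence near
  it (\<open>radial_bound_strict\<close>). This leaves enough room for a one-dimensional inequality that is not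
  sharp (\<open>one_dim_interpolation\<close>). For fixed \<open>p\<close> a single concentrated test function beats all radial
  functions at \<open>\<theta> = vartheta_exp p d\<close>, \<open>a = a_lower d \<theta> p\<close>; since both its quotient and the radial
  bound are continuous in \<open>(\<theta>, a)\<close>, it still does so in a neighbourhood.

  Two technical points. Spherical coordinates are replaced by \<open>nn_integral_log_polar\<close>, where the
  sphere is thickened to the shell \<open>1 \<le> |y| < e\<close> and a point is written \<open>exp s *\<^sub>R y\<close>; the mass of the
  shell is the area of the sphere. A radial function need not be the limit of radial test functions by
  construction, so the one-dimensional inequality is applied to the approximating test functions
  along almost every ray and passes to the limit there (\<open>D12_rays\<close>).
\<close>

section \<open>Smooth functions and a bump function\<close>

text \<open>Smoothness quantifies over all lists of directions; counting derivatives instead gives a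
  predicate that is closed under products and compositions by induction on the order.\<close>

fun differentiable_upto :: "nat \<Rightarrow> (real ^ 'n::finite \<Rightarrow> real) \<Rightarrow> bool" where
  "differentiable_upto 0 f \<longleftrightarrow> (\<forall>x. f differentiable (at x))"
| "differentiable_upto (Suc k) f \<longleftrightarrow>
     (\<forall>x. f differentiable (at x)) \<and> (\<forall>i. differentiable_upto k (partial_deriv i f))"

lemma differentiable_upto_imp_differentiable:
  "differentiable_upto k f \<Longrightarrow> f differentiable (at x)"
  by (cases k) auto

lemma smooth_if_differentiable_upto:
  assumes "\<And>k. differentiable_upto k f"
  shows "smooth f"
  unfolding smooth_def
proof (intro allI)
  fix "is" :: "'a list" and x
  have "differentiable_upto (length is) f \<Longrightarrow> fold partial_deriv is f differentiable (at x)" for f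
    by (induction "is" arbitrary: f) (auto intro: differentiable_upto_imp_differentiable)
  with assms show "fold partial_deriv is f differentiable (at x)" by blast
qed

lemma differentiable_upto_mono: "differentiable_upto (Suc k) f \<Longrightarrow> differentiable_upto k f"
  by (induction k arbitrary: f) auto

lemma partial_deriv_eqI:
  assumes "\<And>x. (f has_derivative f' x) (at x)"
  shows "partial_deriv i f = (\<lambda>x. f' x (axis i 1))"
  by (rule ext) (simp add: partial_deriv_def frechet_derivative_at[OF assms, symmetric])

lemma has_derivative_frechet:
  "f differentiable (at x) \<Longrightarrow> (f has_derivative frechet_derivative f (at x)) (at x)"
  by (simp add: frechet_derivative_works)

lemma differentiable_upto_const: "differentiable_upto k (\<lambda>x. c)"
proof (induction k arbitrary: c)
  case (Suc k)
  have "partial_deriv i (\<lambda>x. c) = (\<lambda>x. 0)" for i :: 'a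
    by (subst partial_deriv_eqI[where f' = "\<lambda>x h. 0"]) auto
  with Suc show ?case by simp
qed simp

lemma differentiable_upto_add:
  "differentiable_upto k f \<Longrightarrow> differentiable_upto k g \<Longrightarrow> differentiable_upto k (\<lambda>x. f x + g x)"
proof (induction k arbitrary: f g)
  case (Suc k)
  have "partial_deriv i (\<lambda>x. f x + g x) = (\<lambda>x. partial_deriv i f x + partial_deriv i g x)" for i
    by (subst partial_deriv_eqI, rule has_derivative_add)
       (use Suc.prems in \<open>auto intro!: has_derivative_frechet simp: partial_deriv_def\<close>)
  with Suc show ?case by auto
qed (auto intro: differentiable_add)

lemma differentiable_upto_mult:
  "differentiable_upto k f \<Longrightarrow> differentiable_upto k g \<Longrightarrow> differentiable_upto k (\<lambda>x. f x * g x)"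
proof (induction k arbitrary: f g)
  case (Suc k)
  have "partial_deriv i (\<lambda>x. f x * g x) =
      (\<lambda>x. f x * partial_deriv i g x + partial_deriv i f x * g x)" for i
    by (subst partial_deriv_eqI, rule has_derivative_mult)
       (use Suc.prems in \<open>auto intro!: has_derivative_frechet simp: partial_deriv_def\<close>)
  then show ?case
    using Suc differentiable_upto_mono[OF Suc.prems(1)] differentiable_upto_mono[OF Suc.prems(2)]
    by (auto intro!: differentiable_upto_add)
qed (auto intro: differentiable_mult)

text \<open>The outer function is given with all its derivatives \<open>\<psi> 0, \<psi> 1, \<dots>\<close>, so that the induction can
  pass from \<open>\<psi> j\<close> to \<open>\<psi> (Suc j)\<close>.\<close>

lemma differentiable_upto_compose:
  fixes \<psi> :: "nat \<Rightarrow> real \<Rightarrow> real"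
  assumes \<psi>: "\<And>j t. (\<psi> j has_real_derivative \<psi> (Suc j) t) (at t)"
    and f: "differentiable_upto k f"
  shows "differentiable_upto k (\<lambda>x. \<psi> j (f x))"
  using f
proof (induction k arbitrary: j)
  have D: "((\<lambda>x. \<psi> j (f x)) has_derivative (\<lambda>h. frechet_derivative f (at x) h * \<psi> (Suc j) (f x))) (at x)"
    if "f differentiable (at x)" for x j
    by (rule has_derivative_compose[OF has_derivative_frechet[OF that], of "\<psi> j"
          "\<lambda>h. h * \<psi> (Suc j) (f x)", simplified])
       (use \<psi>[of j "f x"] in \<open>simp add: has_field_derivative_def mult_commute_abs\<close>)
  { case 0
    then show ?case using D by (auto simp: differentiable_def)
  next
    case (Suc k)
    have df: "f differentiable (at x)" for x
      using Suc.prems by auto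
    have "partial_deriv i (\<lambda>x. \<psi> j (f x)) = (\<lambda>x. partial_deriv i f x * \<psi> (Suc j) (f x))" for i
      by (subst partial_deriv_eqI, rule D[OF df]) (simp add: partial_deriv_def)
    then show ?case
      using Suc differentiable_upto_mono[OF Suc.prems] differentiableI[OF D[OF df]]
      by (auto intro!: differentiable_upto_mult)
  }
qed

lemma differentiable_upto_affine: "differentiable_upto k (\<lambda>x. c * (x $ i) + b)"
proof (cases k)
  case (Suc l)
  have D: "((\<lambda>x. c * (x $ i) + b) has_derivative (\<lambda>h. c * (h $ i))) (at x)" for x :: "real ^ 'a"
    by (auto intro!: derivative_eq_intros bounded_linear.has_derivative[OF bounded_linear_vec_nth])
  have "partial_deriv j (\<lambda>x. c * (x $ i) + b) = (\<lambda>x. c * (axis j 1 $ i))" for j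
    by (rule partial_deriv_eqI[OF D])
  with Suc D show ?thesis by (auto simp: differentiable_upto_const differentiable_def)
next
  case 0
  have D: "((\<lambda>x. c * (x $ i) + b) has_derivative (\<lambda>h. c * (h $ i))) (at x)" for x :: "real ^ 'a"
    by (auto intro!: derivative_eq_intros bounded_linear.has_derivative[OF bounded_linear_vec_nth])
  with 0 show ?thesis by (auto simp: differentiable_def)
qed

lemma differentiable_upto_sum:
  "(\<And>j. j \<in> J \<Longrightarrow> differentiable_upto k (f j)) \<Longrightarrow> differentiable_upto k (\<lambda>x. \<Sum>j\<in>J. f j x)"
  by (induction J rule: infinite_finite_induct)
     (auto intro: differentiable_upto_add differentiable_upto_const)

lemma differentiable_upto_dist_square:
  "differentiable_upto k (\<lambda>x. c * (norm (x - e))\<^sup>2 + b)"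
proof -
  have eq: "c * (norm (x - e))\<^sup>2 + b =
      (\<Sum>j\<in>UNIV. (c * (x $ j) + (- c * e $ j)) * (1 * (x $ j) + (- e $ j))) + b" for x :: "real ^ 'a"
    unfolding power2_norm_eq_inner inner_vec_def
    by (simp add: sum_distrib_left power2_eq_square algebra_simps)
  show ?thesis
    unfolding eq
    by (intro differentiable_upto_add differentiable_upto_const differentiable_upto_sum
        differentiable_upto_mult differentiable_upto_affine)
qed

text \<open>Every derivative of \<open>exp (- 1 / t)\<close> is a polynomial in \<open>1 / t\<close> times \<open>exp (- 1 / t)\<close>; these
  are the polynomials.\<close>

fun bump_poly :: "nat \<Rightarrow> real poly" where
  "bump_poly 0 = 1"
| "bump_poly (Suc k) = monom 1 2 * (bump_poly k - pderiv (bump_poly k))"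

text \<open>The \<open>k\<close>-th derivative of the function that is \<open>exp (- 1 / t)\<close> for \<open>t > 0\<close> and 0 otherwise.\<close>

definition bump :: "nat \<Rightarrow> real \<Rightarrow> real" where
  "bump k t = (if t > 0 then poly (bump_poly k) (1 / t) * exp (- (1 / t)) else 0)"

lemma poly_times_exp_tendsto_0:
  "((\<lambda>x::real. poly p x * exp (- x)) \<longlongrightarrow> 0) at_top"
proof -
  have "((\<lambda>x::real. \<Sum>i\<le>degree p. coeff p i * (x ^ i / exp x)) \<longlongrightarrow> (\<Sum>i\<le>degree p. coeff p i * 0)) at_top"
    by (intro tendsto_intros tendsto_power_div_exp_0)
  moreover have "(\<lambda>x::real. poly p x * exp (- x)) = (\<lambda>x. \<Sum>i\<le>degree p. coeff p i * (x ^ i / exp x))"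
    by (auto simp: poly_altdef sum_distrib_right exp_minus divide_inverse mult.assoc)
  ultimately show ?thesis by simp
qed

lemma bump_right_limit: "((\<lambda>t::real. poly p (1 / t) * exp (- (1 / t))) \<longlongrightarrow> 0) (at_right 0)"
  using filterlim_compose[OF poly_times_exp_tendsto_0[of p] filterlim_inverse_at_top_right]
  by (simp add: inverse_eq_divide)

lemma bump_has_derivative: "(bump k has_real_derivative bump (Suc k) t) (at t)"
proof -
  consider "t > 0" | "t < 0" | "t = 0" by linarith
  then show ?thesis
  proof cases
    case 1
    have inv: "((\<lambda>t. 1 / t) has_real_derivative - (1 / t\<^sup>2)) (at t)"
      using 1 by (auto intro!: derivative_eq_intros simp: power2_eq_square)
    have "((\<lambda>t. poly (bump_poly k) (1 / t) * exp (- (1 / t))) has_real_derivative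
        poly (pderiv (bump_poly k)) (1 / t) * (- (1 / t\<^sup>2)) * exp (- (1 / t))
        + exp (- (1 / t)) * (- (- (1 / t\<^sup>2))) * poly (bump_poly k) (1 / t)) (at t)"
      by (intro DERIV_mult DERIV_chain2[OF poly_DERIV inv] DERIV_chain2[OF DERIV_exp]
          DERIV_minus inv)
    also have "poly (pderiv (bump_poly k)) (1 / t) * (- (1 / t\<^sup>2)) * exp (- (1 / t))
        + exp (- (1 / t)) * (- (- (1 / t\<^sup>2))) * poly (bump_poly k) (1 / t) = bump (Suc k) t"
      using 1 by (simp add: bump_def poly_monom power_divide algebra_simps)
    finally have "((\<lambda>t. poly (bump_poly k) (1 / t) * exp (- (1 / t))) has_real_derivative
        bump (Suc k) t) (at t)" .
    moreover have "\<forall>\<^sub>F x in nhds t. bump k x = poly (bump_poly k) (1 / x) * exp (- (1 / x))"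
      using eventually_nhds_in_open[of "{0<..}" t] 1 by (auto elim!: eventually_mono simp: bump_def)
    ultimately show ?thesis by (subst DERIV_cong_ev[OF refl _ refl]) auto
  next
    case 2
    have "\<forall>\<^sub>F x in nhds t. bump k x = 0"
      using eventually_nhds_in_open[of "{..<0}" t] 2 by (auto elim!: eventually_mono simp: bump_def)
    then have "(bump k has_real_derivative 0) (at t)"
      by (subst DERIV_cong_ev[OF refl _ refl]) auto
    with 2 show ?thesis by (simp add: bump_def)
  next
    case 3
    have "((\<lambda>h. bump k h / h) \<longlongrightarrow> 0) (at_right 0)"
      using bump_right_limit[of "monom 1 1 * bump_poly k"]
    proof (rule Lim_transform_eventually)
      show "\<forall>\<^sub>F x in at_right 0. poly (monom 1 1 * bump_poly k) (1 / x) * exp (- (1 / x)) = bump k x / x"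
        using eventually_at_right_less[of 0] by eventually_elim (auto simp: bump_def poly_monom)
    qed
    moreover have "((\<lambda>h. bump k h / h) \<longlongrightarrow> 0) (at_left 0)"
    proof (rule Lim_transform_eventually[OF tendsto_const])
      show "\<forall>\<^sub>F x in at_left 0. 0 = bump k x / x"
        using eventually_at_left_real[of "-1" 0] by (auto elim!: eventually_mono simp: bump_def)
    qed
    ultimately have "((\<lambda>h. bump k h / h) \<longlongrightarrow> 0) (at 0)"
      by (simp add: filterlim_split_at)
    with 3 show ?thesis by (simp add: DERIV_def bump_def)
  qed
qed

section \<open>Integration along rays\<close>

lemma nn_integral_lborel_scaleR:
  fixes F :: "'a::euclidean_space \<Rightarrow> ennreal"
  assumes [measurable]: "F \<in> borel_measurable borel" and c: "c \<noteq> 0"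
  shows "(\<integral>\<^sup>+x. F x \<partial>lborel) = (\<integral>\<^sup>+y. F (t + c *\<^sub>R y) * ennreal (\<bar>c\<bar> ^ DIM('a)) \<partial>lborel)"
  by (subst lborel_affine[OF c, of t])
     (simp add: nn_integral_density nn_integral_distr mult.commute ennreal_power)

text \<open>The density is invariant under dilations and the shell is a fundamental domain of the
  dilations by powers of \<open>e\<close>. Hence this measure can play the role of the surface measure of the
  sphere.\<close>

definition shell :: "(real ^ 'n::finite) measure" where
  "shell = density lborel
     (\<lambda>y. ennreal (indicator {y. 1 \<le> norm y \<and> norm y < exp 1} y / norm y ^ CARD('n)))"

lemma sets_shell [measurable_cong]: "sets shell = sets borel"
  by (simp add: shell_def)

lemma space_shell [simp]: "space shell = UNIV"
  by (simp add: shell_def)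

text \<open>Every ray spends exactly one unit of logarithmic time in the shell.\<close>

lemma dilation_window:
  assumes "(x :: real ^ 'n::finite) \<noteq> 0"
  shows "(\<integral>\<^sup>+s. indicator {y. 1 \<le> norm y \<and> norm y < exp 1} (exp (- s) *\<^sub>R x) \<partial>lborel) = 1"
proof -
  have "1 \<le> exp (- s) * norm x \<longleftrightarrow> s \<le> ln (norm x)" for s
    using assms by (simp add: exp_minus field_simps ln_ge_iff[symmetric])
  moreover have "exp (- s) * norm x < exp 1 \<longleftrightarrow> ln (norm x) - 1 < s" for s
  proof -
    have "exp (- s) * norm x < exp 1 \<longleftrightarrow> norm x < exp (1 + s)"
      by (simp add: exp_minus field_simps exp_add)
    also have "\<dots> \<longleftrightarrow> ln (norm x) < 1 + s"
      using assms by (metis exp_less_cancel_iff exp_ln zero_less_norm_iff)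
    finally show ?thesis by linarith
  qed
  ultimately have "(\<lambda>s. indicator {y. 1 \<le> norm y \<and> norm y < exp 1} (exp (- s) *\<^sub>R x)) =
      (indicator {ln (norm x) - 1 <.. ln (norm x)} :: real \<Rightarrow> ennreal)"
    by (auto simp: fun_eq_iff indicator_def)
  then show ?thesis by simp
qed

text \<open>Polar coordinates with \<open>r = e\<^sup>s\<close>: insert the window of the preceding lemma, exchange the
  integrals, and rescale \<open>x = e\<^sup>s y\<close> for each \<open>s\<close>.\<close>

lemma nn_integral_log_polar:
  fixes F :: "real ^ 'n::finite \<Rightarrow> ennreal"
  assumes [measurable]: "F \<in> borel_measurable borel"
  shows "(\<integral>\<^sup>+x. F x \<partial>lborel) =
    (\<integral>\<^sup>+y. (\<integral>\<^sup>+s. F (exp s *\<^sub>R y) * ennreal (norm (exp s *\<^sub>R y) ^ CARD('n)) \<partial>lborel) \<partial>shell)"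
proof -
  let ?A = "{y :: real ^ 'n. 1 \<le> norm y \<and> norm y < exp 1}"
  have "(\<integral>\<^sup>+y. (\<integral>\<^sup>+s. F (exp s *\<^sub>R y) * ennreal (norm (exp s *\<^sub>R y) ^ CARD('n)) \<partial>lborel) \<partial>shell)
     = (\<integral>\<^sup>+y. (\<integral>\<^sup>+s. ennreal (indicator ?A y / norm y ^ CARD('n)) *
          (F (exp s *\<^sub>R y) * ennreal (norm (exp s *\<^sub>R y) ^ CARD('n))) \<partial>lborel) \<partial>lborel)"
    unfolding shell_def by (subst nn_integral_density) (simp_all add: nn_integral_cmult)
  also have "\<dots> = (\<integral>\<^sup>+y. (\<integral>\<^sup>+s. indicator ?A y * F (exp s *\<^sub>R y) * ennreal (exp s ^ CARD('n)) \<partial>lborel) \<partial>lborel)"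
  proof (intro nn_integral_cong)
    fix y :: "real ^ 'n" and s :: real
    show "ennreal (indicator ?A y / norm y ^ CARD('n)) *
          (F (exp s *\<^sub>R y) * ennreal (norm (exp s *\<^sub>R y) ^ CARD('n)))
        = indicator ?A y * F (exp s *\<^sub>R y) * ennreal (exp s ^ CARD('n))"
    proof (cases "y \<in> ?A")
      case True
      then have pos: "norm y > 0" by auto
      have "ennreal (1 / norm y ^ CARD('n)) * ennreal (norm (exp s *\<^sub>R y) ^ CARD('n))
          = ennreal (exp s ^ CARD('n))"
        using pos by (subst ennreal_mult[symmetric]) (auto simp: power_mult_distrib)
      with True show ?thesis
        by (simp add: ac_simps)
    qed simp
  qed
  also have "\<dots> = (\<integral>\<^sup>+s. (\<integral>\<^sup>+y. indicator ?A y * F (exp s *\<^sub>R y) * ennreal (exp s ^ CARD('n)) \<partial>lborel) \<partial>lborel)"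
    by (rule lborel_pair.Fubini') measurable
  also have "\<dots> = (\<integral>\<^sup>+s. (\<integral>\<^sup>+x. indicator ?A (exp (- s) *\<^sub>R x) * F x \<partial>lborel) \<partial>lborel)"
  proof (rule nn_integral_cong)
    fix s :: real
    show "(\<integral>\<^sup>+y. indicator ?A y * F (exp s *\<^sub>R y) * ennreal (exp s ^ CARD('n)) \<partial>lborel) =
        (\<integral>\<^sup>+x. indicator ?A (exp (- s) *\<^sub>R x) * F x \<partial>lborel)"
      by (subst (2) nn_integral_lborel_scaleR[of _ "exp s" 0]) (auto simp: exp_minus)
  qed
  also have "\<dots> = (\<integral>\<^sup>+x. (\<integral>\<^sup>+s. indicator ?A (exp (- s) *\<^sub>R x) * F x \<partial>lborel) \<partial>lborel)"
    by (rule lborel_pair.Fubini') measurable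
  also have "\<dots> = (\<integral>\<^sup>+x. F x \<partial>lborel)"
  proof (rule nn_integral_cong_AE)
    have "AE x in lborel. x \<noteq> (0 :: real ^ 'n)"
      by (rule AE_lborel_singleton)
    then show "AE x in lborel. (\<integral>\<^sup>+s. indicator ?A (exp (- s) *\<^sub>R x) * F x \<partial>lborel) = F x"
    proof eventually_elim
      case (elim x)
      then show ?case by (simp add: nn_integral_multc dilation_window)
    qed
  qed
  finally show ?thesis by simp
qed

lemma AE_shell_nonzero: "AE y in shell. (y :: real ^ 'n::finite) \<noteq> 0"
  unfolding shell_def by (subst AE_density) (auto intro!: AE_I2 simp: indicator_def)

lemma shell_cong_nonzero:
  assumes "\<And>y. y \<noteq> 0 \<Longrightarrow> f y = g y"
  shows "(\<integral>\<^sup>+y. f y \<partial>shell) = (\<integral>\<^sup>+y. g y \<partial>(shell :: (real ^ 'n::finite) measure))"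
  by (rule nn_integral_cong_AE) (use AE_shell_nonzero assms in \<open>auto elim: eventually_mono\<close>)

lemma AE_log_polar:
  assumes "AE x in lborel. P (x :: real ^ 'n::finite)"
  shows "AE y in shell. AE s in lborel. P (exp s *\<^sub>R y)"
proof -
  obtain N where N: "{x. \<not> P x} \<subseteq> N" and null: "emeasure lborel N = 0"
    and [measurable]: "N \<in> sets borel"
    using AE_E[OF assms] by (auto simp: space_lborel sets_lborel)
  have "(\<integral>\<^sup>+y. (\<integral>\<^sup>+s. indicator N (exp s *\<^sub>R y) * ennreal (norm (exp s *\<^sub>R y) ^ CARD('n)) \<partial>lborel) \<partial>shell) = 0"
    using nn_integral_log_polar[of "indicator N"] null by simp
  then have "AE y in shell. (\<integral>\<^sup>+s. indicator N (exp s *\<^sub>R y) * ennreal (norm (exp s *\<^sub>R y) ^ CARD('n)) \<partial>lborel) = 0"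
    by (subst (asm) nn_integral_0_iff_AE) auto
  with AE_shell_nonzero show ?thesis
  proof eventually_elim
    case (elim y)
    then have "AE s in lborel. indicator N (exp s *\<^sub>R y) * ennreal (norm (exp s *\<^sub>R y) ^ CARD('n)) = 0"
      by (subst (asm) nn_integral_0_iff_AE) auto
    then show ?case
    proof eventually_elim
      case (elim s)
      with \<open>y \<noteq> 0\<close> N show ?case by (auto simp: indicator_def split: if_splits)
    qed
  qed
qed

definition shell_mass :: "'n::finite itself \<Rightarrow> real" where
  "shell_mass T = measure (shell :: (real ^ 'n) measure) UNIV"

lemma emeasure_shell_finite: "emeasure (shell :: (real ^ 'n::finite) measure) UNIV < \<infinity>"
proof -
  let ?A = "{y :: real ^ 'n. 1 \<le> norm y \<and> norm y < exp 1}"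
  have "emeasure (shell :: (real ^ 'n) measure) UNIV =
      (\<integral>\<^sup>+y. ennreal (indicator ?A y / norm y ^ CARD('n)) \<partial>lborel)"
    unfolding shell_def by (subst emeasure_density) auto
  also have "\<dots> \<le> (\<integral>\<^sup>+y. indicator (ball 0 (exp 1)) (y :: real ^ 'n) \<partial>lborel)"
    by (rule nn_integral_mono) (auto simp: indicator_def divide_le_eq_1)
  also have "\<dots> = emeasure lborel (ball (0 :: real ^ 'n) (exp 1))"
    by simp
  also have "\<dots> < \<infinity>"
    using emeasure_lborel_ball_finite[of "0 :: real ^ 'n" "exp 1"] by simp
  finally show ?thesis .
qed

lemma emeasure_shell: "emeasure (shell :: (real ^ 'n::finite) measure) UNIV = ennreal (shell_mass TYPE('n))"
  unfolding shell_mass_def using emeasure_shell_finite[where 'n = 'n]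
  by (intro emeasure_eq_ennreal_measure) (simp add: less_top)

lemma shell_mass_pos: "shell_mass TYPE('n::finite) > 0"
proof (rule ccontr)
  assume "\<not> ?thesis"
  then have "emeasure (shell :: (real ^ 'n) measure) UNIV = 0"
    by (simp add: emeasure_shell ennreal_eq_0_iff)
  then have "AE y in (shell :: (real ^ 'n) measure). False"
    by (auto simp: AE_iff_measurable[of UNIV] sets_shell)
  then have "AE y in shell. (\<integral>\<^sup>+s. 1 * ennreal (norm (exp s *\<^sub>R (y :: real ^ 'n)) ^ CARD('n)) \<partial>lborel) = 0"
    by (rule AE_mp) simp
  then have "(\<integral>\<^sup>+x. 1 \<partial>(lborel :: (real ^ 'n) measure)) = 0"
    using nn_integral_log_polar[of "\<lambda>x :: real ^ 'n. 1"]
    by (subst (asm) nn_integral_0_iff_AE[symmetric]) auto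
  then show False by simp
qed

section \<open>An interpolation inequality on the line\<close>

lemma integrable_continuous_bounded_support:
  fixes f :: "real \<Rightarrow> real"
  assumes "continuous_on UNIV f" and "\<And>s. L < \<bar>s\<bar> \<Longrightarrow> f s = 0"
  shows "integrable lborel f" "(LINT s|lborel. f s) = integral {-L..L} f"
proof -
  have eq: "(\<lambda>s. indicator {-L..L} s *\<^sub>R f s) = f"
    using assms(2) by (force simp: indicator_def fun_eq_iff)
  have I: "set_integrable lborel {-L..L} f"
    by (rule borel_integrable_atLeastAtMost') (use assms(1) continuous_on_subset in blast)
  then show "integrable lborel f" unfolding set_integrable_def eq .
  show "(LINT s|lborel. f s) = integral {-L..L} f"
    using set_borel_integral_eq_integral(2)[OF I] unfolding set_lebesgue_integral_def eq .
qed

lemma integral_Cauchy_Schwarz: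
  fixes f g :: "'a \<Rightarrow> real"
  assumes I: "integrable M (\<lambda>x. (f x)\<^sup>2)" "integrable M (\<lambda>x. (g x)\<^sup>2)" "integrable M (\<lambda>x. f x * g x)"
  shows "(LINT x|M. f x * g x)\<^sup>2 \<le> (LINT x|M. (f x)\<^sup>2) * (LINT x|M. (g x)\<^sup>2)"
proof -
  define F B G where "F = (LINT x|M. (f x)\<^sup>2)" and "B = (LINT x|M. f x * g x)"
    and "G = (LINT x|M. (g x)\<^sup>2)"
  have nn: "0 \<le> F - 2 * t * B + t\<^sup>2 * G" for t
  proof -
    have "0 \<le> (LINT x|M. (f x - t * g x)\<^sup>2)" by simp
    also have "\<dots> = (LINT x|M. (f x)\<^sup>2 - 2 * t * (f x * g x) + t\<^sup>2 * (g x)\<^sup>2)"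
      by (simp add: power2_eq_square algebra_simps)
    also have "\<dots> = F - 2 * t * B + t\<^sup>2 * G"
      using I by (simp add: F_def B_def G_def)
    finally show ?thesis .
  qed
  have "0 \<le> F" "0 \<le> G" by (simp_all add: F_def G_def)
  have "B\<^sup>2 \<le> F * G"
  proof (cases "G = 0")
    case True
    have "B = 0"
    proof (rule ccontr)
      assume "B \<noteq> 0"
      with nn[of "(F + 1) / (2 * B)"] True show False by (simp add: field_simps)
    qed
    then show ?thesis using \<open>0 \<le> F\<close> \<open>0 \<le> G\<close> by simp
  next
    case False
    with \<open>0 \<le> G\<close> have "G > 0" by simp
    then show ?thesis using nn[of "B / G"] by (simp add: field_simps power2_eq_square)
  qed
  then show ?thesis by (simp add: F_def B_def G_def)
qed

text \<open>With \<open>g = dwell\<close>, the product \<open>\<integral>w'\<^sup>2 \<integral>(g w)\<^sup>2\<close> dominates the square of \<open>\<integral>g(w) |w'|\<close>, which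
  only depends on the heights that \<open>w\<close> passes through. The choice \<open>g(x)\<^sup>2 = 2 x\<^sup>2 (1 - sqrt x)\<close>
  has an elementary primitive and is close enough to the optimal \<open>x\<^sup>2 ln (1 / x)\<close> of the limit
  \<open>p \<longrightarrow> 2\<close>.\<close>

definition dwell :: "real \<Rightarrow> real" where
  "dwell x = \<bar>x\<bar> * sqrt (2 * max 0 (1 - sqrt \<bar>x\<bar>))"

lemma continuous_dwell: "continuous_on S dwell"
  unfolding dwell_def by (intro continuous_intros)

lemma dwell_nonneg: "0 \<le> dwell x"
  by (simp add: dwell_def)

text \<open>In the variable \<open>Q = sqrt (1 - sqrt t)\<close> the integrand is the polynomial
  \<open>4 sqrt 2 Q\<^sup>2 (1 - Q\<^sup>2)\<^sup>3\<close>.\<close>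

lemma integral_dwell: "(dwell has_integral 2 * sqrt 2 * (32 / 315)) {0..1}"
proof -
  define K :: "real \<Rightarrow> real" where
    "K Q = - 2 * sqrt 2 * (2 / 3 * Q ^ 3 - 6 / 5 * Q ^ 5 + 6 / 7 * Q ^ 7 - 2 / 9 * Q ^ 9)" for Q
  define H where "H t = K (sqrt (1 - sqrt t))" for t
  have "(dwell has_integral H 1 - H 0) {0..1}"
  proof (rule fundamental_theorem_of_calculus_interior)
    show "continuous_on {0..1} H"
      unfolding H_def K_def by (intro continuous_intros)
    fix t :: real assume t: "t \<in> {0<..<1}"
    define Q where "Q = sqrt (1 - sqrt t)"
    have st: "0 < sqrt t" "sqrt t < 1" using t by (auto simp: real_sqrt_lt_1_iff)
    have Qpos: "Q > 0" and Q2: "Q\<^sup>2 = 1 - sqrt t" using st by (auto simp: Q_def)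
    have dQ: "((\<lambda>t. sqrt (1 - sqrt t)) has_real_derivative - (inverse Q / 2 * (inverse (sqrt t) / 2))) (at t)"
      unfolding Q_def using st t by (auto intro!: derivative_eq_intros)
    have dK: "(K has_real_derivative - 4 * sqrt 2 * (Q\<^sup>2 * (1 - Q\<^sup>2) ^ 3)) (at Q)"
      unfolding K_def
      by (rule derivative_eq_intros refl)+ (simp add: field_simps power2_eq_square eval_nat_numeral)
    have "(H has_real_derivative - 4 * sqrt 2 * (Q\<^sup>2 * (1 - Q\<^sup>2) ^ 3) *
        (- (inverse Q / 2 * (inverse (sqrt t) / 2)))) (at t)"
      unfolding H_def using DERIV_chain2[OF dK[unfolded Q_def] dQ[unfolded Q_def]] by (simp add: Q_def)
    also have "- 4 * sqrt 2 * (Q\<^sup>2 * (1 - Q\<^sup>2) ^ 3) * (- (inverse Q / 2 * (inverse (sqrt t) / 2)))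
        = sqrt 2 * Q * (sqrt t)\<^sup>2"
    proof -
      define r where "r = sqrt t"
      have r: "1 - Q\<^sup>2 = r" "r > 0" using Q2 st by (auto simp: r_def)
      show ?thesis
        unfolding r_def[symmetric] r(1) using Qpos r(2)
        by (simp add: field_simps power2_eq_square power3_eq_cube)
    qed
    also have "\<dots> = dwell t"
      using t st by (simp add: dwell_def Q_def real_sqrt_mult[symmetric])
    finally show "(H has_vector_derivative dwell t) (at t)"
      by (simp add: has_real_derivative_iff_has_vector_derivative)
  qed simp
  moreover have "H 1 - H 0 = 2 * sqrt 2 * (32 / 315)"
    by (simp add: H_def K_def field_simps)
  ultimately show ?thesis by simp
qed

text \<open>A function that vanishes at both ends and reaches the height 1 passes through all heights in
  \<open>[0, 1]\<close> twice, so \<open>\<integral>dwell(w) |w'|\<close> is at least twice the integral of \<open>dwell\<close> over \<open>[0, 1]\<close>.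
  Cauchy-Schwarz then gives a lower bound that is independent of the shape of \<open>w\<close>.\<close>

lemma normalized_crossing_bound:
  fixes w w' :: "real \<Rightarrow> real"
  assumes der: "\<And>s. (w has_real_derivative w' s) (at s)" and cont: "continuous_on UNIV w'"
    and supp: "\<And>s. L \<le> \<bar>s\<bar> \<Longrightarrow> w s = 0 \<and> w' s = 0"
    and le1: "\<And>s. \<bar>w s\<bar> \<le> 1" and s0: "w s0 = 1"
  shows "5 / 16 \<le> (LINT s|lborel. (w' s)\<^sup>2) * (LINT s|lborel. (dwell (w s))\<^sup>2)"
proof -
  have contw: "continuous_on UNIV w"
    using der by (meson DERIV_continuous_on UNIV_I has_field_derivative_at_within)
  have contgw: "continuous_on UNIV (\<lambda>s. dwell (w s))"
    using continuous_on_compose2[OF continuous_dwell contw] by blast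
  have s0L: "-L \<le> s0" "s0 \<le> L" using supp[of s0] s0 by (cases "L \<le> \<bar>s0\<bar>"; simp)+
  obtain \<Gamma> where \<Gamma>: "\<And>x. x \<in> {-2..2} \<Longrightarrow> (\<Gamma> has_vector_derivative dwell x) (at x within {-2..2})"
    using antiderivative_continuous[OF continuous_dwell, of "-2" 2] by auto
  have \<Gamma>': "(\<Gamma> has_real_derivative dwell x) (at x)" if "\<bar>x\<bar> \<le> 1" for x
  proof -
    have "at x within {-2..2} = at x" using that by (intro at_within_interior) auto
    moreover have "x \<in> {-2..2}" using that by auto
    ultimately show ?thesis
      using \<Gamma>[of x] by (auto simp: has_real_derivative_iff_has_vector_derivative)
  qed
  define J where "J = 2 * sqrt 2 * (32 / 315 :: real)"
  have "(dwell has_integral \<Gamma> 1 - \<Gamma> 0) {0..1}"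
  proof (rule fundamental_theorem_of_calculus)
    show "(\<Gamma> has_vector_derivative dwell x) (at x within {0..1})" if "x \<in> {0..1}" for x
      by (rule has_vector_derivative_at_within,
          rule \<Gamma>'[unfolded has_real_derivative_iff_has_vector_derivative]) (use that in auto)
  qed simp
  then have J: "\<Gamma> 1 - \<Gamma> 0 = J"
    using integral_dwell has_integral_unique unfolding J_def by blast
  have d\<Gamma>: "((\<lambda>s. \<Gamma> (w s)) has_vector_derivative dwell (w s) * w' s) (at s within S)" for s S
    by (rule has_vector_derivative_at_within,
        rule DERIV_chain2[OF \<Gamma>'[OF le1] der, unfolded has_real_derivative_iff_has_vector_derivative])
  \<comment> \<open>The rise to the maximum and the descent from it each contribute the integral \<open>J\<close>.\<close>
  define k where "k s = dwell (w s) * \<bar>w' s\<bar>" for s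
  have contk: "continuous_on S k" for S
    unfolding k_def by (intro continuous_intros continuous_on_subset[OF contgw] continuous_on_subset[OF cont]) auto
  have left: "((\<lambda>s. dwell (w s) * w' s) has_integral J) {-L..s0}"
    using fundamental_theorem_of_calculus[of "-L" s0 "\<lambda>s. \<Gamma> (w s)", OF s0L(1) d\<Gamma>] J supp[of "-L"] s0
    by simp
  have right: "((\<lambda>s. - (dwell (w s) * w' s)) has_integral J) {s0..L}"
    using has_integral_neg[OF fundamental_theorem_of_calculus[of s0 L "\<lambda>s. \<Gamma> (w s)", OF s0L(2) d\<Gamma>]]
      J supp[of L] s0 by simp
  have k_ge: "dwell (w s) * w' s \<le> k s" "- (dwell (w s) * w' s) \<le> k s" for s
    using mult_left_mono[OF abs_ge_self[of "w' s"] dwell_nonneg[of "w s"]]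
      mult_left_mono[OF abs_ge_minus_self[of "w' s"] dwell_nonneg[of "w s"]]
    by (simp_all add: k_def)
  have "J \<le> integral {-L..s0} k"
    by (rule has_integral_le[OF left integrable_integral[OF integrable_continuous_interval[OF contk]] k_ge(1)])
  moreover have "J \<le> integral {s0..L} k"
    by (rule has_integral_le[OF right integrable_integral[OF integrable_continuous_interval[OF contk]] k_ge(2)])
  ultimately have "2 * J \<le> integral {-L..L} k"
    using Henstock_Kurzweil_Integration.integral_combine[OF s0L integrable_continuous_interval[OF contk]]
    by simp
  also have "\<dots> = (LINT s|lborel. k s)"
    by (rule integrable_continuous_bounded_support(2)[OF contk, symmetric])
       (use supp in \<open>auto simp: k_def\<close>)
  finally have "(2 * J)\<^sup>2 \<le> (LINT s|lborel. \<bar>w' s\<bar> * dwell (w s))\<^sup>2"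
    by (intro power_mono) (auto simp: J_def k_def mult.commute)
  also have "\<dots> \<le> (LINT s|lborel. \<bar>w' s\<bar>\<^sup>2) * (LINT s|lborel. (dwell (w s))\<^sup>2)"
    by (intro integral_Cauchy_Schwarz integrable_continuous_bounded_support(1)[of _ L])
       (use supp in \<open>auto simp: dwell_def intro!: continuous_intros contgw[unfolded dwell_def] contw cont\<close>)
  finally have "(2 * J)\<^sup>2 \<le> (LINT s|lborel. (w' s)\<^sup>2) * (LINT s|lborel. (dwell (w s))\<^sup>2)"
    by simp
  moreover have "5 / 16 \<le> (2 * J)\<^sup>2"
    by (simp add: J_def power_mult_distrib power2_eq_square)
  ultimately show ?thesis by linarith
qed

lemma Bernoulli_concave:
  fixes x r :: real
  assumes "0 \<le> x" "x \<le> 1" "0 < r" "r \<le> 1"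
  shows "x powr r \<le> 1 - r * (1 - x)"
proof (cases "x = 0")
  case False
  with assms have "x powr r * 1 powr (1 - r) \<le> r * x + (1 - r) * 1"
    by (intro Youngs_inequality_0) auto
  then show ?thesis by (simp add: algebra_simps)
qed (use assms in auto)

text \<open>Bernoulli's inequality for \<open>sqrt \<bar>x\<bar>\<close> with the exponent \<open>2 h\<close>, which has to be at most 1; this
  is where the restriction \<open>h \<le> 1/2\<close> comes from.\<close>

lemma powr_le_dwell:
  assumes "\<bar>x\<bar> \<le> 1" "0 < h" "h \<le> 1 / 2"
  shows "\<bar>x\<bar> powr (2 + h) \<le> x\<^sup>2 - h * (dwell x)\<^sup>2"
proof -
  have "\<bar>x\<bar> powr h = (sqrt \<bar>x\<bar>) powr (2 * h)"
    by (simp add: powr_half_sqrt[symmetric] powr_powr)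
  also have "\<dots> \<le> 1 - 2 * h * (1 - sqrt \<bar>x\<bar>)"
    using assms by (intro Bernoulli_concave) (auto simp: real_sqrt_le_1_iff)
  finally have "x\<^sup>2 * \<bar>x\<bar> powr h \<le> x\<^sup>2 * (1 - 2 * h * (1 - sqrt \<bar>x\<bar>))"
    by (rule mult_left_mono) simp
  moreover have "\<bar>x\<bar> powr (2 + h) = x\<^sup>2 * \<bar>x\<bar> powr h"
    by (simp add: powr_add)
  moreover have "(dwell x)\<^sup>2 = x\<^sup>2 * (2 * (1 - sqrt \<bar>x\<bar>))"
    using assms by (simp add: dwell_def power_mult_distrib max_def real_sqrt_le_1_iff)
  ultimately show ?thesis by (simp only:) (simp add: right_diff_distrib mult_ac)
qed

text \<open>The factor \<open>5 / 4\<close> is four times the constant \<open>5 / 16\<close> of \<open>normalized_crossing_bound\<close>. The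
  sharp inequality would have \<open>\<pi> e / 2\<close> here in the limit \<open>h \<longrightarrow> 0\<close>.\<close>

definition line_const :: real where "line_const = 5 / 4 * exp 1"

lemma line_const_pos: "line_const > 0" by (simp add: line_const_def)

text \<open>Integrating \<open>powr_le_dwell\<close> and using \<open>normalized_crossing_bound\<close> leaves \<open>N (1 - (h/4) z)\<close>
  with \<open>z = 5 / (4 E N)\<close>, which is at most \<open>N exp (- z) powr (h/4)\<close>, and
  \<open>exp (- z) \<le> 1 / (e z)\<close>.\<close>

lemma one_dim_interpolation_normalized:
  fixes w w' :: "real \<Rightarrow> real"
  assumes der: "\<And>s. (w has_real_derivative w' s) (at s)" and cont: "continuous_on UNIV w'"
    and supp: "\<And>s. L \<le> \<bar>s\<bar> \<Longrightarrow> w s = 0 \<and> w' s = 0"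
    and le1: "\<And>s. \<bar>w s\<bar> \<le> 1" and s0: "w s0 = 1" and h: "0 < h" "h \<le> 1 / 2"
  shows "(LINT s|lborel. \<bar>w s\<bar> powr (2 + h)) \<le>
    (LINT s|lborel. (w s)\<^sup>2) powr (1 + h / 4) * ((LINT s|lborel. (w' s)\<^sup>2) / line_const) powr (h / 4)"
proof -
  define N E D where "N = (LINT s|lborel. (w s)\<^sup>2)" and "E = (LINT s|lborel. (w' s)\<^sup>2)"
    and "D = (LINT s|lborel. (dwell (w s))\<^sup>2)"
  have contw: "continuous_on UNIV w"
    using der by (meson DERIV_continuous_on UNIV_I has_field_derivative_at_within)
  have contgw: "continuous_on UNIV (\<lambda>s. dwell (w s))"
    using continuous_on_compose2[OF continuous_dwell contw] by blast
  have I: "integrable lborel (\<lambda>s. (w s)\<^sup>2)" "integrable lborel (\<lambda>s. (dwell (w s))\<^sup>2)"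
    "integrable lborel (\<lambda>s. \<bar>w s\<bar> powr (2 + h))"
    by (rule integrable_continuous_bounded_support(1)[of _ L];
        use supp h in \<open>auto simp: dwell_def intro!: continuous_intros contgw[unfolded dwell_def]
          continuous_on_powr' contw\<close>)+
  have "(LINT s|lborel. \<bar>w s\<bar> powr (2 + h)) \<le> (LINT s|lborel. (w s)\<^sup>2 - h * (dwell (w s))\<^sup>2)"
    by (intro integral_mono I Bochner_Integration.integrable_diff integrable_mult_right[OF I(2)]
        powr_le_dwell le1 h)
  also have "\<dots> = N - h * D"
    using I by (simp add: N_def D_def)
  finally have P: "(LINT s|lborel. \<bar>w s\<bar> powr (2 + h)) \<le> N - h * D" .
  have ED: "5 / 16 \<le> E * D"
    unfolding E_def D_def by (rule normalized_crossing_bound[OF der cont supp le1 s0])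
  have nn: "0 \<le> E" "0 \<le> D" "0 \<le> N" by (simp_all add: E_def D_def N_def)
  with ED have Epos: "E > 0" and Dpos: "D > 0" by (auto simp: less_le)
  have "0 \<le> (LINT s|lborel. \<bar>w s\<bar> powr (2 + h))" by simp
  with P h Dpos have Npos: "N > 0" by (smt (verit) mult_pos_pos)
  define z where "z = 5 / 4 / (E * N)"
  have z: "z > 0" using Epos Npos by (simp add: z_def)
  have "D \<ge> 5 / 16 / E" using ED Epos by (simp add: field_simps)
  then have "N - h * D \<le> N - h * (5 / 16 / E)"
    using mult_left_mono[of "5 / 16 / E" D h] h by simp
  also have "\<dots> = N * (1 - h / 4 * z)" using Epos Npos by (simp add: z_def field_simps)
  also have "\<dots> \<le> N * exp (- (h / 4 * z))"
    using Npos exp_ge_add_one_self[of "- (h / 4 * z)"] by simp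
  also have "exp (- (h / 4 * z)) = exp (- z) powr (h / 4)"
    by (simp add: powr_def)
  also have "exp (- z) powr (h / 4) \<le> (E * N / line_const) powr (h / 4)"
  proof (rule powr_mono2)
    have "z \<le> exp (z - 1)" using exp_ge_add_one_self[of "z - 1"] by simp
    then have "exp (- z) * (z * exp 1) \<le> 1"
      by (simp add: exp_diff exp_minus field_simps)
    then have "exp (- z) \<le> 1 / (z * exp 1)" using z by (simp add: pos_le_divide_eq)
    also have "\<dots> = E * N / line_const" using Epos Npos by (simp add: z_def line_const_def field_simps)
    finally show "exp (- z) \<le> E * N / line_const" .
  qed (use h in auto)
  also have "N * (E * N / line_const) powr (h / 4) = N powr (1 + h / 4) * (E / line_const) powr (h / 4)"
    using Npos Epos line_const_pos powr_mult[of "E / line_const" N "h / 4"]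
    by (simp add: powr_add mult_ac)
  finally have "N - h * D \<le> N powr (1 + h / 4) * (E / line_const) powr (h / 4)"
    using Npos by simp
  with P show ?thesis by (simp add: N_def E_def)
qed

text \<open>Both sides are homogeneous of degree \<open>2 + h\<close>, so \<open>w\<close> can be divided by its value of largest
  modulus.\<close>

lemma one_dim_interpolation:
  fixes w w' :: "real \<Rightarrow> real"
  assumes der: "\<And>s. (w has_real_derivative w' s) (at s)" and cont: "continuous_on UNIV w'"
    and supp: "\<And>s. L \<le> \<bar>s\<bar> \<Longrightarrow> w s = 0 \<and> w' s = 0" and h: "0 < h" "h \<le> 1 / 2"
  shows "(LINT s|lborel. \<bar>w s\<bar> powr (2 + h)) \<le>
    (LINT s|lborel. (w s)\<^sup>2) powr (1 + h / 4) * ((LINT s|lborel. (w' s)\<^sup>2) / line_const) powr (h / 4)"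
proof -
  have contw: "continuous_on UNIV w"
    using der by (meson DERIV_continuous_on UNIV_I has_field_derivative_at_within)
  have "\<exists>s0. \<forall>s. \<bar>w s\<bar> \<le> \<bar>w s0\<bar>"
  proof -
    let ?L = "\<bar>L\<bar>"
    have "\<exists>s0\<in>{-?L..?L}. \<forall>s\<in>{-?L..?L}. \<bar>w s\<bar> \<le> \<bar>w s0\<bar>"
      by (rule continuous_attains_sup) (auto intro!: continuous_intros continuous_on_subset[OF contw])
    then obtain s0 where "s0 \<in> {-?L..?L}" "\<And>s. s \<in> {-?L..?L} \<Longrightarrow> \<bar>w s\<bar> \<le> \<bar>w s0\<bar>"
      by blast
    moreover have "\<bar>w s\<bar> \<le> \<bar>w s0\<bar>" if "s \<notin> {-?L..?L}" for s
      using supp[of s] that by auto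
    ultimately show ?thesis by blast
  qed
  then obtain s0 where s0: "\<And>s. \<bar>w s\<bar> \<le> \<bar>w s0\<bar>" by blast
  show ?thesis
  proof (cases "w s0 = 0")
    case True
    with s0 have "w = (\<lambda>s. 0)" by (auto simp: fun_eq_iff)
    then show ?thesis by simp
  next
    case False
    define M where "M = \<bar>w s0\<bar>"
    have M: "M > 0" using False by (simp add: M_def)
    have scale: "c powr \<alpha> * c powr \<beta> * (X powr \<alpha> * Y powr \<beta>) = (c * X) powr \<alpha> * (c * Y) powr \<beta>"
      if "0 \<le> c" "0 \<le> X" "0 \<le> Y" for c X Y \<alpha> \<beta> :: real
      using that by (simp add: powr_mult)
    define v v' where "v s = w s / w s0" and "v' s = w' s / w s0" for s
    have "(LINT s|lborel. \<bar>v s\<bar> powr (2 + h)) \<le>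
        (LINT s|lborel. (v s)\<^sup>2) powr (1 + h / 4) * ((LINT s|lborel. (v' s)\<^sup>2) / line_const) powr (h / 4)"
    proof (rule one_dim_interpolation_normalized)
      show "(v has_real_derivative v' s) (at s)" for s
        unfolding v_def v'_def by (rule DERIV_cdivide[OF der])
      show "v s = 0 \<and> v' s = 0" if "L \<le> \<bar>s\<bar>" for s
        using supp[OF that] by (simp add: v_def v'_def)
      show "v s0 = 1" using False by (simp add: v_def)
      show "\<bar>v s\<bar> \<le> 1" for s
        using s0[of s] False by (simp add: v_def divide_le_eq_1)
      show "continuous_on UNIV v'"
        unfolding v'_def using False by (intro continuous_intros cont) auto
    qed (fact h)+
    also have "(LINT s|lborel. \<bar>v s\<bar> powr (2 + h)) = (LINT s|lborel. \<bar>w s\<bar> powr (2 + h)) / M powr (2 + h)"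
      using M by (simp add: v_def M_def powr_divide)
    also have "(LINT s|lborel. (v s)\<^sup>2) = (LINT s|lborel. (w s)\<^sup>2) / M\<^sup>2"
      by (simp add: v_def M_def power_divide)
    also have "(LINT s|lborel. (v' s)\<^sup>2) = (LINT s|lborel. (w' s)\<^sup>2) / M\<^sup>2"
      by (simp add: v'_def M_def power_divide)
    finally have "(LINT s|lborel. \<bar>w s\<bar> powr (2 + h)) \<le> M powr (2 + h) *
        (((LINT s|lborel. (w s)\<^sup>2) / M\<^sup>2) powr (1 + h / 4) * ((LINT s|lborel. (w' s)\<^sup>2) / M\<^sup>2 / line_const) powr (h / 4))"
      using M by (simp add: pos_divide_le_eq mult.commute)
    also have "M powr (2 + h) = (M\<^sup>2) powr (1 + h / 4) * (M\<^sup>2) powr (h / 4)"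
      using M by (simp add: powr_add[symmetric] powr_powr add.commute flip: powr_numeral)
    also have "\<dots> * (((LINT s|lborel. (w s)\<^sup>2) / M\<^sup>2) powr (1 + h / 4) *
          ((LINT s|lborel. (w' s)\<^sup>2) / M\<^sup>2 / line_const) powr (h / 4))
        = (M\<^sup>2 * ((LINT s|lborel. (w s)\<^sup>2) / M\<^sup>2)) powr (1 + h / 4) *
          (M\<^sup>2 * ((LINT s|lborel. (w' s)\<^sup>2) / M\<^sup>2 / line_const)) powr (h / 4)"
      by (rule scale) (use line_const_pos in auto)
    finally have fin: "(LINT s|lborel. \<bar>w s\<bar> powr (2 + h)) \<le>
        (M\<^sup>2 * ((LINT s|lborel. (w s)\<^sup>2) / M\<^sup>2)) powr (1 + h / 4) *
        (M\<^sup>2 * ((LINT s|lborel. (w' s)\<^sup>2) / M\<^sup>2 / line_const)) powr (h / 4)" .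
    have "M\<^sup>2 * (x / M\<^sup>2) = x" "M\<^sup>2 * (x / M\<^sup>2 / line_const) = x / line_const" for x
      using M by auto
    with fin show ?thesis by metis
  qed
qed

section \<open>The interpolation inequality for limits\<close>

text \<open>Along a subsequence the integrals are summable, so the series is finite almost everywhere and
  its terms tend to 0.\<close>

lemma nn_integral_tendsto_0_AE_subseq:
  fixes f :: "nat \<Rightarrow> 'a \<Rightarrow> ennreal"
  assumes [measurable]: "\<And>n. f n \<in> borel_measurable M"
    and lim: "(\<lambda>n. \<integral>\<^sup>+x. f n x \<partial>M) \<longlonglongrightarrow> 0"
  obtains r :: "nat \<Rightarrow> nat" where "strict_mono r" "AE x in M. (\<lambda>n. f (r n) x) \<longlonglongrightarrow> 0"
proof -
  have ex: "\<exists>n>k. (\<integral>\<^sup>+x. f n x \<partial>M) < ennreal ((1 / 2) ^ m)" for k m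
  proof -
    have "\<forall>\<^sub>F n in sequentially. (\<integral>\<^sup>+x. f n x \<partial>M) < ennreal ((1 / 2) ^ m)"
      by (rule order_tendstoD(2)[OF lim]) simp
    with eventually_gt_at_top[of k] have "\<forall>\<^sub>F n in sequentially. n > k \<and> (\<integral>\<^sup>+x. f n x \<partial>M) < ennreal ((1 / 2) ^ m)"
      by eventually_elim simp
    then show ?thesis using eventually_happens'[OF sequentially_bot] by blast
  qed
  have "\<exists>r. \<forall>n. (\<integral>\<^sup>+x. f (r n) x \<partial>M) < ennreal ((1 / 2) ^ n) \<and> r n < r (Suc n)"
  proof (rule dependent_nat_choice)
    show "\<exists>x. (\<integral>\<^sup>+y. f x y \<partial>M) < ennreal ((1 / 2) ^ 0)" using ex by blast
    show "\<exists>y. (\<integral>\<^sup>+z. f y z \<partial>M) < ennreal ((1 / 2) ^ Suc n) \<and> x < y" for x n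
      using ex[of x "Suc n"] by blast
  qed
  then obtain r where r: "\<And>n. (\<integral>\<^sup>+x. f (r n) x \<partial>M) < ennreal ((1 / 2) ^ n)" "strict_mono r"
    by (auto simp: strict_mono_Suc_iff)
  have "(\<integral>\<^sup>+x. (\<Sum>n. f (r n) x) \<partial>M) = (\<Sum>n. \<integral>\<^sup>+x. f (r n) x \<partial>M)"
    by (rule nn_integral_suminf) simp
  also have "\<dots> \<le> (\<Sum>n. ennreal ((1 / 2) ^ n))"
    by (intro suminf_le summableI less_imp_le r(1))
  also have "\<dots> = ennreal (\<Sum>n. (1 / 2) ^ n)"
    by (rule suminf_ennreal2) (auto intro: summable_geometric)
  also have "\<dots> < \<infinity>" by simp
  finally have "AE x in M. (\<Sum>n. f (r n) x) \<noteq> \<infinity>"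
    by (intro nn_integral_noteq_infinite) auto
  then have "AE x in M. (\<lambda>n. f (r n) x) \<longlonglongrightarrow> 0"
  proof eventually_elim
    case (elim x)
    then have fin: "f (r n) x \<noteq> top" for n
      by (metis ennreal_suminf_lessD infinity_ennreal_def top.not_eq_extremum)
    then have eq: "f (r n) x = ennreal (enn2real (f (r n) x))" for n by (simp add: less_top)
    have "summable (\<lambda>n. enn2real (f (r n) x))"
      by (rule summable_suminf_not_top) (use elim eq in auto)
    then have "(\<lambda>n. ennreal (enn2real (f (r n) x))) \<longlonglongrightarrow> ennreal 0"
      by (intro tendsto_ennrealI summable_LIMSEQ_zero)
    with eq show ?case by simp
  qed
  with r(2) that show thesis by blast
qed

lemma L2_norm_convergence:
  fixes f :: "nat \<Rightarrow> 'a \<Rightarrow> real"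
  assumes [measurable]: "g \<in> borel_measurable M"
    and I: "\<And>n. integrable M (\<lambda>x. (f n x)\<^sup>2)" and meas [measurable]: "\<And>n. f n \<in> borel_measurable M"
    and lim: "(\<lambda>n. \<integral>\<^sup>+x. ennreal ((f n x - g x)\<^sup>2) \<partial>M) \<longlonglongrightarrow> 0"
  shows "integrable M (\<lambda>x. (g x)\<^sup>2)"
    and "(\<lambda>n. LINT x|M. (f n x)\<^sup>2) \<longlonglongrightarrow> (LINT x|M. (g x)\<^sup>2)"
proof -
  have "\<forall>\<^sub>F n in sequentially. (\<integral>\<^sup>+x. ennreal ((f n x - g x)\<^sup>2) \<partial>M) < \<infinity>"
    by (rule order_tendstoD(2)[OF lim]) simp
  then have ev: "\<forall>\<^sub>F n in sequentially. integrable M (\<lambda>x. (f n x - g x)\<^sup>2)"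
    by eventually_elim (auto intro!: integrableI_nonneg)
  then obtain m where m: "integrable M (\<lambda>x. (f m x - g x)\<^sup>2)"
    by (auto simp: eventually_sequentially)
  show Ig: "integrable M (\<lambda>x. (g x)\<^sup>2)"
  proof (rule Bochner_Integration.integrable_bound)
    show "integrable M (\<lambda>x. 2 * (f m x)\<^sup>2 + 2 * (f m x - g x)\<^sup>2)"
      using I m by auto
    have "(b :: real)\<^sup>2 \<le> 2 * a\<^sup>2 + 2 * (a - b)\<^sup>2" for a b
      using zero_le_power2[of "2 * a - b"] by (simp add: power2_eq_square algebra_simps)
    then show "AE x in M. norm ((g x)\<^sup>2) \<le> norm (2 * (f m x)\<^sup>2 + 2 * (f m x - g x)\<^sup>2)"
      by (intro AE_I2) simp
  qed simp
  define D where "D n = (LINT x|M. (f n x - g x)\<^sup>2)" for n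
  define F where "F = (LINT x|M. (g x)\<^sup>2)"
  have D0: "D \<longlonglongrightarrow> 0"
  proof -
    have "(\<lambda>n. enn2real (\<integral>\<^sup>+x. ennreal ((f n x - g x)\<^sup>2) \<partial>M)) \<longlonglongrightarrow> enn2real 0"
      by (rule tendsto_enn2real) (use lim in simp_all)
    then show ?thesis by (simp add: D_def[abs_def] integral_eq_nn_integral)
  qed
  have bound: "\<forall>\<^sub>F n in sequentially. norm ((LINT x|M. (f n x)\<^sup>2) - F) \<le> D n + 2 * sqrt (D n * F)"
    using ev
  proof eventually_elim
    case (elim n)
    have Ic: "integrable M (\<lambda>x. (f n x - g x) * g x)"
    proof (rule Bochner_Integration.integrable_bound)
      show "integrable M (\<lambda>x. (f n x - g x)\<^sup>2 + (g x)\<^sup>2)" using elim Ig by auto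
      have "\<bar>a * b\<bar> \<le> a\<^sup>2 + b\<^sup>2" for a b :: real
      proof -
        have "2 * \<bar>a * b\<bar> \<le> a\<^sup>2 + b\<^sup>2"
          using zero_le_power2[of "\<bar>a\<bar> - \<bar>b\<bar>"]
          by (simp add: power2_eq_square algebra_simps abs_mult)
        then show ?thesis using abs_ge_zero[of "a * b"] by linarith
      qed
      then show "AE x in M. norm ((f n x - g x) * g x) \<le> norm ((f n x - g x)\<^sup>2 + (g x)\<^sup>2)"
        by (intro AE_I2) simp
    qed simp
    have "(LINT x|M. (f n x)\<^sup>2) = (LINT x|M. (f n x - g x)\<^sup>2 + 2 * ((f n x - g x) * g x) + (g x)\<^sup>2)"
      by (simp add: power2_eq_square algebra_simps)
    also have "\<dots> = D n + 2 * (LINT x|M. (f n x - g x) * g x) + F"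
      using elim Ig Ic by (simp add: D_def F_def)
    finally have eq: "(LINT x|M. (f n x)\<^sup>2) - F = D n + 2 * (LINT x|M. (f n x - g x) * g x)" by simp
    have "\<bar>LINT x|M. (f n x - g x) * g x\<bar> \<le> sqrt (D n * F)"
      using integral_Cauchy_Schwarz[OF elim Ig Ic] by (simp add: D_def F_def real_le_rsqrt)
    moreover have "D n \<ge> 0" by (simp add: D_def)
    ultimately show ?case by (simp add: eq)
  qed
  have "(\<lambda>n. D n + 2 * sqrt (D n * F)) \<longlonglongrightarrow> 0 + 2 * sqrt (0 * F)"
    by (intro tendsto_intros D0)
  then have "(\<lambda>n. (LINT x|M. (f n x)\<^sup>2) - F) \<longlonglongrightarrow> 0"
    by (intro Lim_null_comparison[OF bound]) simp
  then show "(\<lambda>n. LINT x|M. (f n x)\<^sup>2) \<longlonglongrightarrow> (LINT x|M. (g x)\<^sup>2)"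
    by (simp add: F_def LIM_zero_iff)
qed

text \<open>The mixed term is the integral of the derivative of \<open>w\<^sup>2 / 2\<close>. This is how the term
  \<open>k\<^sup>2 \<integral>w\<^sup>2\<close>, and with it the dependence of the radial constant on \<open>a\<close>, arises.\<close>

lemma integral_square_shifted_derivative:
  fixes w w' :: "real \<Rightarrow> real"
  assumes der: "\<And>s. (w has_real_derivative w' s) (at s)" and cont: "continuous_on UNIV w'"
    and supp: "\<And>s. L \<le> \<bar>s\<bar> \<Longrightarrow> w s = 0 \<and> w' s = 0"
  shows "integrable lborel (\<lambda>s. (w s)\<^sup>2)" "integrable lborel (\<lambda>s. (w' s - k * w s)\<^sup>2)"
    "(LINT s|lborel. (w' s - k * w s)\<^sup>2) = (LINT s|lborel. (w' s)\<^sup>2) + k\<^sup>2 * (LINT s|lborel. (w s)\<^sup>2)"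
proof -
  have contw: "continuous_on UNIV w"
    using der by (meson DERIV_continuous_on UNIV_I has_field_derivative_at_within)
  have I: "integrable lborel (\<lambda>s. (w s)\<^sup>2)" "integrable lborel (\<lambda>s. (w' s)\<^sup>2)"
    "integrable lborel (\<lambda>s. w s * w' s)" "integrable lborel (\<lambda>s. (w' s - k * w s)\<^sup>2)"
    by (rule integrable_continuous_bounded_support(1)[of _ L];
        use supp in \<open>auto intro!: continuous_intros contw cont\<close>)+
  show "integrable lborel (\<lambda>s. (w s)\<^sup>2)" "integrable lborel (\<lambda>s. (w' s - k * w s)\<^sup>2)"
    by (fact I)+
  have "(LINT s|lborel. w s * w' s) = integral {-\<bar>L\<bar>..\<bar>L\<bar>} (\<lambda>s. w s * w' s)"
    by (rule integrable_continuous_bounded_support(2))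
       (use supp in \<open>auto intro!: continuous_intros contw cont\<close>)
  also have "((\<lambda>s. w s * w' s) has_integral (w \<bar>L\<bar>)\<^sup>2 / 2 - (w (-\<bar>L\<bar>))\<^sup>2 / 2) {-\<bar>L\<bar>..\<bar>L\<bar>}"
  proof (rule fundamental_theorem_of_calculus)
    have "((\<lambda>s. (w s)\<^sup>2 / 2) has_real_derivative w s * w' s) (at s)" for s
      using der[of s] by (auto intro!: derivative_eq_intros)
    then show "((\<lambda>s. (w s)\<^sup>2 / 2) has_vector_derivative w s * w' s) (at s within {-\<bar>L\<bar>..\<bar>L\<bar>})" for s
      unfolding has_real_derivative_iff_has_vector_derivative
      by (rule has_vector_derivative_at_within)
  qed simp
  then have "integral {-\<bar>L\<bar>..\<bar>L\<bar>} (\<lambda>s. w s * w' s) = 0"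
    using supp[of "\<bar>L\<bar>"] supp[of "- \<bar>L\<bar>"] by (simp add: integral_unique)
  finally have cross: "(LINT s|lborel. w s * w' s) = 0" .
  have "(LINT s|lborel. (w' s - k * w s)\<^sup>2) =
      (LINT s|lborel. (w' s)\<^sup>2 - 2 * k * (w s * w' s) + k\<^sup>2 * (w s)\<^sup>2)"
    by (simp add: power2_eq_square algebra_simps)
  also have "\<dots> = (LINT s|lborel. (w' s)\<^sup>2) + k\<^sup>2 * (LINT s|lborel. (w s)\<^sup>2)"
    using I cross by simp
  finally show "(LINT s|lborel. (w' s - k * w s)\<^sup>2) =
      (LINT s|lborel. (w' s)\<^sup>2) + k\<^sup>2 * (LINT s|lborel. (w s)\<^sup>2)" .
qed

text \<open>The square norms converge, so the right-hand sides converge, and Fatou's lemma handles the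
  left-hand sides along a subsequence that converges almost everywhere. The derivative enters
  through \<open>w' - k w\<close>, because this is what the gradient becomes along a ray.\<close>

lemma one_dim_interpolation_limit:
  fixes w w' :: "nat \<Rightarrow> real \<Rightarrow> real" and u z :: "real \<Rightarrow> real"
  assumes der: "\<And>n s. (w n has_real_derivative w' n s) (at s)"
    and cont: "\<And>n. continuous_on UNIV (w' n)"
    and supp: "\<And>n. \<exists>L. \<forall>s. L \<le> \<bar>s\<bar> \<longrightarrow> w n s = 0 \<and> w' n s = 0"
    and [measurable]: "u \<in> borel_measurable borel" "z \<in> borel_measurable borel"
    and limu: "(\<lambda>n. \<integral>\<^sup>+s. ennreal ((w n s - u s)\<^sup>2) \<partial>lborel) \<longlonglongrightarrow> 0"
    and limz: "(\<lambda>n. \<integral>\<^sup>+s. ennreal (((w' n s - k * w n s) - z s)\<^sup>2) \<partial>lborel) \<longlonglongrightarrow> 0"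
    and h: "0 < h" "h \<le> 1 / 2"
  shows "\<exists>N A. 0 \<le> N \<and> k\<^sup>2 * N \<le> A \<and> (\<integral>\<^sup>+s. ennreal ((u s)\<^sup>2) \<partial>lborel) = ennreal N \<and>
    (\<integral>\<^sup>+s. ennreal ((z s)\<^sup>2) \<partial>lborel) = ennreal A \<and>
    (\<integral>\<^sup>+s. ennreal (\<bar>u s\<bar> powr (2 + h)) \<partial>lborel)
      \<le> ennreal (N powr (1 + h / 4) * ((A - k\<^sup>2 * N) / line_const) powr (h / 4))"
proof -
  have contw: "continuous_on UNIV (w n)" for n
    using der by (meson DERIV_continuous_on UNIV_I has_field_derivative_at_within)
  have [measurable]: "w n \<in> borel_measurable borel" "w' n \<in> borel_measurable borel" for n
    by (intro borel_measurable_continuous_onI contw cont)+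
  obtain L where L: "\<And>n s. L n \<le> \<bar>s\<bar> \<Longrightarrow> w n s = 0 \<and> w' n s = 0"
    using supp by metis
  note sq = integral_square_shifted_derivative(1)[where L = "L n" for n, OF der cont L]
    integral_square_shifted_derivative(2,3)[where k = k and L = "L n" for n, OF der cont L]
  define N where "N = (LINT s|lborel. (u s)\<^sup>2)"
  define A where "A = (LINT s|lborel. (z s)\<^sup>2)"
  define E where "E n = (LINT s|lborel. (w' n s)\<^sup>2)" for n
  have Iu: "integrable lborel (\<lambda>s. (u s)\<^sup>2)"
    and Nlim: "(\<lambda>n. LINT s|lborel. (w n s)\<^sup>2) \<longlonglongrightarrow> N"
    unfolding N_def by (rule L2_norm_convergence[OF _ sq(1) _ limu]; simp)+
  have Iz: "integrable lborel (\<lambda>s. (z s)\<^sup>2)"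
    and Alim: "(\<lambda>n. LINT s|lborel. (w' n s - k * w n s)\<^sup>2) \<longlonglongrightarrow> A"
    unfolding A_def by (rule L2_norm_convergence[OF _ sq(2) _ limz]; simp)+
  have E_eq: "E n = (LINT s|lborel. (w' n s - k * w n s)\<^sup>2) - k\<^sup>2 * (LINT s|lborel. (w n s)\<^sup>2)" for n
    using sq(3)[of n] by (simp add: E_def)
  have Elim: "E \<longlonglongrightarrow> A - k\<^sup>2 * N"
    unfolding E_eq by (intro tendsto_intros Alim Nlim)
  have E0: "0 \<le> E n" for n by (simp add: E_def)
  then have "0 \<le> A - k\<^sup>2 * N" by (intro LIMSEQ_le_const[OF Elim]) auto
  moreover have N0: "0 \<le> N" by (simp add: N_def)
  define B where "B n = (LINT s|lborel. (w n s)\<^sup>2) powr (1 + h / 4) * (E n / line_const) powr (h / 4)" for n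
  have Blim: "B \<longlonglongrightarrow> N powr (1 + h / 4) * ((A - k\<^sup>2 * N) / line_const) powr (h / 4)"
    unfolding B_def
    by (intro tendsto_mult tendsto_powr' tendsto_divide Elim Nlim tendsto_const disjI2 conjI always_eventually allI)
       (use h line_const_pos E0 in auto)
  have P: "(\<integral>\<^sup>+s. ennreal (\<bar>w n s\<bar> powr (2 + h)) \<partial>lborel) \<le> ennreal (B n)" for n
  proof -
    have "integrable lborel (\<lambda>s. \<bar>w n s\<bar> powr (2 + h))"
      by (rule integrable_continuous_bounded_support(1)[of _ "L n"])
         (use L h in \<open>auto intro!: continuous_intros continuous_on_powr' contw\<close>)
    then have "(\<integral>\<^sup>+s. ennreal (\<bar>w n s\<bar> powr (2 + h)) \<partial>lborel) = ennreal (LINT s|lborel. \<bar>w n s\<bar> powr (2 + h))"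
      by (intro nn_integral_eq_integral) auto
    also have "\<dots> \<le> ennreal (B n)"
      unfolding B_def E_def by (intro ennreal_leI one_dim_interpolation[OF der cont L h])
    finally show ?thesis .
  qed
  obtain r where r: "strict_mono r" "AE s in lborel. (\<lambda>n. ennreal ((w (r n) s - u s)\<^sup>2)) \<longlonglongrightarrow> 0"
    using nn_integral_tendsto_0_AE_subseq[OF _ limu] by auto
  have "AE s in lborel. liminf (\<lambda>n. ennreal (\<bar>w (r n) s\<bar> powr (2 + h))) = ennreal (\<bar>u s\<bar> powr (2 + h))"
    using r(2)
  proof eventually_elim
    case (elim s)
    then have "(\<lambda>n. enn2real (ennreal ((w (r n) s - u s)\<^sup>2))) \<longlonglongrightarrow> enn2real 0"
      by (intro tendsto_enn2real) simp_all
    then have "(\<lambda>n. (w (r n) s - u s)\<^sup>2) \<longlonglongrightarrow> 0" by simp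
    then have "(\<lambda>n. w (r n) s - u s) \<longlonglongrightarrow> 0"
      using tendsto_real_sqrt by (fastforce simp: tendsto_rabs_zero_iff)
    then have "(\<lambda>n. w (r n) s) \<longlonglongrightarrow> u s" by (simp add: LIM_zero_iff)
    then have "(\<lambda>n. ennreal (\<bar>w (r n) s\<bar> powr (2 + h))) \<longlonglongrightarrow> ennreal (\<bar>u s\<bar> powr (2 + h))"
      by (intro tendsto_ennrealI tendsto_powr' tendsto_rabs tendsto_const) (use h in auto)
    then show ?case by (intro lim_imp_Liminf) auto
  qed
  then have fatou1: "(\<integral>\<^sup>+s. ennreal (\<bar>u s\<bar> powr (2 + h)) \<partial>lborel) =
      (\<integral>\<^sup>+s. liminf (\<lambda>n. ennreal (\<bar>w (r n) s\<bar> powr (2 + h))) \<partial>lborel)"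
    by (intro nn_integral_cong_AE) auto
  have fatou2: "(\<integral>\<^sup>+s. liminf (\<lambda>n. ennreal (\<bar>w (r n) s\<bar> powr (2 + h))) \<partial>lborel)
      \<le> liminf (\<lambda>n. \<integral>\<^sup>+s. ennreal (\<bar>w (r n) s\<bar> powr (2 + h)) \<partial>lborel)"
    by (rule nn_integral_liminf) simp
  have fatou3: "liminf (\<lambda>n. \<integral>\<^sup>+s. ennreal (\<bar>w (r n) s\<bar> powr (2 + h)) \<partial>lborel)
      \<le> liminf (\<lambda>n. ennreal (B (r n)))"
    by (rule Liminf_mono) (simp add: P)
  have fatou4: "liminf (\<lambda>n. ennreal (B (r n))) = ennreal (N powr (1 + h / 4) * ((A - k\<^sup>2 * N) / line_const) powr (h / 4))"
    by (intro lim_imp_Liminf tendsto_ennrealI)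
       (use LIMSEQ_subseq_LIMSEQ[OF Blim r(1)] in \<open>auto simp: o_def\<close>)
  have "(\<integral>\<^sup>+s. ennreal (\<bar>u s\<bar> powr (2 + h)) \<partial>lborel)
      \<le> ennreal (N powr (1 + h / 4) * ((A - k\<^sup>2 * N) / line_const) powr (h / 4))"
    using fatou1 fatou2 fatou3 fatou4 by simp
  moreover have "(\<integral>\<^sup>+s. ennreal ((u s)\<^sup>2) \<partial>lborel) = ennreal N"
    "(\<integral>\<^sup>+s. ennreal ((z s)\<^sup>2) \<partial>lborel) = ennreal A"
    using Iu Iz by (simp_all add: N_def A_def nn_integral_eq_integral)
  ultimately show ?thesis using N0 by (intro exI[of _ N] exI[of _ A]) auto
qed

section \<open>Test functions and radial functions along rays\<close>

lemma smooth_differentiable: "smooth f \<Longrightarrow> f differentiable (at x)"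
  unfolding smooth_def by (metis fold_simps(1))

lemma smooth_partial_deriv_differentiable: "smooth f \<Longrightarrow> partial_deriv i f differentiable (at x)"
  unfolding smooth_def by (metis fold_simps)

lemma smooth_continuous: "smooth f \<Longrightarrow> continuous_on S f"
  by (meson continuous_at_imp_continuous_on differentiable_imp_continuous_within smooth_differentiable)

lemma smooth_grad_continuous: "smooth f \<Longrightarrow> continuous_on S (grad f)"
  unfolding grad_def
  by (intro continuous_on_vec_lambda)
     (meson continuous_at_imp_continuous_on differentiable_imp_continuous_within
        smooth_partial_deriv_differentiable)

lemma has_derivative_grad:
  assumes "f differentiable (at x)"
  shows "(f has_derivative (\<lambda>v. grad f x \<bullet> v)) (at x)"
proof -
  let ?D = "frechet_derivative f (at x)"
  have D: "(f has_derivative ?D) (at x)" by (rule has_derivative_frechet[OF assms])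
  then have lin: "linear ?D" by (rule has_derivative_linear)
  have "?D v = grad f x \<bullet> v" for v
  proof -
    have "?D v = ?D (\<Sum>i\<in>UNIV. v $ i *\<^sub>R axis i 1)"
      by (subst basis_expansion[of v, symmetric]) (simp add: scalar_mult_eq_scaleR)
    also have "\<dots> = (\<Sum>i\<in>UNIV. v $ i * ?D (axis i 1))"
      by (simp add: linear_sum[OF lin] linear_scale[OF lin])
    also have "\<dots> = grad f x \<bullet> v"
      by (simp add: inner_vec_def grad_def partial_deriv_def mult.commute)
    finally show ?thesis .
  qed
  then have "?D = (\<lambda>v. grad f x \<bullet> v)" by auto
  with D show ?thesis by simp
qed

lemma grad_eqI:
  assumes "(f has_derivative (\<lambda>v. g \<bullet> v)) (at x)"
  shows "grad f x = g"
  by (simp add: grad_def partial_deriv_def frechet_derivative_at[OF assms, symmetric]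
      inner_axis vec_eq_iff)

text \<open>Outside the closure of the support the function vanishes in a neighbourhood, so its gradient
  vanishes too.\<close>

lemma test_function_support:
  fixes \<phi> :: "real ^ 'n::finite \<Rightarrow> real"
  assumes "test_function \<phi>"
  obtains r R where "0 < r" "\<And>x. norm x < r \<or> R < norm x \<Longrightarrow> \<phi> x = 0 \<and> grad \<phi> x = 0"
proof -
  let ?K = "closure {x. \<phi> x \<noteq> 0}"
  have K: "compact ?K" "0 \<notin> ?K" and sm: "smooth \<phi>" using assms by (auto simp: test_function_def)
  have out: "\<phi> x = 0 \<and> grad \<phi> x = 0" if "x \<notin> ?K" for x
  proof -
    have "\<phi> x = 0" using that closure_subset[of "{x. \<phi> x \<noteq> 0}"] by auto
    moreover have "(\<phi> has_derivative (\<lambda>v. 0 \<bullet> v)) (at x)"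
    proof (rule has_derivative_transform_within_open)
      show "((\<lambda>x. 0) has_derivative (\<lambda>v. 0 \<bullet> v)) (at x)" by simp
      show "open (- ?K)" by (intro open_Compl closed_closure)
      show "x \<in> - ?K" using that by simp
      show "0 = \<phi> y" if "y \<in> - ?K" for y
        using that closure_subset[of "{x. \<phi> x \<noteq> 0}"] by auto
    qed
    ultimately show ?thesis by (simp add: grad_eqI)
  qed
  obtain R where R: "\<And>x. x \<in> ?K \<Longrightarrow> norm x \<le> R"
    using compact_imp_bounded[OF K(1)] by (auto simp: bounded_iff)
  obtain r where r: "r > 0" "ball 0 r \<subseteq> - ?K"
    using K(2) open_contains_ball[of "- ?K"] by auto
  show thesis
  proof (rule that[OF r(1)])
    fix x :: "real ^ 'n" assume "norm x < r \<or> R < norm x"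
    then have "x \<notin> ?K" using R[of x] r(2) by (auto simp: subset_iff)
    then show "\<phi> x = 0 \<and> grad \<phi> x = 0" by (rule out)
  qed
qed

text \<open>The factor \<open>|x| powr k\<close> turns the weighted norms of \<open>u\<close> into unweighted norms along the rays.\<close>

definition ray :: "real \<Rightarrow> (real ^ 'n::finite \<Rightarrow> real) \<Rightarrow> real ^ 'n \<Rightarrow> real \<Rightarrow> real" where
  "ray k u y s = norm (exp s *\<^sub>R y) powr k * u (exp s *\<^sub>R y)"

text \<open>The weighted radial derivative; for \<open>G = grad u\<close> it equals \<open>w' - k w\<close> with \<open>w = ray k u y\<close>.\<close>

definition ray_slope :: "real \<Rightarrow> (real ^ 'n::finite \<Rightarrow> real ^ 'n) \<Rightarrow> real ^ 'n \<Rightarrow> real \<Rightarrow> real" where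
  "ray_slope k G y s = norm (exp s *\<^sub>R y) powr k * (G (exp s *\<^sub>R y) \<bullet> (exp s *\<^sub>R y))"

lemma ray_measurable:
  assumes [measurable]: "u \<in> borel_measurable borel"
  shows "ray k u y \<in> borel_measurable borel"
  unfolding ray_def by measurable

lemma ray_slope_measurable:
  assumes [measurable]: "G \<in> borel_measurable borel"
  shows "ray_slope k G y \<in> borel_measurable borel"
  unfolding ray_slope_def by measurable

lemma ray_has_derivative:
  assumes "smooth \<phi>" "y \<noteq> 0"
  shows "(ray k \<phi> y has_real_derivative k * ray k \<phi> y s + ray_slope k (grad \<phi>) y s) (at s)"
proof -
  have n: "norm (exp s *\<^sub>R y) = exp s * norm y" for s by simp
  have "((\<lambda>s. exp s *\<^sub>R y) has_vector_derivative exp s *\<^sub>R y) (at s)"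
    by (auto intro!: derivative_eq_intros simp: has_real_derivative_iff_has_vector_derivative[symmetric])
  then have "((\<lambda>s. \<phi> (exp s *\<^sub>R y)) has_derivative (\<lambda>t. grad \<phi> (exp s *\<^sub>R y) \<bullet> (t *\<^sub>R exp s *\<^sub>R y))) (at s)"
    unfolding has_vector_derivative_def
    by (rule has_derivative_compose[OF _ has_derivative_grad[OF smooth_differentiable[OF assms(1)]]])
  then have d1: "((\<lambda>s. \<phi> (exp s *\<^sub>R y)) has_real_derivative grad \<phi> (exp s *\<^sub>R y) \<bullet> (exp s *\<^sub>R y)) (at s)"
    by (simp add: has_field_derivative_def mult_commute_abs mult.assoc)
  have pos: "exp s * norm y > 0" using assms(2) by simp
  have "((\<lambda>s. (exp s * norm y) powr k) has_real_derivative
      k * (exp s * norm y) powr (k - 1) * (exp s * norm y)) (at s)"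
    using pos by (auto intro!: derivative_eq_intros)
  also have "k * (exp s * norm y) powr (k - 1) * (exp s * norm y) = k * (exp s * norm y) powr k"
    using pos by (simp add: powr_diff)
  finally have d2: "((\<lambda>s. (exp s * norm y) powr k) has_real_derivative k * (exp s * norm y) powr k) (at s)" .
  show ?thesis
    unfolding ray_def[abs_def] ray_slope_def n
    using DERIV_mult[OF d2 d1] by (simp add: mult_ac)
qed

lemma ray_bounded_support:
  assumes "test_function \<phi>" "y \<noteq> 0"
  shows "\<exists>L. \<forall>s. L \<le> \<bar>s\<bar> \<longrightarrow> ray k \<phi> y s = 0 \<and> k * ray k \<phi> y s + ray_slope k (grad \<phi>) y s = 0"
proof -
  obtain r R where r: "0 < r" and rR: "\<And>x. norm x < r \<or> R < norm x \<Longrightarrow> \<phi> x = 0 \<and> grad \<phi> x = 0"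
    using test_function_support[OF assms(1)] by blast
  \<comment> \<open>The ray is in the small ball before the time \<open>a\<close> and outside the large ball after the time \<open>b\<close>.\<close>
  define a b where "a = ln (r / norm y) - 1" and "b = ln ((\<bar>R\<bar> + 1) / norm y)"
  have ny: "norm y > 0" using assms(2) by simp
  have "\<phi> (exp s *\<^sub>R y) = 0 \<and> grad \<phi> (exp s *\<^sub>R y) = 0" if "\<bar>a\<bar> + \<bar>b\<bar> \<le> \<bar>s\<bar>" for s
  proof (rule rR)
    have "s \<le> a \<or> b \<le> s" using that by linarith
    then show "norm (exp s *\<^sub>R y) < r \<or> R < norm (exp s *\<^sub>R y)"
    proof
      assume "s \<le> a"
      then have "exp s \<le> exp a" by simp
      also have "\<dots> < r / norm y" using r ny by (simp add: a_def exp_diff field_simps)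
      finally show ?thesis using ny by (simp add: field_simps)
    next
      assume "b \<le> s"
      then have "exp b \<le> exp s" by simp
      moreover have "exp b = (\<bar>R\<bar> + 1) / norm y" using ny by (simp add: b_def)
      ultimately have "\<bar>R\<bar> + 1 \<le> exp s * norm y" using ny by (simp add: field_simps)
      then show ?thesis by auto
    qed
  qed
  then show ?thesis
    by (intro exI[of _ "\<bar>a\<bar> + \<bar>b\<bar>"]) (simp add: ray_def ray_slope_def)
qed

lemma nn_integral_translate:
  fixes f :: "real \<Rightarrow> ennreal"
  assumes [measurable]: "f \<in> borel_measurable borel"
  shows "(\<integral>\<^sup>+s. f (c + s) \<partial>lborel) = (\<integral>\<^sup>+s. f s \<partial>lborel)"
  by (subst (2) lborel_distr_plus[of c, symmetric]) (simp add: nn_integral_distr)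

lemma AE_translate: "AE s in lborel. P s \<Longrightarrow> AE s in lborel. P (c + s :: real)"
  using AE_distrD[of "(+) c" lborel borel P, unfolded lborel_distr_plus] by simp

lemma shell_nontrivial: "\<not> (AE y in (shell :: (real ^ 'n::finite) measure). False)"
  using shell_mass_pos[where 'n = 'n] emeasure_shell[where 'n = 'n]
  by (auto simp: AE_iff_measurable[of UNIV] sets_shell)

text \<open>Along two rays a radial function takes the same values up to a translation in \<open>s\<close>, and the
  integral over the line does not see translations. The profile \<open>f\<close> may fail to be measurable,
  so it is only used to compare the values of \<open>u\<close> on two rays.\<close>

lemma radial_ray_integral_constant:
  fixes \<Phi> :: "real \<Rightarrow> real \<Rightarrow> ennreal"
  assumes "radially_symmetric (u :: real ^ 'n::finite \<Rightarrow> real)"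
    and meas: "\<And>y. (\<lambda>s. \<Phi> (norm (exp s *\<^sub>R y)) (u (exp s *\<^sub>R y))) \<in> borel_measurable borel"
  shows "\<exists>c. AE y in shell. (\<integral>\<^sup>+s. \<Phi> (norm (exp s *\<^sub>R y)) (u (exp s *\<^sub>R y)) \<partial>lborel) = c"
proof -
  obtain f where "AE x in lborel. u x = f (norm x)"
    using assms(1) by (auto simp: radially_symmetric_def)
  from AE_log_polar[OF this] AE_shell_nonzero
  have good: "AE y in shell. y \<noteq> 0 \<and> (AE s in lborel. u (exp s *\<^sub>R y) = f (norm (exp s *\<^sub>R y)))"
    by eventually_elim simp
  have "\<exists>z. z \<noteq> 0 \<and> (AE s in lborel. u (exp s *\<^sub>R z) = f (norm (exp s *\<^sub>R z)))"
  proof (rule ccontr)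
    assume none: "\<not> ?thesis"
    from good have "AE y in (shell :: (real ^ 'n) measure). False"
      by eventually_elim (use none in blast)
    with shell_nontrivial show False by blast
  qed
  then obtain z :: "real ^ 'n" where z: "z \<noteq> 0" "AE s in lborel. u (exp s *\<^sub>R z) = f (norm (exp s *\<^sub>R z))"
    by blast
  define I where "I y = (\<integral>\<^sup>+s. \<Phi> (norm (exp s *\<^sub>R y)) (u (exp s *\<^sub>R y)) \<partial>lborel)" for y
  have "AE y in shell. I y = I z"
    using good
  proof eventually_elim
    case (elim y)
    \<comment> \<open>the logarithmic time by which the ray through \<open>y\<close> is ahead of the one through \<open>z\<close>\<close>
    define \<tau> where "\<tau> = ln (norm z) - ln (norm y)"
    have sh: "norm (exp (\<tau> + s) *\<^sub>R y) = norm (exp s *\<^sub>R z)" for s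
      using elim z(1) by (simp add: \<tau>_def exp_add exp_diff)
    have "I y = (\<integral>\<^sup>+s. \<Phi> (norm (exp (\<tau> + s) *\<^sub>R y)) (u (exp (\<tau> + s) *\<^sub>R y)) \<partial>lborel)"
      unfolding I_def by (rule nn_integral_translate[OF meas, symmetric])
    also have "\<dots> = I z"
      unfolding I_def
    proof (rule nn_integral_cong_AE)
      have "AE s in lborel. u (exp (\<tau> + s) *\<^sub>R y) = f (norm (exp (\<tau> + s) *\<^sub>R y))"
        using elim AE_translate[of "\<lambda>s. u (exp s *\<^sub>R y) = f (norm (exp s *\<^sub>R y))" \<tau>] by blast
      with z(2) show "AE s in lborel. \<Phi> (norm (exp (\<tau> + s) *\<^sub>R y)) (u (exp (\<tau> + s) *\<^sub>R y)) =
          \<Phi> (norm (exp s *\<^sub>R z)) (u (exp s *\<^sub>R z))"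
        by eventually_elim (simp only: sh)
    qed
    finally show ?case .
  qed
  then show ?thesis by (auto simp: I_def)
qed

section \<open>Radial functions in the weighted Sobolev space\<close>

text \<open>The exponents of the three weights are such that they are absorbed by the volume element and
  the factor \<open>|x| powr k\<close>.\<close>

lemma weight_value:
  fixes x :: "real ^ 'n::finite"
  assumes "x \<noteq> 0" and k: "k = a_crit CARD('n) - a"
  shows "v\<^sup>2 / norm x powr (2 * (a + 1)) * norm x ^ CARD('n) = (norm x powr k * v)\<^sup>2"
proof -
  have pos: "norm x > 0" using assms by simp
  have "2 * (a + 1) + 2 * k = real CARD('n)" by (simp add: k a_crit_def field_simps)
  then have "norm x ^ CARD('n) = norm x powr (2 * (a + 1) + 2 * k)"
    using pos by (simp add: powr_realpow)
  then have "norm x ^ CARD('n) / norm x powr (2 * (a + 1)) = norm x powr (2 * k)"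
    using pos by (simp add: powr_add)
  also have "\<dots> = (norm x powr k)\<^sup>2"
    by (simp add: power2_eq_square powr_add[symmetric])
  finally have *: "norm x ^ CARD('n) / norm x powr (2 * (a + 1)) = (norm x powr k)\<^sup>2" .
  have "v\<^sup>2 / norm x powr (2 * (a + 1)) * norm x ^ CARD('n) =
      norm x ^ CARD('n) / norm x powr (2 * (a + 1)) * v\<^sup>2" by simp
  then show ?thesis unfolding * by (simp add: power_mult_distrib)
qed

lemma weight_gradient:
  fixes x :: "real ^ 'n::finite"
  assumes "x \<noteq> 0" and k: "k = a_crit CARD('n) - a"
  shows "v\<^sup>2 / norm x powr (2 * a) * norm x ^ CARD('n) = (norm x powr k * (v * norm x))\<^sup>2"
proof -
  have "norm x powr (2 * (a + 1)) = norm x powr (2 * a) * (norm x)\<^sup>2"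
    using assms by (simp add: powr_add[of _ "2 * a" 2, symmetric] flip: powr_numeral)
  then show ?thesis
    using weight_value[OF assms, of "v * norm x"] assms(1) by (simp add: power_mult_distrib)
qed

lemma weight_density:
  fixes x :: "real ^ 'n::finite"
  assumes "x \<noteq> 0" and k: "k = a_crit CARD('n) - a" and "p > 0"
  shows "\<bar>v\<bar> powr p / norm x powr (b_exp CARD('n) p a * p) * norm x ^ CARD('n)
    = \<bar>norm x powr k * v\<bar> powr p"
proof -
  have pos: "norm x > 0" using assms by simp
  have "b_exp CARD('n) p a * p + k * p = real CARD('n)"
    using \<open>p > 0\<close> by (simp add: k b_exp_def field_simps)
  then have "norm x ^ CARD('n) = norm x powr (b_exp CARD('n) p a * p + k * p)"
    using pos by (simp add: powr_realpow)
  then have *: "norm x ^ CARD('n) / norm x powr (b_exp CARD('n) p a * p) = (norm x powr k) powr p"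
    using pos by (simp add: powr_add powr_powr)
  have "\<bar>v\<bar> powr p / norm x powr (b_exp CARD('n) p a * p) * norm x ^ CARD('n)
      = norm x ^ CARD('n) / norm x powr (b_exp CARD('n) p a * p) * \<bar>v\<bar> powr p"
    by simp
  then show ?thesis unfolding * by (simp add: abs_mult powr_mult)
qed

lemma ennreal_mult_eqI: "0 \<le> A \<Longrightarrow> 0 \<le> B \<Longrightarrow> A * B = C \<Longrightarrow> ennreal A * ennreal B = ennreal C"
  by (simp add: ennreal_mult[symmetric])

lemma log_polar_value:
  fixes u :: "real ^ 'n::finite \<Rightarrow> real"
  assumes [measurable]: "u \<in> borel_measurable borel" and k: "k = a_crit CARD('n) - a"
  shows "(\<integral>\<^sup>+x. ennreal (\<bar>u x\<bar>\<^sup>2 / norm x powr (2 * (a + 1))) \<partial>lborel) =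
    (\<integral>\<^sup>+y. (\<integral>\<^sup>+s. ennreal ((ray k u y s)\<^sup>2) \<partial>lborel) \<partial>shell)"
  by (subst nn_integral_log_polar, measurable)
     (rule shell_cong_nonzero, rule nn_integral_cong, rule ennreal_mult_eqI, simp, simp,
       subst weight_value[OF _ k], simp, simp add: ray_def power_mult_distrib)

lemma log_polar_density:
  fixes u :: "real ^ 'n::finite \<Rightarrow> real"
  assumes [measurable]: "u \<in> borel_measurable borel" and k: "k = a_crit CARD('n) - a" and "p > 0"
  shows "(\<integral>\<^sup>+x. ennreal (ckn_density p a u x) \<partial>lborel) =
    (\<integral>\<^sup>+y. (\<integral>\<^sup>+s. ennreal (\<bar>ray k u y s\<bar> powr p) \<partial>lborel) \<partial>shell)"
  unfolding ckn_density_def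
  by (subst nn_integral_log_polar, measurable)
     (rule shell_cong_nonzero, rule nn_integral_cong, rule ennreal_mult_eqI, simp, simp,
       subst weight_density[OF _ k \<open>p > 0\<close>], simp, simp add: ray_def)

text \<open>Only the radial component of \<open>G\<close> is kept, hence the inequality.\<close>

lemma log_polar_gradient:
  fixes G :: "real ^ 'n::finite \<Rightarrow> real ^ 'n"
  assumes [measurable]: "G \<in> borel_measurable borel" and k: "k = a_crit CARD('n) - a"
  shows "(\<integral>\<^sup>+y. (\<integral>\<^sup>+s. ennreal ((ray_slope k G y s)\<^sup>2) \<partial>lborel) \<partial>shell)
    \<le> (\<integral>\<^sup>+x. ennreal ((norm (G x))\<^sup>2 / norm x powr (2 * a)) \<partial>lborel)"
proof -
  have le: "ennreal ((ray_slope k G y s)\<^sup>2) \<le>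
      ennreal ((norm (exp s *\<^sub>R y) powr k * (norm (G (exp s *\<^sub>R y)) * norm (exp s *\<^sub>R y)))\<^sup>2)" for y s
    unfolding ray_slope_def power_mult_distrib
    by (intro ennreal_leI mult_left_mono)
       (auto simp: abs_le_square_iff[symmetric] power_mult_distrib[symmetric] Cauchy_Schwarz_ineq2 simp del: norm_scaleR inner_scaleR_right)
  have "(\<integral>\<^sup>+x. ennreal ((norm (G x))\<^sup>2 / norm x powr (2 * a)) \<partial>lborel) =
      (\<integral>\<^sup>+y. (\<integral>\<^sup>+s. ennreal ((norm (exp s *\<^sub>R y) powr k * (norm (G (exp s *\<^sub>R y)) * norm (exp s *\<^sub>R y)))\<^sup>2) \<partial>lborel) \<partial>shell)"
    by (subst nn_integral_log_polar, measurable)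
       (rule shell_cong_nonzero, rule nn_integral_cong, rule ennreal_mult_eqI, simp, simp,
         subst weight_gradient[OF _ k], simp, simp)
  then show ?thesis by (simp only:) (intro nn_integral_mono le)
qed

lemma test_function_measurable:
  assumes "test_function \<phi>"
  shows "\<phi> \<in> borel_measurable borel" "grad \<phi> \<in> borel_measurable borel"
  using assms unfolding test_function_def
  by (auto intro!: borel_measurable_continuous_onI smooth_continuous smooth_grad_continuous)

lemma ckn_density_measurable:
  assumes [measurable]: "u \<in> borel_measurable borel"
  shows "ckn_density p a u \<in> borel_measurable borel"
  unfolding ckn_density_def[abs_def] by measurable

text \<open>Convergence of test functions in the weighted norm is convergence in the mean over the rays,
  so a subsequence converges along almost every ray, where the one-dimensional inequality passes
  to the limit.\<close>

lemma D12_rays: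
  fixes u :: "real ^ 'n::finite \<Rightarrow> real"
  assumes D: "D12 a u G" and k: "k = a_crit CARD('n) - a" and h: "0 < h" "h \<le> 1 / 2"
  shows "AE y in shell. \<exists>N A. 0 \<le> N \<and> k\<^sup>2 * N \<le> A \<and>
    (\<integral>\<^sup>+s. ennreal ((ray k u y s)\<^sup>2) \<partial>lborel) = ennreal N \<and>
    (\<integral>\<^sup>+s. ennreal ((ray_slope k G y s)\<^sup>2) \<partial>lborel) = ennreal A \<and>
    (\<integral>\<^sup>+s. ennreal (\<bar>ray k u y s\<bar> powr (2 + h)) \<partial>lborel)
      \<le> ennreal (N powr (1 + h / 4) * ((A - k\<^sup>2 * N) / line_const) powr (h / 4))"
proof -
  obtain \<phi> where \<phi>: "\<And>n. test_function (\<phi> n)"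
    and lim: "(\<lambda>n::nat.
            (\<integral>\<^sup>+x. ennreal ((norm (grad (\<phi> n) x - G x))\<^sup>2 / norm x powr (2 * a)) \<partial>lborel)
          + (\<integral>\<^sup>+x. ennreal (\<bar>\<phi> n x - u x\<bar>\<^sup>2 / norm x powr (2 * (a + 1))) \<partial>lborel)) \<longlonglongrightarrow> 0"
    and [measurable]: "u \<in> borel_measurable borel" "G \<in> borel_measurable borel"
    using D unfolding D12_def by auto
  have [measurable]: "\<phi> n \<in> borel_measurable borel" "grad (\<phi> n) \<in> borel_measurable borel" for n
    using test_function_measurable[OF \<phi>] by auto
  define \<alpha> where "\<alpha> n y = (\<integral>\<^sup>+s. ennreal ((ray_slope k (\<lambda>x. grad (\<phi> n) x - G x) y s)\<^sup>2) \<partial>lborel)" for n y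
  define \<beta> where "\<beta> n y = (\<integral>\<^sup>+s. ennreal ((ray k (\<lambda>x. \<phi> n x - u x) y s)\<^sup>2) \<partial>lborel)" for n y
  have [measurable]: "\<alpha> n \<in> borel_measurable borel" "\<beta> n \<in> borel_measurable borel" for n
    unfolding \<alpha>_def[abs_def] \<beta>_def[abs_def] ray_def ray_slope_def by measurable
  have "(\<lambda>n. \<integral>\<^sup>+y. \<alpha> n y + \<beta> n y \<partial>shell) \<longlonglongrightarrow> 0"
  proof (rule tendsto_sandwich[OF _ _ tendsto_const lim])
    show "\<forall>\<^sub>F n in sequentially. (\<integral>\<^sup>+y. \<alpha> n y + \<beta> n y \<partial>shell) \<le>
        (\<integral>\<^sup>+x. ennreal ((norm (grad (\<phi> n) x - G x))\<^sup>2 / norm x powr (2 * a)) \<partial>lborel)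
          + (\<integral>\<^sup>+x. ennreal (\<bar>\<phi> n x - u x\<bar>\<^sup>2 / norm x powr (2 * (a + 1))) \<partial>lborel)"
    proof (intro always_eventually allI)
      fix n
      have "(\<integral>\<^sup>+y. \<alpha> n y + \<beta> n y \<partial>shell) = (\<integral>\<^sup>+y. \<alpha> n y \<partial>shell) + (\<integral>\<^sup>+y. \<beta> n y \<partial>shell)"
        by (rule nn_integral_add) auto
      then show "(\<integral>\<^sup>+y. \<alpha> n y + \<beta> n y \<partial>shell) \<le>
        (\<integral>\<^sup>+x. ennreal ((norm (grad (\<phi> n) x - G x))\<^sup>2 / norm x powr (2 * a)) \<partial>lborel)
          + (\<integral>\<^sup>+x. ennreal (\<bar>\<phi> n x - u x\<bar>\<^sup>2 / norm x powr (2 * (a + 1))) \<partial>lborel)"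
        using log_polar_gradient[OF _ k, of "\<lambda>x. grad (\<phi> n) x - G x"]
          log_polar_value[OF _ k, of "\<lambda>x. \<phi> n x - u x"]
        by (simp add: \<alpha>_def \<beta>_def add_right_mono)
    qed
  qed auto
  then obtain r where r: "strict_mono r" "AE y in shell. (\<lambda>n. \<alpha> (r n) y + \<beta> (r n) y) \<longlonglongrightarrow> 0"
    by (rule nn_integral_tendsto_0_AE_subseq[rotated]) auto
  from r(2) AE_shell_nonzero show ?thesis
  proof eventually_elim
    case (elim y)
    have lim0: "(\<lambda>n. \<alpha> (r n) y) \<longlonglongrightarrow> 0" "(\<lambda>n. \<beta> (r n) y) \<longlonglongrightarrow> 0"
      by (rule tendsto_sandwich[OF _ _ tendsto_const elim(1)]; simp)+
    show ?case
    proof (rule one_dim_interpolation_limit)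
      show "(ray k (\<phi> (r n)) y has_real_derivative
          k * ray k (\<phi> (r n)) y s + ray_slope k (grad (\<phi> (r n))) y s) (at s)" for n s
        using \<phi> elim(2) by (intro ray_has_derivative) (auto simp: test_function_def)
      have cont: "continuous_on UNIV (\<phi> n)" "continuous_on UNIV (grad (\<phi> n))" for n
        using \<phi>[of n] by (auto simp: test_function_def intro: smooth_continuous smooth_grad_continuous)
      show "continuous_on UNIV (\<lambda>s. k * ray k (\<phi> (r n)) y s + ray_slope k (grad (\<phi> (r n))) y s)" for n
        unfolding ray_def ray_slope_def using elim(2)
        by (intro continuous_intros continuous_on_compose2[OF cont(1)] continuous_on_compose2[OF cont(2)]) auto
      show "\<exists>L. \<forall>s. L \<le> \<bar>s\<bar> \<longrightarrow> ray k (\<phi> (r n)) y s = 0 \<and>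
          k * ray k (\<phi> (r n)) y s + ray_slope k (grad (\<phi> (r n))) y s = 0" for n
        by (rule ray_bounded_support[OF \<phi> elim(2)])
      show "(\<lambda>n. \<integral>\<^sup>+s. ennreal ((ray k (\<phi> (r n)) y s - ray k u y s)\<^sup>2) \<partial>lborel) \<longlonglongrightarrow> 0"
        using lim0(2) by (simp add: \<beta>_def ray_def right_diff_distrib)
      show "(\<lambda>n. \<integral>\<^sup>+s. ennreal (((k * ray k (\<phi> (r n)) y s + ray_slope k (grad (\<phi> (r n))) y s)
          - k * ray k (\<phi> (r n)) y s - ray_slope k G y s)\<^sup>2) \<partial>lborel) \<longlonglongrightarrow> 0"
        using lim0(1) by (simp add: \<alpha>_def ray_slope_def right_diff_distrib inner_diff_left)
    qed (use h in \<open>auto intro: ray_measurable ray_slope_measurable\<close>)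
  qed
qed

lemma integrable_annular_support:
  fixes f :: "real ^ 'n::finite \<Rightarrow> real"
  assumes "0 < r" and supp: "\<And>x. norm x < r \<or> R < norm x \<Longrightarrow> f x = 0"
    and cont: "continuous_on (- {0}) f"
  shows "integrable lborel f"
proof -
  let ?K = "cball 0 R - ball (0 :: real ^ 'n) r"
  have "compact ?K" by (intro compact_diff) auto
  moreover have "continuous_on ?K f"
    by (rule continuous_on_subset[OF cont]) (use \<open>0 < r\<close> in auto)
  ultimately have "integrable lborel (\<lambda>x. indicator ?K x *\<^sub>R f x)"
    by (intro borel_integrable_compact)
  also have "(\<lambda>x. indicator ?K x *\<^sub>R f x) = f"
    using supp by (force simp: indicator_def fun_eq_iff)
  finally show ?thesis .
qed

lemma test_function_gradient_integrable:
  assumes "test_function (\<phi> :: real ^ 'n::finite \<Rightarrow> real)"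
  shows "integrable lborel (\<lambda>x. (norm (grad \<phi> x))\<^sup>2 / norm x powr t)"
proof -
  obtain r R where "0 < r" "\<And>x. norm x < r \<or> R < norm x \<Longrightarrow> \<phi> x = 0 \<and> grad \<phi> x = 0"
    using test_function_support[OF assms] by blast
  with assms show ?thesis
    by (intro integrable_annular_support[of r R])
       (auto simp: test_function_def intro!: continuous_intros smooth_grad_continuous)
qed

lemma test_function_value_integrable:
  assumes "test_function (\<phi> :: real ^ 'n::finite \<Rightarrow> real)" "q > 0"
  shows "integrable lborel (\<lambda>x. \<bar>\<phi> x\<bar> powr q / norm x powr t)"
proof -
  obtain r R where "0 < r" "\<And>x. norm x < r \<or> R < norm x \<Longrightarrow> \<phi> x = 0 \<and> grad \<phi> x = 0"
    using test_function_support[OF assms(1)] by blast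
  moreover have "continuous_on S \<phi>" for S
    using assms by (auto simp: test_function_def intro: smooth_continuous)
  ultimately show ?thesis
    using assms by (intro integrable_annular_support[of r R])
       (auto intro!: continuous_intros continuous_on_powr')
qed

text \<open>Needed to compare Bochner integrals, which would be 0 for a divergent gradient term.\<close>

lemma D12_gradient_finite:
  fixes u :: "real ^ 'n::finite \<Rightarrow> real"
  assumes D: "D12 a u G"
  shows "(\<integral>\<^sup>+x. ennreal ((norm (G x))\<^sup>2 / norm x powr (2 * a)) \<partial>lborel) < \<infinity>"
proof -
  obtain \<phi> where \<phi>: "\<And>n. test_function (\<phi> n)"
    and lim: "(\<lambda>n::nat.
            (\<integral>\<^sup>+x. ennreal ((norm (grad (\<phi> n) x - G x))\<^sup>2 / norm x powr (2 * a)) \<partial>lborel)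
          + (\<integral>\<^sup>+x. ennreal (\<bar>\<phi> n x - u x\<bar>\<^sup>2 / norm x powr (2 * (a + 1))) \<partial>lborel)) \<longlonglongrightarrow> 0"
    and [measurable]: "u \<in> borel_measurable borel" "G \<in> borel_measurable borel"
    using D unfolding D12_def by auto
  have [measurable]: "\<phi> n \<in> borel_measurable borel" "grad (\<phi> n) \<in> borel_measurable borel" for n
    using test_function_measurable[OF \<phi>] by auto
  have "\<forall>\<^sub>F n in sequentially. (\<integral>\<^sup>+x. ennreal ((norm (grad (\<phi> n) x - G x))\<^sup>2 / norm x powr (2 * a)) \<partial>lborel)
          + (\<integral>\<^sup>+x. ennreal (\<bar>\<phi> n x - u x\<bar>\<^sup>2 / norm x powr (2 * (a + 1))) \<partial>lborel) < \<infinity>"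
    by (rule order_tendstoD(2)[OF lim]) simp
  then obtain n where n: "(\<integral>\<^sup>+x. ennreal ((norm (grad (\<phi> n) x - G x))\<^sup>2 / norm x powr (2 * a)) \<partial>lborel) < \<infinity>"
    by (auto simp: eventually_sequentially)
  have fin: "(\<integral>\<^sup>+x. ennreal ((norm (grad (\<phi> n) x))\<^sup>2 / norm x powr (2 * a)) \<partial>lborel) < \<infinity>"
    using test_function_gradient_integrable[OF \<phi>] by (subst nn_integral_eq_integral) auto
  have sq: "(norm g)\<^sup>2 \<le> 2 * (norm (f - g))\<^sup>2 + 2 * (norm f)\<^sup>2" for f g :: "real ^ 'n"
  proof -
    have "norm g \<le> norm (f - g) + norm f" by (metis add.commute norm_minus_commute norm_triangle_sub)
    then have "(norm g)\<^sup>2 \<le> (norm (f - g) + norm f)\<^sup>2" by (intro power_mono) auto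
    also have "\<dots> \<le> 2 * (norm (f - g))\<^sup>2 + 2 * (norm f)\<^sup>2"
      using zero_le_power2[of "norm (f - g) - norm f"] by (simp add: power2_eq_square algebra_simps)
    finally show ?thesis .
  qed
  have "(\<integral>\<^sup>+x. ennreal ((norm (G x))\<^sup>2 / norm x powr (2 * a)) \<partial>lborel) \<le>
      (\<integral>\<^sup>+x. 2 * ennreal ((norm (grad (\<phi> n) x - G x))\<^sup>2 / norm x powr (2 * a)) +
        2 * ennreal ((norm (grad (\<phi> n) x))\<^sup>2 / norm x powr (2 * a)) \<partial>lborel)"
  proof (rule nn_integral_mono)
    fix x
    have "(norm (G x))\<^sup>2 / norm x powr (2 * a) \<le>
        (2 * (norm (grad (\<phi> n) x - G x))\<^sup>2 + 2 * (norm (grad (\<phi> n) x))\<^sup>2) / norm x powr (2 * a)"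
      by (intro divide_right_mono sq) simp
    also have "ennreal \<dots> = 2 * ennreal ((norm (grad (\<phi> n) x - G x))\<^sup>2 / norm x powr (2 * a)) +
        2 * ennreal ((norm (grad (\<phi> n) x))\<^sup>2 / norm x powr (2 * a))"
      by (simp add: add_divide_distrib ennreal_mult[symmetric] flip: ennreal_plus ennreal_numeral)
    finally show "ennreal ((norm (G x))\<^sup>2 / norm x powr (2 * a)) \<le>
        2 * ennreal ((norm (grad (\<phi> n) x - G x))\<^sup>2 / norm x powr (2 * a)) +
        2 * ennreal ((norm (grad (\<phi> n) x))\<^sup>2 / norm x powr (2 * a))" by (simp add: ennreal_leI)
  qed
  also have "\<dots> < \<infinity>"
    using n fin by (subst nn_integral_add) (auto simp: nn_integral_cmult ennreal_mult_less_top)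
  finally show ?thesis .
qed

text \<open>\<open>N\<close> and \<open>X N\<close> stand for \<open>\<integral>w\<^sup>2\<close> and a lower bound of \<open>\<integral>w'\<^sup>2\<close> on a single ray. The first
  integral and the \<open>p\<close>-integral are the same on almost all rays because \<open>u\<close> is radial, and \<open>X\<close>
  is read off from them by solving the one-dimensional inequality for the gradient term.\<close>

lemma radial_ray_data:
  fixes u :: "real ^ 'n::finite \<Rightarrow> real"
  assumes D: "D12 a u G" and rad: "radially_symmetric u" and nz: "\<not> (AE x in lborel. u x = 0)"
    and k: "k = a_crit CARD('n) - a" and h: "0 < h" "h \<le> 1 / 2"
  obtains N X where "0 < N" "0 \<le> X"
    "(LINT x|lborel. \<bar>u x\<bar>\<^sup>2 / norm x powr (2 * (a + 1))) = shell_mass TYPE('n) * N"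
    "(LINT x|lborel. ckn_density (2 + h) a u x) =
      shell_mass TYPE('n) * (N powr (1 + h / 2) * (X / line_const) powr (h / 4))"
    "shell_mass TYPE('n) * (N * (k\<^sup>2 + X)) \<le> (LINT x|lborel. (norm (G x))\<^sup>2 / norm x powr (2 * a))"
proof -
  have [measurable]: "u \<in> borel_measurable borel" "G \<in> borel_measurable borel"
    using D by (auto simp: D12_def)
  let ?\<sigma> = "shell_mass TYPE('n)"
  have \<sigma>: "?\<sigma> > 0" by (rule shell_mass_pos)
  obtain c where c: "AE y in shell. (\<integral>\<^sup>+s. ennreal ((ray k u y s)\<^sup>2) \<partial>lborel) = c"
    using radial_ray_integral_constant[OF rad, of "\<lambda>r v. ennreal ((r powr k * v)\<^sup>2)"]
    unfolding ray_def by auto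
  obtain e where e: "AE y in shell. (\<integral>\<^sup>+s. ennreal (\<bar>ray k u y s\<bar> powr (2 + h)) \<partial>lborel) = e"
    using radial_ray_integral_constant[OF rad, of "\<lambda>r v. ennreal (\<bar>r powr k * v\<bar> powr (2 + h))"]
    unfolding ray_def by auto
  have rays: "AE y in shell. \<exists>N A. 0 \<le> N \<and> k\<^sup>2 * N \<le> A \<and> c = ennreal N \<and>
    (\<integral>\<^sup>+s. ennreal ((ray_slope k G y s)\<^sup>2) \<partial>lborel) = ennreal A \<and>
    e \<le> ennreal (N powr (1 + h / 4) * ((A - k\<^sup>2 * N) / line_const) powr (h / 4))"
    using D12_rays[OF D k h] c e by eventually_elim auto
  have "\<exists>N B. 0 \<le> N \<and> c = ennreal N \<and> e \<le> ennreal B"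
  proof (rule ccontr)
    assume none: "\<not> ?thesis"
    from rays have "AE y in (shell :: (real ^ 'n) measure). False"
      by eventually_elim (use none in blast)
    with shell_nontrivial show False by blast
  qed
  then obtain N B where N: "0 \<le> N" "c = ennreal N" and "e \<le> ennreal B" by blast
  then obtain P where P: "0 \<le> P" "e = ennreal P"
    by (cases e) (auto simp: top_unique)
  have shell_const: "(\<integral>\<^sup>+y. ennreal t \<partial>(shell :: (real ^ 'n) measure)) = ennreal (?\<sigma> * t)" if "0 \<le> t" for t
    using \<sigma> that by (simp add: emeasure_shell ennreal_mult[symmetric] mult.commute)
  have "(\<integral>\<^sup>+x. ennreal (\<bar>u x\<bar>\<^sup>2 / norm x powr (2 * (a + 1))) \<partial>lborel) = (\<integral>\<^sup>+y. ennreal N \<partial>(shell :: (real ^ 'n) measure))"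
    unfolding log_polar_value[OF \<open>u \<in> borel_measurable borel\<close> k]
    by (rule nn_integral_cong_AE) (use c N in simp)
  then have val: "(\<integral>\<^sup>+x. ennreal (\<bar>u x\<bar>\<^sup>2 / norm x powr (2 * (a + 1))) \<partial>lborel) = ennreal (?\<sigma> * N)"
    using shell_const[OF N(1)] by simp
  have "(\<integral>\<^sup>+x. ennreal (ckn_density (2 + h) a u x) \<partial>lborel) = (\<integral>\<^sup>+y. ennreal P \<partial>(shell :: (real ^ 'n) measure))"
    using h by (subst log_polar_density[OF \<open>u \<in> borel_measurable borel\<close> k], simp)
       (rule nn_integral_cong_AE, use e P in simp)
  then have den: "(\<integral>\<^sup>+x. ennreal (ckn_density (2 + h) a u x) \<partial>lborel) = ennreal (?\<sigma> * P)"
    using shell_const[OF P(1)] by simp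
  have "N \<noteq> 0"
  proof
    assume "N = 0"
    with val have "(\<integral>\<^sup>+x. ennreal (\<bar>u x\<bar>\<^sup>2 / norm x powr (2 * (a + 1))) \<partial>lborel) = 0" by simp
    then have "AE x in lborel. ennreal (\<bar>u x\<bar>\<^sup>2 / norm x powr (2 * (a + 1))) = 0"
      by (subst (asm) nn_integral_0_iff_AE) auto
    with AE_lborel_singleton[of "0 :: real ^ 'n"] have "AE x in lborel. u x = 0"
      by eventually_elim (auto simp: ennreal_eq_0_iff divide_le_0_iff)
    with nz show False by blast
  qed
  with N have Npos: "N > 0" by simp
  \<comment> \<open>the gradient term relative to \<open>N\<close> that would turn the one-dimensional inequality into an equality\<close>
  define X where "X = line_const * (P / N powr (1 + h / 2)) powr (4 / h)"
  have X0: "X \<ge> 0" using line_const_pos by (simp add: X_def)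
  have PX: "P = N powr (1 + h / 2) * (X / line_const) powr (h / 4)"
    using h P Npos line_const_pos by (simp add: X_def powr_powr)
  have slope: "N * (k\<^sup>2 + X) \<le> A"
    if A: "k\<^sup>2 * N \<le> A" and le: "P \<le> N powr (1 + h / 4) * ((A - k\<^sup>2 * N) / line_const) powr (h / 4)" for A
  proof (rule ccontr)
    assume "\<not> ?thesis"
    then have "A - k\<^sup>2 * N < N * X" by (simp add: algebra_simps)
    from divide_strict_right_mono[OF this line_const_pos]
    have "(A - k\<^sup>2 * N) / line_const < N * (X / line_const)" by simp
    then have "((A - k\<^sup>2 * N) / line_const) powr (h / 4) < (N * (X / line_const)) powr (h / 4)"
      using h A line_const_pos by (intro powr_less_mono2) auto
    also have "\<dots> = N powr (h / 4) * (X / line_const) powr (h / 4)"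
      using Npos X0 line_const_pos by (intro powr_mult)
    finally have "N powr (1 + h / 4) * ((A - k\<^sup>2 * N) / line_const) powr (h / 4)
        < N powr (1 + h / 4) * (N powr (h / 4) * (X / line_const) powr (h / 4))"
      using Npos by simp
    also have "\<dots> = P"
      unfolding PX using Npos by (simp add: powr_add[symmetric] add.commute flip: mult.assoc)
    finally show False using le by simp
  qed
  have "ennreal (?\<sigma> * (N * (k\<^sup>2 + X))) = (\<integral>\<^sup>+y. ennreal (N * (k\<^sup>2 + X)) \<partial>(shell :: (real ^ 'n) measure))"
    using Npos X0 by (intro shell_const[symmetric]) simp
  also have "\<dots> \<le> (\<integral>\<^sup>+y. (\<integral>\<^sup>+s. ennreal ((ray_slope k G y s)\<^sup>2) \<partial>lborel) \<partial>shell)"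
  proof (rule nn_integral_mono_AE)
    show "AE y in shell. ennreal (N * (k\<^sup>2 + X)) \<le> (\<integral>\<^sup>+s. ennreal ((ray_slope k G y s)\<^sup>2) \<partial>lborel)"
      using rays
    proof eventually_elim
      case (elim y)
      then obtain N' A where "0 \<le> N'" "k\<^sup>2 * N' \<le> A" "c = ennreal N'"
        "(\<integral>\<^sup>+s. ennreal ((ray_slope k G y s)\<^sup>2) \<partial>lborel) = ennreal A"
        "e \<le> ennreal (N' powr (1 + h / 4) * ((A - k\<^sup>2 * N') / line_const) powr (h / 4))" by blast
      moreover from this have "N' = N" using N by simp
      ultimately show ?case using slope[of A] P by (auto intro!: ennreal_leI)
    qed
  qed
  also have "\<dots> \<le> (\<integral>\<^sup>+x. ennreal ((norm (G x))\<^sup>2 / norm x powr (2 * a)) \<partial>lborel)"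
    by (rule log_polar_gradient[OF \<open>G \<in> borel_measurable borel\<close> k])
  finally have "ennreal (?\<sigma> * (N * (k\<^sup>2 + X))) \<le> (\<integral>\<^sup>+x. ennreal ((norm (G x))\<^sup>2 / norm x powr (2 * a)) \<partial>lborel)" .
  then have grad: "enn2real (ennreal (?\<sigma> * (N * (k\<^sup>2 + X)))) \<le>
      enn2real (\<integral>\<^sup>+x. ennreal ((norm (G x))\<^sup>2 / norm x powr (2 * a)) \<partial>lborel)"
    using D12_gradient_finite[OF D] by (intro enn2real_mono) auto
  show thesis
  proof (rule that[OF Npos X0])
    show "(LINT x|lborel. \<bar>u x\<bar>\<^sup>2 / norm x powr (2 * (a + 1))) = ?\<sigma> * N"
      using val \<sigma> Npos by (subst integral_eq_nn_integral) auto
    show "(LINT x|lborel. ckn_density (2 + h) a u x) = ?\<sigma> * (N powr (1 + h / 2) * (X / line_const) powr (h / 4))"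
      using den \<sigma> P(1) unfolding PX[symmetric]
      by (subst integral_eq_nn_integral) (auto simp: ckn_density_def intro: ckn_density_measurable)
    show "?\<sigma> * (N * (k\<^sup>2 + X)) \<le> (LINT x|lborel. (norm (G x))\<^sup>2 / norm x powr (2 * a))"
      using grad \<sigma> Npos X0 by (subst integral_eq_nn_integral) auto
  qed
qed

section \<open>Gaussian integrals and the area of the sphere\<close>

lemma nn_integral_gauss_half:
  assumes "0 < l"
  shows "(\<integral>\<^sup>+x. ennreal (indicator {0..} x * exp (- (l * x\<^sup>2))) \<partial>lborel) = ennreal (sqrt (pi / l) / 2)"
proof -
  have base: "(\<integral>\<^sup>+x. ennreal (indicator {0..} x * exp (- (x\<^sup>2))) \<partial>lborel) = ennreal (sqrt pi / 2)"
    using gaussian_moment_0 by (subst nn_integral_eq_integral) (auto simp: has_bochner_integral_iff)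
  have "(\<integral>\<^sup>+x. ennreal (indicator {0..} x * exp (- (x\<^sup>2))) \<partial>lborel) =
      (\<integral>\<^sup>+x. ennreal (indicator {0..} (sqrt l * x) * exp (- ((sqrt l * x)\<^sup>2))) * ennreal (sqrt l) \<partial>lborel)"
    using assms by (subst nn_integral_lborel_scaleR[where c = "sqrt l" and t = 0]) auto
  also have "\<dots> = (\<integral>\<^sup>+x. ennreal (indicator {0..} x * exp (- (l * x\<^sup>2))) * ennreal (sqrt l) \<partial>lborel)"
    using assms by (intro nn_integral_cong) (auto simp: power_mult_distrib indicator_def zero_le_mult_iff)
  also have "\<dots> = (\<integral>\<^sup>+x. ennreal (indicator {0..} x * exp (- (l * x\<^sup>2))) \<partial>lborel) * ennreal (sqrt l)"
    by (rule nn_integral_multc) measurable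
  finally have eq: "ennreal (sqrt pi / 2) = (\<integral>\<^sup>+x. ennreal (indicator {0..} x * exp (- (l * x\<^sup>2))) \<partial>lborel) * ennreal (sqrt l)"
    using base by simp
  have "(\<integral>\<^sup>+x. ennreal (indicator {0..} x * exp (- (l * x\<^sup>2))) \<partial>lborel) =
      (\<integral>\<^sup>+x. ennreal (indicator {0..} x * exp (- (l * x\<^sup>2))) \<partial>lborel) * ennreal (sqrt l) * ennreal (1 / sqrt l)"
    using assms by (simp add: mult.assoc ennreal_mult[symmetric])
  also have "\<dots> = ennreal (sqrt pi / 2) * ennreal (1 / sqrt l)" by (simp add: eq)
  also have "\<dots> = ennreal (sqrt (pi / l) / 2)"
    using assms by (subst ennreal_mult[symmetric]) (auto simp: real_sqrt_divide)
  finally show ?thesis .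
qed

lemma nn_integral_gauss:
  assumes "0 < l"
  shows "(\<integral>\<^sup>+x. ennreal (exp (- (l * x\<^sup>2))) \<partial>lborel) = ennreal (sqrt (pi / l))"
proof -
  let ?h = "\<lambda>x. ennreal (indicator {0..} x * exp (- (l * x\<^sup>2)))"
  have "(\<integral>\<^sup>+x. ennreal (exp (- (l * x\<^sup>2))) \<partial>lborel) = (\<integral>\<^sup>+x. ?h x + ?h (0 + (- 1) *\<^sub>R x) \<partial>lborel)"
  proof (rule nn_integral_cong_AE)
    show "AE x in lborel. ennreal (exp (- (l * x\<^sup>2))) = ?h x + ?h (0 + (- 1) *\<^sub>R x)"
      using AE_lborel_singleton[of "0 :: real"] by eventually_elim (auto simp: indicator_def)
  qed
  also have "\<dots> = (\<integral>\<^sup>+x. ?h x \<partial>lborel) + (\<integral>\<^sup>+x. ?h (0 + (- 1) *\<^sub>R x) \<partial>lborel)"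
    by (rule nn_integral_add) measurable
  also have "(\<integral>\<^sup>+x. ?h (0 + (- 1) *\<^sub>R x) \<partial>lborel) = (\<integral>\<^sup>+x. ?h x \<partial>lborel)"
    by (subst (2) nn_integral_lborel_scaleR[where c = "- 1" and t = 0]) auto
  finally show ?thesis
    using assms by (simp add: nn_integral_gauss_half[OF assms] flip: ennreal_plus)
qed

lemma norm_square_Basis: "(norm x)\<^sup>2 = (\<Sum>b\<in>Basis. (x \<bullet> b)\<^sup>2)"
  unfolding power2_norm_eq_inner by (subst euclidean_inner) (simp add: power2_eq_square)

lemma nn_integral_gauss_euclidean:
  assumes "0 < l"
  shows "(\<integral>\<^sup>+x. ennreal (exp (- (l * (norm x)\<^sup>2))) \<partial>(lborel :: 'a::euclidean_space measure)) =
    ennreal (sqrt (pi / l) ^ DIM('a))"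
proof -
  have "(\<integral>\<^sup>+x. ennreal (exp (- (l * (norm x)\<^sup>2))) \<partial>(lborel :: 'a measure)) =
      (\<integral>\<^sup>+x. (\<Prod>b\<in>Basis. ennreal (exp (- (l * (x \<bullet> b)\<^sup>2)))) \<partial>(lborel :: 'a measure))"
    by (simp add: norm_square_Basis prod_ennreal exp_sum[symmetric] sum_distrib_left sum_negf)
  also have "\<dots> = (\<Prod>b\<in>(Basis :: 'a set). ennreal (sqrt (pi / l)))"
    by (subst nn_integral_lborel_prod) (auto simp: nn_integral_gauss[OF assms])
  finally show ?thesis using assms by (simp add: prod_ennreal ennreal_power)
qed

lemma integral_gauss_moment:
  "(\<integral>\<^sup>+x. ennreal (x\<^sup>2 * exp (- (x\<^sup>2))) \<partial>lborel) = ennreal (sqrt pi / 2)"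
proof -
  have hb: "has_bochner_integral lborel (\<lambda>x::real. exp (- x\<^sup>2) * x ^ (2 * 1)) (2 * ((sqrt pi / 2) * (fact (2 * 1) / (2 ^ (2 * 1) * fact 1))))"
    using has_bochner_integral_even_function[OF gaussian_moment_even_pos[where k=1]] by simp
  then have "has_bochner_integral lborel (\<lambda>x::real. x\<^sup>2 * exp (- x\<^sup>2)) (sqrt pi / 2)"
    by (simp add: mult.commute fact_numeral)
  then show ?thesis
    by (subst nn_integral_eq_integral) (auto simp: has_bochner_integral_iff)
qed

text \<open>Expanding \<open>|x|\<^sup>2\<close> into coordinates turns the integrand into a sum of products of
  one-dimensional functions.\<close>

lemma nn_integral_gauss_euclidean_moment:
  "(\<integral>\<^sup>+x. ennreal ((norm x)\<^sup>2 * exp (- (norm x)\<^sup>2)) \<partial>(lborel :: 'a::euclidean_space measure)) =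
    ennreal (real DIM('a) / 2 * sqrt pi ^ DIM('a))"
proof -
  let ?f = "\<lambda>c b t :: real. ennreal (if b = (c :: 'a) then t\<^sup>2 * exp (- (t\<^sup>2)) else exp (- (t\<^sup>2)))"
  have "(\<integral>\<^sup>+x. ennreal ((norm x)\<^sup>2 * exp (- (norm x)\<^sup>2)) \<partial>(lborel :: 'a measure)) =
      (\<integral>\<^sup>+x. (\<Sum>c\<in>Basis. \<Prod>b\<in>Basis. ?f c b (x \<bullet> b)) \<partial>(lborel :: 'a measure))"
  proof (rule nn_integral_cong)
    fix x :: 'a
    have "(\<Prod>b\<in>Basis. ?f c b (x \<bullet> b)) = ennreal ((x \<bullet> c)\<^sup>2 * exp (- (norm x)\<^sup>2))" if "c \<in> Basis" for c
    proof -
      have "(\<Prod>b\<in>Basis. ?f c b (x \<bullet> b)) = ennreal (\<Prod>b\<in>Basis. (if b = c then (x \<bullet> c)\<^sup>2 else 1) * exp (- (x \<bullet> b)\<^sup>2))"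
        by (subst prod_ennreal) (auto intro!: prod.cong arg_cong[where f = ennreal])
      also have "(\<Prod>b\<in>Basis. (if b = c then (x \<bullet> c)\<^sup>2 else 1) * exp (- (x \<bullet> b)\<^sup>2)) = (x \<bullet> c)\<^sup>2 * exp (- (norm x)\<^sup>2)"
        using that by (simp add: prod.distrib norm_square_Basis exp_sum[symmetric] sum_negf)
      finally show ?thesis .
    qed
    then show "ennreal ((norm x)\<^sup>2 * exp (- (norm x)\<^sup>2)) = (\<Sum>c\<in>Basis. \<Prod>b\<in>Basis. ?f c b (x \<bullet> b))"
      by (simp add: sum_distrib_right[symmetric] norm_square_Basis[of x, symmetric])
  qed
  also have "\<dots> = (\<Sum>c\<in>Basis. \<integral>\<^sup>+x. (\<Prod>b\<in>Basis. ?f c b (x \<bullet> b)) \<partial>(lborel :: 'a measure))"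
    by (rule nn_integral_sum) measurable
  also have "\<dots> = (\<Sum>c\<in>(Basis :: 'a set). ennreal (sqrt pi ^ DIM('a) / 2))"
  proof (rule sum.cong[OF refl])
    fix c :: 'a assume c: "c \<in> Basis"
    have "(\<integral>\<^sup>+x. (\<Prod>b\<in>Basis. ?f c b (x \<bullet> b)) \<partial>(lborel :: 'a measure)) =
        (\<Prod>b\<in>Basis. \<integral>\<^sup>+t. ?f c b t \<partial>lborel)"
      by (rule nn_integral_lborel_prod) auto
    also have "\<dots> = (\<Prod>b\<in>Basis. ennreal ((if b = c then 1 / 2 else 1) * sqrt pi))"
      using integral_gauss_moment nn_integral_gauss[of 1] by (intro prod.cong) auto
    also have "\<dots> = ennreal (\<Prod>b\<in>Basis. (if b = c then 1 / 2 else 1) * sqrt pi)"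
      by (rule prod_ennreal) auto
    also have "(\<Prod>b\<in>Basis. (if b = c then 1 / 2 else 1) * sqrt pi) = sqrt pi ^ DIM('a) / 2"
      using c by (simp add: prod.distrib)
    finally show "(\<integral>\<^sup>+x. (\<Prod>b\<in>Basis. ?f c b (x \<bullet> b)) \<partial>(lborel :: 'a measure)) = ennreal (sqrt pi ^ DIM('a) / 2)" .
  qed
  finally show ?thesis by (simp add: ennreal_of_nat_eq_real_of_nat ennreal_mult[symmetric])
qed

lemma ln_le_quadratic:
  fixes x :: real
  assumes "0 < x" "x \<le> 1"
  shows "2 * ln x \<le> - x\<^sup>2 + 4 * x - 3"
proof -
  let ?g = "\<lambda>x. - x\<^sup>2 + 4 * x - 3 - 2 * ln x"
  have "?g 1 \<le> ?g x"
  proof (rule DERIV_nonpos_imp_nonincreasing[OF assms(2)])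
    fix y assume "x \<le> y" "y \<le> 1"
    with assms have y: "y > 0" by simp
    have "(?g has_real_derivative - 2 * y + 4 - 2 / y) (at y)"
      using y by (auto intro!: derivative_eq_intros simp: field_simps)
    moreover have "- 2 * y + 4 - 2 / y = - (2 * (y - 1)\<^sup>2 / y)"
      using y by (simp add: field_simps power2_eq_square)
    ultimately show "\<exists>m. (?g has_real_derivative m) (at y) \<and> m \<le> 0"
      using y by (intro exI[of _ "- (2 * (y - 1)\<^sup>2 / y)"]) auto
  qed
  then show ?thesis by simp
qed

text \<open>A narrow half Gaussian on the left and a wide one on the right; it dominates the normalised
  weight \<open>r powr m * exp (- r\<^sup>2)\<close> around its maximum. Using the wide one on both sides would
  double the slack and lose the final comparison.\<close>

definition two_gauss :: "real \<Rightarrow> real" where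
  "two_gauss t = (if t \<le> 0 then exp (- (2 * t\<^sup>2)) else exp (- t\<^sup>2))"

lemma two_gauss_measurable [measurable]: "two_gauss \<in> borel_measurable borel"
  unfolding two_gauss_def by measurable

text \<open>The function \<open>m ln r - r\<^sup>2\<close> is maximal at \<open>r\<^sub>0 = sqrt (m / 2)\<close>. Its second derivative
  \<open>- m / r\<^sup>2 - 2\<close> is at most \<open>-2\<close> everywhere and at most \<open>-4\<close> for \<open>r \<le> r\<^sub>0\<close>, so on the left of
  the maximum it lies below a narrower parabola.\<close>

lemma radial_weight_bound:
  fixes m r :: real
  assumes m: "0 < m" and r: "0 < r"
  shows "r powr m * exp (- r\<^sup>2) \<le> (m / (2 * exp 1)) powr (m / 2) * two_gauss (r - sqrt (m / 2))"
proof -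
  define q where "q = sqrt (m / 2)"
  have q: "q > 0" and q2: "m = 2 * q\<^sup>2" using m by (simp_all add: q_def)
  define x where "x = r / q"
  have x: "x > 0" and rx: "r = q * x" using q r by (simp_all add: x_def)
  have C: "(m / (2 * exp 1)) powr (m / 2) = exp (m * ln q - q\<^sup>2)"
  proof -
    have "ln (m / (2 * exp 1)) = 2 * ln q - 1"
      using q by (simp add: q2 ln_div ln_realpow)
    moreover have "(m / (2 * exp 1)) powr (m / 2) = exp (m / 2 * ln (m / (2 * exp 1)))"
      using m by (simp add: powr_def)
    ultimately show ?thesis by (simp only:) (simp add: q2 algebra_simps)
  qed
  have L: "r powr m * exp (- r\<^sup>2) = exp (m * ln q - q\<^sup>2) * exp (q\<^sup>2 * (2 * ln x - x\<^sup>2 + 1))"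
    using r q x by (simp add: powr_def rx q2 ln_mult exp_add[symmetric] algebra_simps power_mult_distrib)
  have sq: "(r - q)\<^sup>2 = q\<^sup>2 * (x - 1)\<^sup>2"
    by (simp add: rx power_mult_distrib[symmetric] algebra_simps)
  have "exp (q\<^sup>2 * (2 * ln x - x\<^sup>2 + 1)) \<le> two_gauss (r - q)"
  proof (cases "x \<le> 1")
    case True
    then have "r - q \<le> 0" using q by (simp add: rx)
    then have "two_gauss (r - q) = exp (q\<^sup>2 * (- 2 * (x - 1)\<^sup>2))" by (simp add: two_gauss_def sq)
    moreover have "2 * ln x - x\<^sup>2 + 1 \<le> - 2 * (x - 1)\<^sup>2"
      using ln_le_quadratic[OF x True] by (simp add: power2_eq_square algebra_simps)
    ultimately show ?thesis
      by (simp only: exp_le_cancel_iff mult_left_mono zero_le_power2)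
  next
    case False
    then have "\<not> r - q \<le> 0" using q by (simp add: rx)
    then have "two_gauss (r - q) = exp (q\<^sup>2 * (- (x - 1)\<^sup>2))" by (simp add: two_gauss_def sq)
    moreover have "2 * ln x - x\<^sup>2 + 1 \<le> - (x - 1)\<^sup>2"
      using ln_le_minus_one[OF x] by (simp add: power2_eq_square algebra_simps)
    ultimately show ?thesis
      by (simp only: exp_le_cancel_iff mult_left_mono zero_le_power2)
  qed
  then show ?thesis unfolding C L q_def[symmetric] by simp
qed

text \<open>The integral of \<open>two_gauss\<close> relative to \<open>sqrt \<pi>\<close>.\<close>

definition sphere_const :: real where "sphere_const = (1 + 1 / sqrt 2) / 2"

lemma nn_integral_two_gauss:
  "(\<integral>\<^sup>+t. ennreal (two_gauss t) \<partial>lborel) = ennreal (sphere_const * sqrt pi)"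
proof -
  let ?h = "\<lambda>l x. ennreal (indicator {0..} x * exp (- (l * x\<^sup>2)))"
  have "(\<integral>\<^sup>+t. ennreal (two_gauss t) \<partial>lborel) = (\<integral>\<^sup>+x. ?h 1 x + ?h 2 (0 + (- 1) *\<^sub>R x) \<partial>lborel)"
  proof (rule nn_integral_cong_AE)
    show "AE x in lborel. ennreal (two_gauss x) = ?h 1 x + ?h 2 (0 + (- 1) *\<^sub>R x)"
      using AE_lborel_singleton[of "0 :: real"]
      by eventually_elim (auto simp: indicator_def two_gauss_def)
  qed
  also have "\<dots> = (\<integral>\<^sup>+x. ?h 1 x \<partial>lborel) + (\<integral>\<^sup>+x. ?h 2 (0 + (- 1) *\<^sub>R x) \<partial>lborel)"
    by (rule nn_integral_add) measurable
  also have "(\<integral>\<^sup>+x. ?h 2 (0 + (- 1) *\<^sub>R x) \<partial>lborel) = (\<integral>\<^sup>+x. ?h 2 x \<partial>lborel)"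
    by (subst (2) nn_integral_lborel_scaleR[where c = "- 1" and t = 0]) auto
  also have "(\<integral>\<^sup>+x. ?h 1 x \<partial>lborel) + (\<integral>\<^sup>+x. ?h 2 x \<partial>lborel) = ennreal (sqrt pi / 2) + ennreal (sqrt (pi / 2) / 2)"
    using nn_integral_gauss_half[of 1] nn_integral_gauss_half[of 2] by simp
  also have "\<dots> = ennreal (sphere_const * sqrt pi)"
    by (simp add: sphere_const_def real_sqrt_divide field_simps flip: ennreal_plus)
  finally show ?thesis .
qed

text \<open>Substitution \<open>r = e\<^sup>s\<close> on bounded intervals, followed by monotone convergence.\<close>

lemma nn_integral_exp_substitution_le:
  fixes f :: "real \<Rightarrow> real"
  assumes [measurable]: "f \<in> borel_measurable borel" and nn: "\<And>x. 0 \<le> f x"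
  shows "(\<integral>\<^sup>+s. ennreal (f (exp s) * exp s) \<partial>lborel) \<le> (\<integral>\<^sup>+r. ennreal (f r) \<partial>lborel)"
proof -
  let ?g = "\<lambda>m s. ennreal (f (exp s) * exp s) * indicator {- real m..real m} s"
  have "(SUP m. ?g m s) = ennreal (f (exp s) * exp s)" for s
  proof (rule antisym)
    obtain m where "\<bar>s\<bar> \<le> real m" using real_arch_simple by blast
    then have "?g m s = ennreal (f (exp s) * exp s)" by (auto simp: indicator_def)
    then show "ennreal (f (exp s) * exp s) \<le> (SUP m. ?g m s)"
      by (rule subst) (rule SUP_upper, simp)
    show "(SUP m. ?g m s) \<le> ennreal (f (exp s) * exp s)"
      by (rule SUP_least) (auto simp: indicator_def)
  qed
  then have "(\<integral>\<^sup>+s. ennreal (f (exp s) * exp s) \<partial>lborel) = (\<integral>\<^sup>+s. (SUP m. ?g m s) \<partial>lborel)" by simp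
  also have "\<dots> = (SUP m. \<integral>\<^sup>+s. ?g m s \<partial>lborel)"
    by (rule nn_integral_monotone_convergence_SUP)
       (auto simp: incseq_def le_fun_def indicator_def)
  also have "\<dots> \<le> (\<integral>\<^sup>+r. ennreal (f r) \<partial>lborel)"
  proof (rule SUP_least)
    fix m :: nat
    have "(\<integral>\<^sup>+s. ?g m s \<partial>lborel) = (\<integral>\<^sup>+s. ennreal (f (exp s) * exp s * indicator {- real m..real m} s) \<partial>lborel)"
      by (intro nn_integral_cong) (auto simp: indicator_def)
    also have "\<dots> = (\<integral>\<^sup>+r. ennreal (f r * indicator {exp (- real m)..exp (real m)} r) \<partial>lborel)"
      by (rule nn_integral_substitution[symmetric])
         (auto intro!: derivative_eq_intros continuous_intros simp: set_borel_measurable_def)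
    also have "\<dots> \<le> (\<integral>\<^sup>+r. ennreal (f r) \<partial>lborel)"
      by (rule nn_integral_mono) (auto simp: indicator_def nn)
    finally show "(\<integral>\<^sup>+s. ?g m s \<partial>lborel) \<le> (\<integral>\<^sup>+r. ennreal (f r) \<partial>lborel)" .
  qed
  finally show ?thesis .
qed

text \<open>The Gaussian integral over the whole space equals the area of the sphere times
  \<open>\<integral>r ^ (d - 1) exp (- r\<^sup>2) dr\<close>; an upper bound of the radial integral is a lower bound of the
  area.\<close>

lemma shell_mass_lower_bound:
  assumes d: "CARD('n::finite) \<ge> 2"
  shows "sqrt pi ^ CARD('n) \<le> shell_mass TYPE('n) *
    (((real CARD('n) - 1) / (2 * exp 1)) powr ((real CARD('n) - 1) / 2) * (sphere_const * sqrt pi))"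
proof -
  let ?d = "CARD('n)" and ?\<sigma> = "shell_mass TYPE('n)"
  define m where "m = real ?d - 1"
  have m: "m > 0" using d by (simp add: m_def)
  define K where "K = (m / (2 * exp 1)) powr (m / 2)"
  have K: "K \<ge> 0" by (simp add: K_def)
  have c2: "sphere_const \<ge> 0" by (simp add: sphere_const_def)
  define I where "I = (\<integral>\<^sup>+s. ennreal (exp (- (exp s)\<^sup>2) * exp s ^ ?d) \<partial>lborel)"
  have inner: "(\<integral>\<^sup>+s. ennreal (exp (- (norm (exp s *\<^sub>R y))\<^sup>2)) * ennreal (norm (exp s *\<^sub>R y) ^ ?d) \<partial>lborel) = I"
    if "y \<noteq> 0" for y :: "real ^ 'n"
  proof -
    have n: "norm (exp s *\<^sub>R y) = exp (ln (norm y) + s)" for s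
      using that by (simp add: exp_add)
    show ?thesis
      unfolding I_def n
      by (subst nn_integral_translate[where c = "ln (norm y)", symmetric])
         (auto simp: ennreal_mult[symmetric])
  qed
  have "ennreal (sqrt pi ^ ?d) = (\<integral>\<^sup>+x. ennreal (exp (- (norm x)\<^sup>2)) \<partial>(lborel :: (real ^ 'n) measure))"
    using nn_integral_gauss_euclidean[of 1, where 'a = "real ^ 'n"] by simp
  also have "\<dots> = (\<integral>\<^sup>+y. I \<partial>(shell :: (real ^ 'n) measure))"
    by (subst nn_integral_log_polar, measurable) (rule shell_cong_nonzero, rule inner)
  also have "\<dots> = I * ennreal ?\<sigma>" by (simp add: emeasure_shell)
  also have "I \<le> ennreal (K * (sphere_const * sqrt pi))"
  proof -
    have "I \<le> (\<integral>\<^sup>+s. ennreal (K * two_gauss (exp s - sqrt (m / 2)) * exp s) \<partial>lborel)"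
      unfolding I_def
    proof (intro nn_integral_mono ennreal_leI)
      fix s :: real
      have "exp (- (exp s)\<^sup>2) * exp s ^ ?d = (exp s powr m * exp (- (exp s)\<^sup>2)) * exp s"
        by (simp add: m_def powr_diff powr_realpow)
      also have "\<dots> \<le> K * two_gauss (exp s - sqrt (m / 2)) * exp s"
        unfolding K_def by (intro mult_right_mono radial_weight_bound m) auto
      finally show "exp (- (exp s)\<^sup>2) * exp s ^ ?d \<le> K * two_gauss (exp s - sqrt (m / 2)) * exp s" .
    qed
    also have "\<dots> \<le> (\<integral>\<^sup>+r. ennreal (K * two_gauss (r - sqrt (m / 2))) \<partial>lborel)"
      by (rule nn_integral_exp_substitution_le) (use K in \<open>auto simp: two_gauss_def\<close>)
    also have "\<dots> = ennreal K * (\<integral>\<^sup>+r. ennreal (two_gauss (- sqrt (m / 2) + r)) \<partial>lborel)"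
      using K by (subst nn_integral_cmult[symmetric]) (auto simp: ennreal_mult two_gauss_def)
    also have "(\<integral>\<^sup>+r. ennreal (two_gauss (- sqrt (m / 2) + r)) \<partial>lborel) = (\<integral>\<^sup>+r. ennreal (two_gauss r) \<partial>lborel)"
      by (rule nn_integral_translate) measurable
    finally show ?thesis
      using K c2 by (simp add: nn_integral_two_gauss ennreal_mult)
  qed
  then have "I * ennreal ?\<sigma> \<le> ennreal (K * (sphere_const * sqrt pi)) * ennreal ?\<sigma>" by (rule mult_right_mono) simp
  also have "\<dots> = ennreal (?\<sigma> * (K * (sphere_const * sqrt pi)))"
    using K c2 by (subst ennreal_mult[symmetric]) (auto simp: mult.commute intro: less_imp_le shell_mass_pos)
  finally show ?thesis
    using K c2 shell_mass_pos[where 'n = 'n] by (simp add: K_def m_def ennreal_le_iff)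
qed

section \<open>Concentrating Gaussians\<close>

lemma bump_pos: "0 < t \<Longrightarrow> 0 < bump 0 t"
  and bump_nonneg: "0 \<le> bump 0 t"
  and bump_le_1: "bump 0 t \<le> 1"
  and bump_zero: "t \<le> 0 \<Longrightarrow> bump k t = 0"
  by (auto simp: bump_def)

lemma bump_continuous: "continuous_on S (bump k)"
  by (meson DERIV_continuous_on bump_has_derivative has_field_derivative_at_within)

lemma bump_measurable [measurable]: "bump k \<in> borel_measurable borel"
  by (rule borel_measurable_continuous_onI[OF bump_continuous])

text \<open>Below 0 the function vanishes and on \<open>[0, 1/4]\<close> it is continuous; \<open>1/4\<close> is the largest
  argument that occurs in \<open>spike\<close>.\<close>

lemma bump_bounded: obtains C where "0 \<le> C" "\<And>t. t \<le> 1 / 4 \<Longrightarrow> \<bar>bump k t\<bar> \<le> C"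
proof -
  have "compact (bump k ` {0..1 / 4})"
    by (intro compact_continuous_image bump_continuous) simp
  then obtain C where C: "\<And>t. t \<in> {0..1 / 4} \<Longrightarrow> \<bar>bump k t\<bar> \<le> C"
    using compact_imp_bounded by (fastforce simp: bounded_iff)
  have "0 \<le> C" using C[of 0] by simp
  show thesis
  proof (rule that[OF \<open>0 \<le> C\<close>])
    fix t :: real assume "t \<le> 1 / 4"
    then show "\<bar>bump k t\<bar> \<le> C" using C[of t] bump_zero[of t k] \<open>0 \<le> C\<close> by (cases "t \<le> 0") auto
  qed
qed

text \<open>A Gaussian of width \<open>\<delta>\<close> centred at \<open>e\<close>, cut off smoothly at the distance \<open>1 / 2\<close> so that it
  stays away from the origin when \<open>|e| = 1\<close>. The cutoff does not move with \<open>\<delta>\<close>: after rescaling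
  by \<open>\<delta>\<close> it tends to a constant.\<close>

definition spike :: "real \<Rightarrow> real ^ 'n::finite \<Rightarrow> real ^ 'n \<Rightarrow> real" where
  "spike \<delta> e x = bump 0 (1 / 4 - (norm (x - e))\<^sup>2) * exp (- (norm (x - e))\<^sup>2 / (2 * \<delta>\<^sup>2))"

lemma spike_zero: "1 / 2 \<le> norm (x - e) \<Longrightarrow> spike \<delta> e x = 0"
proof -
  assume "1 / 2 \<le> norm (x - e)"
  then have "(1 / 2)\<^sup>2 \<le> (norm (x - e))\<^sup>2" by (intro power_mono) auto
  then show ?thesis by (simp add: spike_def bump_zero power2_eq_square)
qed

lemma spike_smooth: "smooth (spike \<delta> e)"
proof (rule smooth_if_differentiable_upto)
  fix k
  have "differentiable_upto k (\<lambda>x. bump 0 ((- 1) * (norm (x - e))\<^sup>2 + 1 / 4))"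
    by (rule differentiable_upto_compose[where \<psi> = bump, OF bump_has_derivative differentiable_upto_dist_square])
  moreover have "differentiable_upto k (\<lambda>x. exp ((- 1 / (2 * \<delta>\<^sup>2)) * (norm (x - e))\<^sup>2 + 0))"
    by (rule differentiable_upto_compose[where \<psi> = "\<lambda>j. exp", OF DERIV_exp differentiable_upto_dist_square])
  ultimately have "differentiable_upto k (\<lambda>x. bump 0 ((- 1) * (norm (x - e))\<^sup>2 + 1 / 4) *
      exp ((- 1 / (2 * \<delta>\<^sup>2)) * (norm (x - e))\<^sup>2 + 0))"
    by (rule differentiable_upto_mult)
  then show "differentiable_upto k (spike \<delta> e)"
    by (simp add: spike_def[abs_def])
qed

lemma spike_test_function:
  assumes "norm e = 1"
  shows "test_function (spike \<delta> e)"
proof -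
  have "{x. spike \<delta> e x \<noteq> 0} \<subseteq> cball e (1 / 2)"
    using spike_zero[of _ e \<delta>] by (force simp: dist_norm norm_minus_commute)
  then have sub: "closure {x. spike \<delta> e x \<noteq> 0} \<subseteq> cball e (1 / 2)"
    by (rule closure_minimal) simp
  then have "compact (closure {x. spike \<delta> e x \<noteq> 0})"
    by (meson bounded_cball bounded_subset compact_eq_bounded_closed closed_closure)
  moreover have "0 \<notin> closure {x. spike \<delta> e x \<noteq> 0}"
    using sub assms by (auto simp: subset_iff dist_norm)
  ultimately show ?thesis by (simp add: test_function_def spike_smooth)
qed

lemma grad_spike:
  "grad (spike \<delta> e) x =
    (- (2 * bump 1 (1 / 4 - (norm (x - e))\<^sup>2) + bump 0 (1 / 4 - (norm (x - e))\<^sup>2) / \<delta>\<^sup>2) *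
      exp (- (norm (x - e))\<^sup>2 / (2 * \<delta>\<^sup>2))) *\<^sub>R (x - e)"
proof (rule grad_eqI)
  let ?q = "(norm (x - e))\<^sup>2"
  have dq: "((\<lambda>x. (norm (x - e))\<^sup>2) has_derivative (\<lambda>v. 2 * ((x - e) \<bullet> v))) (at x)"
    unfolding power2_norm_eq_inner by (auto intro!: derivative_eq_intros simp: inner_commute)
  have d1: "((\<lambda>x. bump 0 (1 / 4 - (norm (x - e))\<^sup>2)) has_derivative
      (\<lambda>v. bump 1 (1 / 4 - ?q) * (- (2 * ((x - e) \<bullet> v))))) (at x)"
    using has_derivative_compose[OF has_derivative_diff[OF has_derivative_const dq]
        bump_has_derivative[of 0, unfolded has_field_derivative_def]] by simp
  have d2: "((\<lambda>x. exp (- (norm (x - e))\<^sup>2 / (2 * \<delta>\<^sup>2))) has_derivative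
      (\<lambda>v. exp (- ?q / (2 * \<delta>\<^sup>2)) * (- (2 * ((x - e) \<bullet> v)) / (2 * \<delta>\<^sup>2)))) (at x)"
  proof -
    have "((\<lambda>x. - (norm (x - e))\<^sup>2 / (2 * \<delta>\<^sup>2)) has_derivative (\<lambda>v. - (2 * ((x - e) \<bullet> v)) / (2 * \<delta>\<^sup>2))) (at x)"
      unfolding divide_inverse by (intro has_derivative_mult_left has_derivative_minus dq)
    from has_derivative_exp[OF this] show ?thesis
      by (rule has_derivative_eq_rhs) (rule ext, rule mult.commute)
  qed
  have ring: "B\<^sub>0 * (E * (- (2 * s) / (2 * D))) + B\<^sub>1 * (- (2 * s)) * E = - (2 * B\<^sub>1 + B\<^sub>0 / D) * E * s"
    for B\<^sub>0 B\<^sub>1 E s D :: real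
    by (simp add: algebra_simps)
  show "(spike \<delta> e has_derivative (\<lambda>v. (- (2 * bump 1 (1 / 4 - ?q) + bump 0 (1 / 4 - ?q) / \<delta>\<^sup>2) *
      exp (- ?q / (2 * \<delta>\<^sup>2))) *\<^sub>R (x - e) \<bullet> v)) (at x)"
    unfolding spike_def[abs_def]
    by (rule has_derivative_eq_rhs[OF has_derivative_mult[OF d1 d2]])
       (rule ext, simp only: inner_scaleR_left ring)
qed

lemma integral_rescale:
  fixes f :: "real ^ 'n::finite \<Rightarrow> real"
  assumes [measurable]: "f \<in> borel_measurable borel" and nn: "\<And>x. 0 \<le> f x" and \<delta>: "0 < \<delta>"
  shows "(LINT x|lborel. f x) = \<delta> ^ CARD('n) * (LINT y|lborel. f (e + \<delta> *\<^sub>R y))"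
proof -
  have "(\<integral>\<^sup>+x. ennreal (f x) \<partial>lborel) = (\<integral>\<^sup>+y. ennreal (f (e + \<delta> *\<^sub>R y)) * ennreal (\<delta> ^ CARD('n)) \<partial>lborel)"
    using \<delta> by (subst nn_integral_lborel_scaleR[where c = \<delta> and t = e]) auto
  also have "\<dots> = ennreal (\<delta> ^ CARD('n)) * (\<integral>\<^sup>+y. ennreal (f (e + \<delta> *\<^sub>R y)) \<partial>lborel)"
    by (subst nn_integral_multc) (auto simp: mult.commute)
  finally show ?thesis
    using \<delta> by (simp add: integral_eq_nn_integral nn enn2real_mult)
qed

lemma powr_le_2_powr:
  fixes r t :: real
  assumes "1 / 2 \<le> r" "r \<le> 2"
  shows "r powr t \<le> 2 powr \<bar>t\<bar>"
proof (cases "0 \<le> t")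
  case True
  with assms show ?thesis by (simp add: powr_mono2)
next
  case False
  have "r powr t \<le> (1 / 2) powr t"
    using assms False by (intro powr_mono2') auto
  also have "\<dots> = 2 powr \<bar>t\<bar>"
    using False by (simp add: powr_divide powr_minus_divide)
  finally show ?thesis .
qed

lemma bounded_weight_limit:
  fixes H :: "nat \<Rightarrow> 'a \<Rightarrow> real"
  assumes [measurable]: "\<And>n. H n \<in> borel_measurable M" and g: "integrable M g"
    and bound: "\<And>n y. \<bar>H n y\<bar> \<le> C" and lim: "\<And>y. (\<lambda>n. H n y) \<longlonglongrightarrow> L"
  shows "(\<lambda>n. LINT y|M. H n y * g y) \<longlonglongrightarrow> L * (LINT y|M. g y)"
proof -
  have [measurable]: "g \<in> borel_measurable M" using g by auto
  have "(\<lambda>n. LINT y|M. H n y * g y) \<longlonglongrightarrow> (LINT y|M. L * g y)"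
  proof (rule integral_dominated_convergence)
    show "integrable M (\<lambda>y. C * \<bar>g y\<bar>)" using g by auto
    show "AE y in M. (\<lambda>n. H n y * g y) \<longlonglongrightarrow> L * g y"
      by (intro AE_I2 tendsto_intros lim)
    show "AE y in M. norm (H n y * g y) \<le> C * \<bar>g y\<bar>" for n
      by (intro AE_I2) (simp add: abs_mult mult_right_mono bound)
  qed measurable
  then show ?thesis by simp
qed

text \<open>Where the cutoff is not 0, the point \<open>e + \<delta> y\<close> is at distance between \<open>1 / 2\<close> and 2 from the
  origin, so every power of this distance is bounded.\<close>

lemma cutoff_weight_bound:
  fixes e y :: "real ^ 'n::finite"
  assumes e: "norm e = 1" and A: "0 \<le> A" "A \<le> C" and z: "1 / 4 \<le> \<delta>\<^sup>2 * (norm y)\<^sup>2 \<Longrightarrow> A = 0"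
  shows "\<bar>A / norm (e + \<delta> *\<^sub>R y) powr t\<bar> \<le> C * 2 powr \<bar>t\<bar>"
proof (cases "1 / 4 \<le> \<delta>\<^sup>2 * (norm y)\<^sup>2")
  case True
  with z A show ?thesis by simp
next
  case False
  have "norm (\<delta> *\<^sub>R y) < 1 / 2"
  proof (rule power_less_imp_less_base)
    show "(norm (\<delta> *\<^sub>R y))\<^sup>2 < (1 / 2)\<^sup>2" using False by (simp add: power_mult_distrib power_divide)
  qed simp
  then have "1 / 2 \<le> norm (e + \<delta> *\<^sub>R y)" "norm (e + \<delta> *\<^sub>R y) \<le> 2"
    using e norm_triangle_ineq[of e "\<delta> *\<^sub>R y"] norm_triangle_ineq2[of e "- (\<delta> *\<^sub>R y)"] by auto
  then have "norm (e + \<delta> *\<^sub>R y) powr (- t) \<le> 2 powr \<bar>- t\<bar>" by (rule powr_le_2_powr)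
  then have "A * norm (e + \<delta> *\<^sub>R y) powr (- t) \<le> C * 2 powr \<bar>t\<bar>"
    using A by (intro mult_mono) auto
  then show ?thesis using A by (simp add: powr_minus divide_inverse)
qed

lemma integrable_gauss:
  assumes "0 < l"
  shows "integrable lborel (\<lambda>x :: 'a::euclidean_space. exp (- (l * (norm x)\<^sup>2)))"
    "(LINT x|lborel. exp (- (l * (norm (x :: 'a))\<^sup>2))) = sqrt (pi / l) ^ DIM('a)"
proof -
  show "integrable lborel (\<lambda>x :: 'a. exp (- (l * (norm x)\<^sup>2)))"
    by (intro integrableI_nonneg) (auto simp: nn_integral_gauss_euclidean[OF assms])
  show "(LINT x|lborel. exp (- (l * (norm (x :: 'a))\<^sup>2))) = sqrt (pi / l) ^ DIM('a)"
    using assms by (subst integral_eq_nn_integral) (auto simp: nn_integral_gauss_euclidean[OF assms])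
qed

lemma integrable_gauss_moment:
  "integrable lborel (\<lambda>x :: 'a::euclidean_space. (norm x)\<^sup>2 * exp (- (norm x)\<^sup>2))"
  "(LINT x|lborel. (norm (x :: 'a))\<^sup>2 * exp (- (norm x)\<^sup>2)) = real DIM('a) / 2 * sqrt pi ^ DIM('a)"
proof -
  show "integrable lborel (\<lambda>x :: 'a. (norm x)\<^sup>2 * exp (- (norm x)\<^sup>2))"
    by (intro integrableI_nonneg) (auto simp: nn_integral_gauss_euclidean_moment)
  show "(LINT x|lborel. (norm (x :: 'a))\<^sup>2 * exp (- (norm x)\<^sup>2)) = real DIM('a) / 2 * sqrt pi ^ DIM('a)"
    by (subst integral_eq_nn_integral) (auto simp: nn_integral_gauss_euclidean_moment)
qed

text \<open>After the substitution \<open>x = e + \<delta> y\<close> the weights and the cutoff converge boundedly to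
  constants, and a Gaussian integral remains. The derivative of the cutoff carries a factor
  \<open>\<delta>\<^sup>2\<close> and disappears.\<close>

lemma spike_integrals:
  fixes e :: "real ^ 'n::finite"
  assumes e: "norm e = 1" and p: "0 < p" and \<delta>0: "\<And>n. 0 < \<delta> n" and \<delta>1: "\<And>n. \<delta> n \<le> 1"
    and \<delta>: "\<delta> \<longlonglongrightarrow> (0 :: real)"
  defines "b \<equiv> bump 0 (1 / 4)"
  shows "\<exists>J. (\<forall>n. (LINT x|lborel. \<bar>spike (\<delta> n) e x\<bar> powr p / norm x powr t) = \<delta> n ^ CARD('n) * J n) \<and>
      J \<longlonglongrightarrow> b powr p * sqrt (2 * pi / p) ^ CARD('n)" (is ?density)
    and "\<exists>J. (\<forall>n. (LINT x|lborel. (norm (grad (spike (\<delta> n) e) x))\<^sup>2 / norm x powr t) = \<delta> n ^ CARD('n) / (\<delta> n)\<^sup>2 * J n) \<and>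
      J \<longlonglongrightarrow> b\<^sup>2 * (real CARD('n) / 2 * sqrt pi ^ CARD('n))" (is ?gradient)
proof -
  let ?B = "\<lambda>k n y. bump k (1 / 4 - (\<delta> n)\<^sup>2 * (norm y)\<^sup>2)"
  have arg: "(\<lambda>n. 1 / 4 - (\<delta> n)\<^sup>2 * (norm y)\<^sup>2) \<longlonglongrightarrow> 1 / 4" for y :: "real ^ 'n"
    using tendsto_diff[OF tendsto_const[of "1 / 4"] tendsto_mult[OF tendsto_power[OF \<delta>, of 2] tendsto_const[of "(norm y)\<^sup>2"]]]
    by simp
  have Blim: "(\<lambda>n. ?B k n y) \<longlonglongrightarrow> bump k (1 / 4)" for k and y :: "real ^ 'n"
    using continuous_on_tendsto_compose[OF bump_continuous[of UNIV k] arg] by simp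
  have wlim: "(\<lambda>n. norm (e + \<delta> n *\<^sub>R y) powr t) \<longlonglongrightarrow> 1" for y
  proof -
    have "(\<lambda>n. norm (e + \<delta> n *\<^sub>R y) powr t) \<longlonglongrightarrow> norm (e + 0 *\<^sub>R y) powr t"
      by (intro tendsto_intros \<delta>) (use e in auto)
    then show ?thesis using e by simp
  qed
  have small: "\<delta> n ^ 2 \<le> 1" for n using \<delta>0[of n] \<delta>1[of n] by (simp add: power_le_one)
  have sm: "continuous_on UNIV (spike (\<delta> n) e)" "continuous_on UNIV (grad (spike (\<delta> n) e))" for n
    by (intro smooth_continuous smooth_grad_continuous spike_smooth)+
  have [measurable]: "spike (\<delta> n) e \<in> borel_measurable borel" "grad (spike (\<delta> n) e) \<in> borel_measurable borel" for n
    using sm by (auto intro!: borel_measurable_continuous_onI)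
  show ?density
  proof (intro exI conjI allI)
    let ?H = "\<lambda>n y. (?B 0 n y) powr p / norm (e + \<delta> n *\<^sub>R y) powr t"
    have pt: "\<bar>spike (\<delta> n) e (e + \<delta> n *\<^sub>R y)\<bar> powr p / norm (e + \<delta> n *\<^sub>R y) powr t =
        ?H n y * exp (- (p / 2 * (norm y)\<^sup>2))" for n y
    proof -
      have "\<bar>spike (\<delta> n) e (e + \<delta> n *\<^sub>R y)\<bar> = ?B 0 n y * exp (- (norm y)\<^sup>2 / 2)"
        using \<delta>0[of n] by (simp add: spike_def power_mult_distrib bump_nonneg abs_mult field_simps)
      then have "\<bar>spike (\<delta> n) e (e + \<delta> n *\<^sub>R y)\<bar> powr p = ?B 0 n y powr p * exp (- (p / 2 * (norm y)\<^sup>2))"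
        by (simp add: powr_mult bump_nonneg powr_def[of "exp _"])
      then show ?thesis by simp
    qed
    show "(LINT x|lborel. \<bar>spike (\<delta> n) e x\<bar> powr p / norm x powr t) =
        \<delta> n ^ CARD('n) * (LINT y|lborel. ?H n y * exp (- (p / 2 * (norm y)\<^sup>2)))" for n
      by (subst integral_rescale[OF _ _ \<delta>0, of _ n e]) (auto simp: pt)
    have "(\<lambda>n. LINT y|lborel. ?H n y * exp (- (p / 2 * (norm y)\<^sup>2))) \<longlonglongrightarrow>
        b powr p * (LINT y|lborel. exp (- (p / 2 * (norm (y :: real ^ 'n))\<^sup>2)))"
    proof (rule bounded_weight_limit)
      show "\<bar>?H n y\<bar> \<le> 1 * 2 powr \<bar>t\<bar>" for n y
        using p by (intro cutoff_weight_bound[OF e])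
          (auto intro!: powr_le1 simp: bump_nonneg bump_le_1 bump_zero)
      show "(\<lambda>n. ?H n y) \<longlonglongrightarrow> b powr p" for y
      proof -
        have "(\<lambda>n. ?H n y) \<longlonglongrightarrow> b powr p / 1"
          unfolding b_def by (intro tendsto_divide tendsto_powr wlim Blim tendsto_const)
            (use bump_pos[of "1 / 4"] in auto)
        then show ?thesis by simp
      qed
      show "integrable lborel (\<lambda>y :: real ^ 'n. exp (- (p / 2 * (norm y)\<^sup>2)))"
        using p by (intro integrable_gauss) auto
    qed measurable
    then show "(\<lambda>n. LINT y|lborel. ?H n y * exp (- (p / 2 * (norm y)\<^sup>2))) \<longlonglongrightarrow>
        b powr p * sqrt (2 * pi / p) ^ CARD('n)"
      using p by (subst (asm) integrable_gauss(2)) (auto simp: mult.commute)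
  qed
  obtain C where C: "0 \<le> C" "\<And>t. t \<le> 1 / 4 \<Longrightarrow> \<bar>bump 1 t\<bar> \<le> C"
    using bump_bounded[of 1] by blast
  show ?gradient
  proof (intro exI conjI allI)
    let ?F = "\<lambda>n y. 2 * (\<delta> n)\<^sup>2 * ?B 1 n y + ?B 0 n y"
    let ?H = "\<lambda>n y. (?F n y)\<^sup>2 / norm (e + \<delta> n *\<^sub>R y) powr t"
    have pt: "(norm (grad (spike (\<delta> n) e) (e + \<delta> n *\<^sub>R y)))\<^sup>2 / norm (e + \<delta> n *\<^sub>R y) powr t =
        1 / (\<delta> n)\<^sup>2 * (?H n y * ((norm y)\<^sup>2 * exp (- (norm y)\<^sup>2)))" for n y
    proof -
      have sq: "(norm ((- c) *\<^sub>R y))\<^sup>2 = c\<^sup>2 * (norm y)\<^sup>2" for c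
        by (simp add: power_mult_distrib)
      have ex: "(exp (- (norm y)\<^sup>2 / 2))\<^sup>2 = exp (- (norm y)\<^sup>2)"
        by (simp add: power2_eq_square exp_add[symmetric])
      have "grad (spike (\<delta> n) e) (e + \<delta> n *\<^sub>R y) = (- (?F n y / \<delta> n * exp (- (norm y)\<^sup>2 / 2))) *\<^sub>R y"
        using \<delta>0[of n] by (simp add: grad_spike power_mult_distrib field_simps power2_eq_square)
      then have "(norm (grad (spike (\<delta> n) e) (e + \<delta> n *\<^sub>R y)))\<^sup>2 =
          (?F n y / \<delta> n * exp (- (norm y)\<^sup>2 / 2))\<^sup>2 * (norm y)\<^sup>2"
        by (simp only: sq)
      also have "\<dots> = 1 / (\<delta> n)\<^sup>2 * ((?F n y)\<^sup>2 * ((norm y)\<^sup>2 * exp (- (norm y)\<^sup>2)))"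
        unfolding power_mult_distrib ex by (simp add: power_divide)
      finally show ?thesis by simp
    qed
    show "(LINT x|lborel. (norm (grad (spike (\<delta> n) e) x))\<^sup>2 / norm x powr t) =
        \<delta> n ^ CARD('n) / (\<delta> n)\<^sup>2 * (LINT y|lborel. ?H n y * ((norm y)\<^sup>2 * exp (- (norm y)\<^sup>2)))" for n
      by (subst integral_rescale[OF _ _ \<delta>0, of _ n e]) (simp_all only: pt integral_mult_right_zero, auto)
    have "(\<lambda>n. LINT y|lborel. ?H n y * ((norm y)\<^sup>2 * exp (- (norm y)\<^sup>2))) \<longlonglongrightarrow>
        b\<^sup>2 * (LINT y|lborel. ((norm (y :: real ^ 'n))\<^sup>2 * exp (- (norm y)\<^sup>2)))"
    proof (rule bounded_weight_limit)
      show "\<bar>?H n y\<bar> \<le> (2 * C + 1)\<^sup>2 * 2 powr \<bar>t\<bar>" for n y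
      proof (intro cutoff_weight_bound[OF e])
        have "\<bar>?F n y\<bar> \<le> 2 * (\<delta> n)\<^sup>2 * \<bar>?B 1 n y\<bar> + \<bar>?B 0 n y\<bar>"
          by (rule order_trans[OF abs_triangle_ineq]) (simp add: abs_mult)
        also have "\<dots> \<le> 2 * 1 * C + 1"
          by (intro add_mono mult_mono C small) (auto simp: C bump_nonneg bump_le_1)
        finally have "\<bar>?F n y\<bar> \<le> \<bar>2 * C + 1\<bar>" using C(1) by simp
        then show "(?F n y)\<^sup>2 \<le> (2 * C + 1)\<^sup>2" by (simp add: abs_le_square_iff)
      qed (auto simp: bump_zero)
      show "(\<lambda>n. ?H n y) \<longlonglongrightarrow> b\<^sup>2" for y
      proof -
        have "(\<lambda>n. ?H n y) \<longlonglongrightarrow> (2 * 0\<^sup>2 * bump 1 (1 / 4) + b)\<^sup>2 / 1"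
          unfolding b_def by (intro tendsto_intros wlim Blim \<delta>) auto
        then show ?thesis by simp
      qed
    qed (use integrable_gauss_moment in \<open>auto\<close>)
    then show "(\<lambda>n. LINT y|lborel. ?H n y * ((norm y)\<^sup>2 * exp (- (norm y)\<^sup>2))) \<longlonglongrightarrow>
        b\<^sup>2 * (real CARD('n) / 2 * sqrt pi ^ CARD('n))"
      by (subst (asm) integrable_gauss_moment(2)) auto
  qed
qed

section \<open>A competitor that beats radial functions\<close>

lemma test_function_D12:
  assumes "test_function \<phi>"
  shows "D12 a \<phi> (grad \<phi>)"
  unfolding D12_def using test_function_measurable[OF assms] assms
  by (intro conjI exI[of _ "\<lambda>n. \<phi>"]) auto

lemma grad_spike_zero: "1 / 2 \<le> norm (x - e) \<Longrightarrow> grad (spike \<delta> e) x = 0"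
proof -
  assume "1 / 2 \<le> norm (x - e)"
  then have "(1 / 2)\<^sup>2 \<le> (norm (x - e))\<^sup>2" by (intro power_mono) auto
  then show ?thesis by (simp add: grad_spike bump_zero power2_eq_square)
qed

lemma spike_support:
  assumes e: "norm e = 1" and x: "\<not> (1 / 2 \<le> norm x \<and> norm x \<le> 2)"
  shows "spike \<delta> e x = 0 \<and> grad (spike \<delta> e) x = 0"
proof -
  have "1 / 2 \<le> norm (x - e)"
    using e x norm_triangle_ineq2[of x e] norm_triangle_ineq3[of x e] by linarith
  then show ?thesis by (simp add: spike_zero grad_spike_zero)
qed

text \<open>On the support, changing the exponent by \<open>\<epsilon>\<close> changes the weight by a factor of at most
  \<open>2 powr \<epsilon>\<close>.\<close>

lemma continuous_weighted_integral:
  fixes f :: "real ^ 'n::finite \<Rightarrow> real"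
  assumes nn: "\<And>x. 0 \<le> f x" and supp: "\<And>x. \<not> (1 / 2 \<le> norm x \<and> norm x \<le> 2) \<Longrightarrow> f x = 0"
    and I: "\<And>t. integrable lborel (\<lambda>x. f x / norm x powr t)"
  shows "isCont (\<lambda>t. LINT x|lborel. f x / norm x powr t) t\<^sub>0"
proof -
  define F where "F t = (LINT x|lborel. f x / norm x powr t)" for t
  have le: "F t \<le> 2 powr \<bar>t - s\<bar> * F s" for s t
  proof -
    have "F t \<le> (LINT x|lborel. 2 powr \<bar>t - s\<bar> * (f x / norm x powr s))"
      unfolding F_def
    proof (intro integral_mono I integrable_mult_right)
      fix x :: "real ^ 'n"
      show "f x / norm x powr t \<le> 2 powr \<bar>t - s\<bar> * (f x / norm x powr s)"
      proof (cases "1 / 2 \<le> norm x \<and> norm x \<le> 2")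
        case True
        then have "norm x powr (s - t) \<le> 2 powr \<bar>s - t\<bar>" by (intro powr_le_2_powr) auto
        then have "norm x powr (s - t) * (f x / norm x powr s) \<le> 2 powr \<bar>t - s\<bar> * (f x / norm x powr s)"
          using nn[of x] by (intro mult_right_mono) (auto simp: abs_minus_commute)
        moreover have "norm x powr (s - t) * (f x / norm x powr s) = f x / norm x powr t"
          using True by (auto simp: powr_diff)
        ultimately show ?thesis by simp
      qed (use supp in auto)
    qed
    then show ?thesis unfolding F_def integral_mult_right_zero .
  qed
  have "(F \<longlongrightarrow> F t\<^sub>0) (at t\<^sub>0)"
  proof (rule tendsto_sandwich)
    show "\<forall>\<^sub>F t in at t\<^sub>0. 2 powr (- \<bar>t\<^sub>0 - t\<bar>) * F t\<^sub>0 \<le> F t"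
      using le[of t\<^sub>0] by (intro always_eventually allI) (simp add: powr_minus field_simps)
    show "\<forall>\<^sub>F t in at t\<^sub>0. F t \<le> 2 powr \<bar>t - t\<^sub>0\<bar> * F t\<^sub>0"
      using le by (intro always_eventually allI)
    have "((\<lambda>t. 2 powr (- \<bar>t\<^sub>0 - t\<bar>) * F t\<^sub>0) \<longlongrightarrow> 2 powr (- \<bar>t\<^sub>0 - t\<^sub>0\<bar>) * F t\<^sub>0) (at t\<^sub>0)"
      by (intro tendsto_intros) auto
    then show "((\<lambda>t. 2 powr (- \<bar>t\<^sub>0 - t\<bar>) * F t\<^sub>0) \<longlongrightarrow> F t\<^sub>0) (at t\<^sub>0)" by simp
    have "((\<lambda>t. 2 powr \<bar>t - t\<^sub>0\<bar> * F t\<^sub>0) \<longlongrightarrow> 2 powr \<bar>t\<^sub>0 - t\<^sub>0\<bar> * F t\<^sub>0) (at t\<^sub>0)"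
      by (intro tendsto_intros) auto
    then show "((\<lambda>t. 2 powr \<bar>t - t\<^sub>0\<bar> * F t\<^sub>0) \<longlongrightarrow> F t\<^sub>0) (at t\<^sub>0)" by simp
  qed
  then show ?thesis by (simp add: isCont_def F_def[abs_def])
qed

lemma vartheta_identity:
  "0 < p \<Longrightarrow> 2 * vartheta_exp p d = real d - 2 * (real d / p)"
  by (simp add: vartheta_exp_def field_simps)

lemma ln_half_le: "0 < p \<Longrightarrow> 1 - p / 2 \<le> ln (2 / (p :: real))"
  using ln_le_minus_one[of "p / 2"] by (simp add: ln_div)

text \<open>The value of the Gagliardo-Nirenberg quotient at a Gaussian, compared with its logarithmic
  Sobolev limit through \<open>ln (2 / p) \<ge> 1 - p / 2\<close>.\<close>

lemma gaussian_ratio_bound: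
  fixes p d :: real
  assumes p: "2 < p" and d: "0 < d" and \<theta>: "2 * \<theta> = d - 2 * (d / p)"
  shows "(d / 2) powr \<theta> * pi powr (d / 2) \<le> (pi * exp 1 * d / 2) powr \<theta> * (2 * pi / p) powr (d / p)"
proof -
  have "ln (2 / p) \<ge> 1 - p / 2" using p by (intro ln_half_le) simp
  then have "(d / p) * (1 - p / 2) \<le> (d / p) * ln (2 / p)" using p d by (intro mult_left_mono) auto
  moreover have "(d / p) * (1 - p / 2) = - \<theta>" using \<theta> p by (simp add: field_simps)
  ultimately have key: "- \<theta> \<le> (d / p) * ln (2 / p)" by simp
  have dp: "d / 2 = \<theta> + d / p" using \<theta> by simp
  have "ln (pi * exp 1 * d / 2) = ln pi + 1 + ln (d / 2)"
    using d ln_mult[of "pi * exp 1" "d / 2"] by (simp add: ln_mult)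
  moreover have "ln (2 * pi / p) = ln pi + ln (2 / p)"
    using p ln_mult[of pi "2 / p"] by (simp add: mult.commute)
  ultimately have "\<theta> * ln (d / 2) + (d / 2) * ln pi \<le> \<theta> * ln (pi * exp 1 * d / 2) + (d / p) * ln (2 * pi / p)"
    using key by (simp only:) (simp add: dp algebra_simps)
  then show ?thesis
    using p d by (simp add: powr_def exp_add[symmetric])
qed

text \<open>For \<open>\<theta> = vartheta_exp p d\<close> the powers of \<open>\<delta>\<close> on both sides of the inequality agree, so the
  quotient of \<open>spike \<delta> e\<close> converges to the Gaussian value, which exceeds \<open>c\<close>.\<close>

lemma concentrated_test_function:
  fixes a c p :: real
  assumes p: "2 < p" and c: "0 \<le> c"
    and lt: "c * (pi * exp 1 * real CARD('n) / 2) powr vartheta_exp p CARD('n) < 1"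
  obtains \<phi> :: "real ^ 'n::finite \<Rightarrow> real" where "test_function \<phi>"
    "\<And>x. \<not> (1 / 2 \<le> norm x \<and> norm x \<le> 2) \<Longrightarrow> \<phi> x = 0 \<and> grad \<phi> x = 0"
    "0 < (LINT x|lborel. (norm (grad \<phi> x))\<^sup>2 / norm x powr (2 * a))"
    "0 < (LINT x|lborel. \<bar>\<phi> x\<bar>\<^sup>2 / norm x powr (2 * (a + 1)))"
    "0 < (LINT x|lborel. ckn_density p a \<phi> x)"
    "c * ckn_rhs (vartheta_exp p CARD('n)) a \<phi> (grad \<phi>) < ckn_lhs p a \<phi>"
proof -
  let ?d = "real CARD('n)" and ?\<theta> = "vartheta_exp p CARD('n)"
  define b where "b = bump 0 (1 / 4)"
  have b: "0 < b" by (simp add: b_def bump_pos)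
  have p0: "0 < p" and two: "0 < (2 :: real)" using p by simp_all
  define e :: "real ^ 'n" where "e = axis undefined 1"
  have e: "norm e = 1" by (simp add: e_def)
  define \<delta> :: "nat \<Rightarrow> real" where "\<delta> n = inverse (real (Suc n))" for n
  have \<delta>0: "0 < \<delta> n" and \<delta>1: "\<delta> n \<le> 1" for n
    by (simp_all add: \<delta>_def inverse_le_1_iff)
  have \<delta>: "\<delta> \<longlonglongrightarrow> 0" unfolding \<delta>_def by (rule LIMSEQ_inverse_real_of_nat)
  obtain J\<^sub>1 where J1: "\<And>n. (LINT x|lborel. \<bar>spike (\<delta> n) e x\<bar> powr p / norm x powr (b_exp CARD('n) p a * p)) = \<delta> n ^ CARD('n) * J\<^sub>1 n"
    and J1lim: "J\<^sub>1 \<longlonglongrightarrow> b powr p * sqrt (2 * pi / p) ^ CARD('n)"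
    using spike_integrals(1)[OF e p0 \<delta>0 \<delta>1 \<delta>] unfolding b_def by blast
  obtain J\<^sub>3 where J3: "\<And>n. (LINT x|lborel. \<bar>spike (\<delta> n) e x\<bar> powr 2 / norm x powr (2 * (a + 1))) = \<delta> n ^ CARD('n) * J\<^sub>3 n"
    and J3lim: "J\<^sub>3 \<longlonglongrightarrow> b powr 2 * sqrt (2 * pi / 2) ^ CARD('n)"
    using spike_integrals(1)[OF e two \<delta>0 \<delta>1 \<delta>] unfolding b_def by blast
  obtain J\<^sub>2 where J2: "\<And>n. (LINT x|lborel. (norm (grad (spike (\<delta> n) e) x))\<^sup>2 / norm x powr (2 * a)) = \<delta> n ^ CARD('n) / (\<delta> n)\<^sup>2 * J\<^sub>2 n"
    and J2lim: "J\<^sub>2 \<longlonglongrightarrow> b\<^sup>2 * (?d / 2 * sqrt pi ^ CARD('n))"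
    using spike_integrals(2)[OF e p0 \<delta>0 \<delta>1 \<delta>] unfolding b_def by blast
  have d: "0 < ?d" by simp
  have J1pos: "\<forall>\<^sub>F n in sequentially. 0 < J\<^sub>1 n"
    by (rule order_tendstoD(1)[OF J1lim]) (use b p0 in auto)
  have J2pos: "\<forall>\<^sub>F n in sequentially. 0 < J\<^sub>2 n"
    by (rule order_tendstoD(1)[OF J2lim]) (use b in auto)
  have J3pos: "\<forall>\<^sub>F n in sequentially. 0 < J\<^sub>3 n"
    by (rule order_tendstoD(1)[OF J3lim]) (use b in auto)
  have sqpi: "sqrt pi ^ CARD('n) = pi powr (?d / 2)" "sqrt (2 * pi / p) ^ CARD('n) = (2 * pi / p) powr (?d / 2)"
    using p0 by (simp_all add: powr_half_sqrt[symmetric] powr_realpow[symmetric] powr_powr)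
  define L where "L = b\<^sup>2 * (c * ((?d / 2) powr ?\<theta> * pi powr (?d / 2)))"
  define R where "R = b\<^sup>2 * (2 * pi / p) powr (?d / p)"
  have "(\<lambda>n. c * (J\<^sub>2 n powr ?\<theta> * J\<^sub>3 n powr (1 - ?\<theta>))) \<longlonglongrightarrow>
      c * ((b\<^sup>2 * (?d / 2 * sqrt pi ^ CARD('n))) powr ?\<theta> * (b powr 2 * sqrt (2 * pi / 2) ^ CARD('n)) powr (1 - ?\<theta>))"
    by (intro tendsto_intros J2lim J3lim) (use b in auto)
  also have "c * ((b\<^sup>2 * (?d / 2 * sqrt pi ^ CARD('n))) powr ?\<theta> * (b powr 2 * sqrt (2 * pi / 2) ^ CARD('n)) powr (1 - ?\<theta>)) = L"
  proof -
    define Z where "Z = b\<^sup>2 * sqrt pi ^ CARD('n)"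
    have Z: "Z > 0" using b by (simp add: Z_def)
    have "(b\<^sup>2 * (?d / 2 * sqrt pi ^ CARD('n))) powr ?\<theta> = (?d / 2) powr ?\<theta> * Z powr ?\<theta>"
      using b by (subst powr_mult[symmetric]) (auto simp: Z_def mult_ac)
    moreover have "(b powr 2 * sqrt (2 * pi / 2) ^ CARD('n)) = Z"
      using b by (simp add: Z_def)
    moreover have "Z powr ?\<theta> * Z powr (1 - ?\<theta>) = Z"
      using Z by (simp add: powr_add[symmetric])
    ultimately show ?thesis by (simp add: L_def Z_def sqpi mult_ac)
  qed
  finally have Llim: "(\<lambda>n. c * (J\<^sub>2 n powr ?\<theta> * J\<^sub>3 n powr (1 - ?\<theta>))) \<longlonglongrightarrow> L" .
  have "(\<lambda>n. J\<^sub>1 n powr (2 / p)) \<longlonglongrightarrow> (b powr p * sqrt (2 * pi / p) ^ CARD('n)) powr (2 / p)"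
    by (intro tendsto_intros J1lim) (use b p0 in auto)
  also have "(b powr p * sqrt (2 * pi / p) ^ CARD('n)) powr (2 / p) = R"
    unfolding sqpi R_def using b p0 by (subst powr_mult) (auto simp: powr_powr)
  finally have Rlim: "(\<lambda>n. J\<^sub>1 n powr (2 / p)) \<longlonglongrightarrow> R" .
  have "L < R"
  proof -
    have "c * ((?d / 2) powr ?\<theta> * pi powr (?d / 2)) \<le>
        c * ((pi * exp 1 * ?d / 2) powr ?\<theta> * (2 * pi / p) powr (?d / p))"
      by (intro mult_left_mono gaussian_ratio_bound c p d vartheta_identity p0)
    also have "\<dots> = (c * (pi * exp 1 * ?d / 2) powr ?\<theta>) * (2 * pi / p) powr (?d / p)" by simp
    also have "\<dots> < 1 * (2 * pi / p) powr (?d / p)"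
      using p0 by (intro mult_strict_right_mono lt) auto
    finally show ?thesis using b by (simp add: L_def R_def)
  qed
  then have "\<forall>\<^sub>F n in sequentially. 0 < J\<^sub>1 n powr (2 / p) - c * (J\<^sub>2 n powr ?\<theta> * J\<^sub>3 n powr (1 - ?\<theta>))"
    by (intro order_tendstoD(1)[OF tendsto_diff[OF Rlim Llim]]) simp
  with J1pos J2pos J3pos have "\<forall>\<^sub>F n in sequentially. 0 < J\<^sub>1 n \<and> 0 < J\<^sub>2 n \<and> 0 < J\<^sub>3 n \<and>
      c * (J\<^sub>2 n powr ?\<theta> * J\<^sub>3 n powr (1 - ?\<theta>)) < J\<^sub>1 n powr (2 / p)"
    by eventually_elim auto
  then obtain n where n: "0 < J\<^sub>1 n" "0 < J\<^sub>2 n" "0 < J\<^sub>3 n"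
    "c * (J\<^sub>2 n powr ?\<theta> * J\<^sub>3 n powr (1 - ?\<theta>)) < J\<^sub>1 n powr (2 / p)"
    using eventually_happens'[OF sequentially_bot] by blast
  have \<delta>n: "\<delta> n ^ CARD('n) = \<delta> n powr ?d" "\<delta> n ^ CARD('n) / (\<delta> n)\<^sup>2 = \<delta> n powr (?d - 2)"
    using \<delta>0[of n] by (simp_all add: powr_realpow powr_diff)
  have scale: "(\<delta> n powr (?d - 2)) powr ?\<theta> * (\<delta> n powr ?d) powr (1 - ?\<theta>) = (\<delta> n powr ?d) powr (2 / p)"
  proof -
    have "(?d - 2) * ?\<theta> + ?d * (1 - ?\<theta>) = ?d - 2 * ?\<theta>" by (simp add: algebra_simps)
    also have "\<dots> = ?d * (2 / p)" using vartheta_identity[OF p0, of "CARD('n)"] by simp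
    finally show ?thesis by (simp add: powr_powr powr_add[symmetric])
  qed
  have I2: "(LINT x|lborel. (norm (grad (spike (\<delta> n) e) x))\<^sup>2 / norm x powr (2 * a)) = \<delta> n powr (?d - 2) * J\<^sub>2 n"
    unfolding J2 by (simp only: \<delta>n(2))
  have I3: "(LINT x|lborel. \<bar>spike (\<delta> n) e x\<bar>\<^sup>2 / norm x powr (2 * (a + 1))) = \<delta> n powr ?d * J\<^sub>3 n"
    using J3[of n] unfolding \<delta>n by (simp add: powr_numeral)
  have I1: "(LINT x|lborel. ckn_density p a (spike (\<delta> n) e) x) = \<delta> n powr ?d * J\<^sub>1 n"
    using J1[of n] unfolding \<delta>n ckn_density_def .
  show thesis
  proof (rule that)
    show "test_function (spike (\<delta> n) e)" by (rule spike_test_function[OF e])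
    show "spike (\<delta> n) e x = 0 \<and> grad (spike (\<delta> n) e) x = 0" if "\<not> (1 / 2 \<le> norm x \<and> norm x \<le> 2)" for x
      by (rule spike_support[OF e that])
    show "0 < (LINT x|lborel. (norm (grad (spike (\<delta> n) e) x))\<^sup>2 / norm x powr (2 * a))"
      unfolding I2 using n \<delta>0[of n] by simp
    show "0 < (LINT x|lborel. \<bar>spike (\<delta> n) e x\<bar>\<^sup>2 / norm x powr (2 * (a + 1)))"
      unfolding I3 using n \<delta>0[of n] by simp
    show "0 < (LINT x|lborel. ckn_density p a (spike (\<delta> n) e) x)"
      unfolding I1 using n \<delta>0[of n] by simp
    have "c * ckn_rhs ?\<theta> a (spike (\<delta> n) e) (grad (spike (\<delta> n) e)) =
        c * ((\<delta> n powr (?d - 2) * J\<^sub>2 n) powr ?\<theta> * (\<delta> n powr ?d * J\<^sub>3 n) powr (1 - ?\<theta>))"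
      by (simp only: ckn_rhs_def I2 I3)
    also have "\<dots> = (\<delta> n powr (?d - 2)) powr ?\<theta> * (\<delta> n powr ?d) powr (1 - ?\<theta>) *
        (c * (J\<^sub>2 n powr ?\<theta> * J\<^sub>3 n powr (1 - ?\<theta>)))"
      using n by (simp add: powr_mult mult_ac del: powr_powr)
    also have "\<dots> = (\<delta> n powr ?d) powr (2 / p) * (c * (J\<^sub>2 n powr ?\<theta> * J\<^sub>3 n powr (1 - ?\<theta>)))"
      unfolding scale ..
    also have "\<dots> < (\<delta> n powr ?d) powr (2 / p) * J\<^sub>1 n powr (2 / p)"
      using n(4) \<delta>0[of n] by simp
    also have "\<dots> = ckn_lhs p a (spike (\<delta> n) e)"
      unfolding ckn_lhs_def I1 using n by (simp add: powr_mult)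
    finally show "c * ckn_rhs ?\<theta> a (spike (\<delta> n) e) (grad (spike (\<delta> n) e)) < ckn_lhs p a (spike (\<delta> n) e)" .
  qed
qed

section \<open>Comparison and symmetry breaking\<close>

text \<open>The function \<open>X powr q / (\<Lambda> + X) powr \<theta>\<close> has its maximum at \<open>X = \<Lambda> q / (\<theta> - q)\<close>; this is the
  weighted inequality of arithmetic and geometric means for \<open>X / (\<Lambda> + X)\<close> and \<open>\<Lambda> / (\<Lambda> + X)\<close>.\<close>

lemma weighted_max:
  fixes q \<theta> \<Lambda> X :: real
  assumes q: "0 < q" "q < \<theta>" and \<Lambda>: "0 < \<Lambda>" and X: "0 \<le> X"
  shows "X powr q \<le> (q / \<theta>) powr q * ((\<theta> - q) / \<theta>) powr (\<theta> - q) * \<Lambda> powr (q - \<theta>) * (\<Lambda> + X) powr \<theta>"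
proof (cases "X = 0")
  case False
  with X have X: "X > 0" by simp
  define \<alpha> \<beta> where "\<alpha> = q / \<theta>" and "\<beta> = (\<theta> - q) / \<theta>"
  have ab: "0 < \<alpha>" "0 < \<beta>" "\<alpha> + \<beta> = 1" "\<alpha> * \<theta> = q" "\<beta> * \<theta> = \<theta> - q"
    using q by (auto simp: \<alpha>_def \<beta>_def field_simps)
  define S where "S = \<Lambda> + X"
  have S: "S > 0" using X \<Lambda> by (simp add: S_def)
  have "(X / S / \<alpha>) powr \<alpha> * (\<Lambda> / S / \<beta>) powr \<beta> \<le> \<alpha> * (X / S / \<alpha>) + \<beta> * (\<Lambda> / S / \<beta>)"
    using ab X \<Lambda> S by (intro Youngs_inequality_0) auto
  also have "\<dots> = 1" using ab S by (simp add: S_def add_divide_distrib[symmetric] add.commute)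
  finally have "((X / S / \<alpha>) powr \<alpha> * (\<Lambda> / S / \<beta>) powr \<beta>) powr \<theta> \<le> 1"
    using q by (intro powr_le1) auto
  also have "((X / S / \<alpha>) powr \<alpha> * (\<Lambda> / S / \<beta>) powr \<beta>) powr \<theta> =
      (X / S / \<alpha>) powr q * (\<Lambda> / S / \<beta>) powr (\<theta> - q)"
    using ab by (simp add: powr_mult powr_powr)
  also have "\<dots> = X powr q * \<Lambda> powr (\<theta> - q) / (\<alpha> powr q * \<beta> powr (\<theta> - q) * S powr \<theta>)"
  proof -
    have S\<theta>: "S powr \<theta> = S powr q * S powr (\<theta> - q)" by (simp add: powr_add[symmetric])
    show ?thesis unfolding S\<theta> using X \<Lambda> S ab by (simp add: powr_divide powr_mult mult_ac)
  qed
  finally have "X powr q * \<Lambda> powr (\<theta> - q) \<le> \<alpha> powr q * \<beta> powr (\<theta> - q) * S powr \<theta>"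
    using ab S by (simp add: pos_divide_le_eq)
  then have "X powr q * \<Lambda> powr (\<theta> - q) * \<Lambda> powr (q - \<theta>) \<le>
      \<alpha> powr q * \<beta> powr (\<theta> - q) * S powr \<theta> * \<Lambda> powr (q - \<theta>)"
    by (rule mult_right_mono) simp
  also have "X powr q * \<Lambda> powr (\<theta> - q) * \<Lambda> powr (q - \<theta>) = X powr q"
    using \<Lambda> by (simp add: mult.assoc powr_add[symmetric])
  finally show ?thesis by (simp add: \<alpha>_def \<beta>_def S_def mult_ac)
qed (use assms in auto)

text \<open>The bound for the quotient of radial functions, with \<open>\<sigma>\<close> the area of the sphere and
  \<open>\<Lambda> = (a_crit - a)\<^sup>2\<close>.\<close>

definition radial_bound :: "real \<Rightarrow> real \<Rightarrow> real \<Rightarrow> real \<Rightarrow> real" where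
  "radial_bound \<sigma> q \<theta> \<Lambda> = \<sigma> powr (- 2 * q) * line_const powr (- q) *
     ((q / \<theta>) powr q * ((\<theta> - q) / \<theta>) powr (\<theta> - q) * \<Lambda> powr (q - \<theta>))"

text \<open>In terms of the ray data the quotient is a constant times \<open>X powr q / (k\<^sup>2 + X) powr \<theta>\<close>, where
  \<open>N\<close> has cancelled by homogeneity.\<close>

lemma radial_quotient_bound:
  fixes u :: "real ^ 'n::finite \<Rightarrow> real"
  assumes D: "D12 a u G" and rad: "radially_symmetric u" and nz: "\<not> (AE x in lborel. u x = 0)"
    and a: "a < a_crit CARD('n)" and p: "2 < p" "p \<le> 5 / 2" and \<theta>: "(p - 2) / (2 * p) < \<theta>"
  shows "0 < ckn_rhs \<theta> a u G"
    and "ckn_lhs p a u \<le>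
      radial_bound (shell_mass TYPE('n)) ((p - 2) / (2 * p)) \<theta> ((a_crit CARD('n) - a)\<^sup>2) * ckn_rhs \<theta> a u G"
proof -
  define h where "h = p - 2"
  define q where "q = (p - 2) / (2 * p)"
  define k where "k = a_crit CARD('n) - a"
  define \<sigma> where "\<sigma> = shell_mass TYPE('n)"
  have \<sigma>: "\<sigma> > 0" by (simp add: \<sigma>_def shell_mass_pos)
  have h: "0 < h" "h \<le> 1 / 2" and ph: "2 + h = p" and q: "0 < q" "q < \<theta>" and k: "0 < k\<^sup>2"
    using p a \<theta> by (auto simp: h_def q_def k_def)
  obtain N X where N: "0 < N" and X: "0 \<le> X"
    and val: "(LINT x|lborel. \<bar>u x\<bar>\<^sup>2 / norm x powr (2 * (a + 1))) = \<sigma> * N"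
    and den: "(LINT x|lborel. ckn_density p a u x) = \<sigma> * (N powr (1 + h / 2) * (X / line_const) powr (h / 4))"
    and grd: "\<sigma> * (N * (k\<^sup>2 + X)) \<le> (LINT x|lborel. (norm (G x))\<^sup>2 / norm x powr (2 * a))"
    by (rule radial_ray_data[OF D rad nz k_def h, unfolded ph, folded \<sigma>_def])
  have pos: "0 < \<sigma> * (N * (k\<^sup>2 + X))"
    by (intro mult_pos_pos add_pos_nonneg \<sigma> N X k)
  with grd have A: "0 < (LINT x|lborel. (norm (G x))\<^sup>2 / norm x powr (2 * a))" by linarith
  then show "0 < ckn_rhs \<theta> a u G"
    unfolding ckn_rhs_def val using \<sigma> N by simp
  have "(\<sigma> * (N * (k\<^sup>2 + X))) powr \<theta> * (\<sigma> * N) powr (1 - \<theta>) \<le> ckn_rhs \<theta> a u G"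
    unfolding ckn_rhs_def val using grd pos q by (intro mult_right_mono powr_mono2) auto
  also have "(\<sigma> * (N * (k\<^sup>2 + X))) powr \<theta> * (\<sigma> * N) powr (1 - \<theta>) = \<sigma> * N * (k\<^sup>2 + X) powr \<theta>"
  proof -
    have "(\<sigma> * (N * (k\<^sup>2 + X))) powr \<theta> = (\<sigma> * N) powr \<theta> * (k\<^sup>2 + X) powr \<theta>"
      using \<sigma> N X k by (subst powr_mult[symmetric]) (auto simp: mult_ac)
    moreover have "(\<sigma> * N) powr \<theta> * (\<sigma> * N) powr (1 - \<theta>) = \<sigma> * N"
      using \<sigma> N by (simp add: powr_add[symmetric])
    ultimately show ?thesis by (simp add: mult_ac)
  qed
  finally have rhs: "\<sigma> * N * (k\<^sup>2 + X) powr \<theta> \<le> ckn_rhs \<theta> a u G" .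
  have lhs: "ckn_lhs p a u = \<sigma> powr (1 - 2 * q) * N * (X powr q * line_const powr (- q))"
  proof -
    have ex: "(1 + h / 2) * (2 / p) = 1" "h / 4 * (2 / p) = q" "2 / p = 1 - 2 * q"
      using p by (simp_all add: h_def q_def field_simps)
    have "ckn_lhs p a u = \<sigma> powr (2 / p) *
        ((N powr (1 + h / 2)) powr (2 / p) * ((X / line_const) powr (h / 4)) powr (2 / p))"
      unfolding ckn_lhs_def den using \<sigma> by (simp only: powr_mult)
    also have "(N powr (1 + h / 2)) powr (2 / p) = N" unfolding powr_powr ex(1) using N by simp
    also have "((X / line_const) powr (h / 4)) powr (2 / p) = X powr q * line_const powr (- q)"
      unfolding powr_powr ex(2) using X line_const_pos by (simp add: powr_divide powr_minus_divide)
    finally show ?thesis unfolding ex(3) by (simp add: mult.assoc)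
  qed
  let ?R = "(q / \<theta>) powr q * ((\<theta> - q) / \<theta>) powr (\<theta> - q) * (k\<^sup>2) powr (q - \<theta>)"
  have "ckn_lhs p a u \<le> \<sigma> powr (1 - 2 * q) * N * (?R * (k\<^sup>2 + X) powr \<theta> * line_const powr (- q))"
    unfolding lhs using N by (intro mult_left_mono mult_right_mono weighted_max q k X) auto
  also have "\<dots> = radial_bound \<sigma> q \<theta> (k\<^sup>2) * (\<sigma> * N * (k\<^sup>2 + X) powr \<theta>)"
  proof -
    have "\<sigma> powr (1 - 2 * q) = \<sigma> * \<sigma> powr (- 2 * q)"
      using \<sigma> by (simp add: powr_diff powr_minus divide_inverse)
    then show ?thesis by (simp add: radial_bound_def mult_ac)
  qed
  also have "\<dots> \<le> radial_bound \<sigma> q \<theta> (k\<^sup>2) * ckn_rhs \<theta> a u G"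
    by (intro mult_left_mono rhs) (simp add: radial_bound_def)
  finally show "ckn_lhs p a u \<le> radial_bound (shell_mass TYPE('n)) ((p - 2) / (2 * p)) \<theta> ((a_crit CARD('n) - a)\<^sup>2) * ckn_rhs \<theta> a u G"
    by (simp only: \<sigma>_def q_def k_def)
qed

text \<open>Numerically the left-hand side is about \<open>0.9155\<close>; this margin is what determines how far \<open>p\<close>
  may move away from 2.\<close>

lemma sphere_const_bound: "sphere_const\<^sup>2 * (2 * pi / 5) < 1"
proof -
  have s: "sqrt 2 < 1.4143" by (rule real_less_lsqrt) (auto simp: power2_eq_square)
  have "sphere_const\<^sup>2 = (3 / 2 + sqrt 2) / 4"
    by (simp add: sphere_const_def power2_eq_square field_simps)
  also have "\<dots> < 0.7286" using s by simp
  finally have "sphere_const\<^sup>2 * (2 * pi / 5) < 0.7286 * (2 * pi / 5)" by simp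
  also have "\<dots> < 1" using pi_approx(2) by simp
  finally show ?thesis .
qed

text \<open>Both factors are \<open>q\<close>-th powers, so the exponent \<open>q\<close> drops out. The \<open>m\<close>-th powers of
  \<open>m = d - 1\<close>, \<open>\<pi>\<close> and \<open>e\<close> then cancel against the estimate of the area of the sphere, which
  leaves the hypothesis \<open>near\<close>.\<close>

lemma radial_bound_strict:
  assumes d: "CARD('n::finite) = Suc m" and m: "m \<ge> 1" and p: "2 < p"
    and near: "sphere_const\<^sup>2 * (2 * pi / 5) * ((p + 2)\<^sup>2 / 16) ^ m < 1"
  shows "radial_bound (shell_mass TYPE('n)) ((p - 2) / (2 * p)) (vartheta_exp p CARD('n)) ((2 * real m / (p + 2))\<^sup>2)
    * (pi * exp 1 * real CARD('n) / 2) powr vartheta_exp p CARD('n) < 1"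
proof -
  define q where "q = (p - 2) / (2 * p)"
  define \<sigma> where "\<sigma> = shell_mass TYPE('n)"
  define D where "D = real CARD('n)"
  define \<Lambda> where "\<Lambda> = (2 * real m / (p + 2))\<^sup>2"
  have \<sigma>: "\<sigma> > 0" by (simp add: \<sigma>_def shell_mass_pos)
  have q: "q > 0" using p by (simp add: q_def)
  have D: "D = real m + 1" "D > 0" using d by (simp_all add: D_def)
  have \<Lambda>: "\<Lambda> > 0" using m p by (simp add: \<Lambda>_def)
  have \<theta>: "vartheta_exp p CARD('n) = D * q" by (simp add: vartheta_exp_def q_def D_def)
  have frac: "q / (D * q) = 1 / D" "real m * q / (D * q) = real m / D" "D * q - q = real m * q" "q - D * q = - (real m * q)"
  proof -
    show "q / (D * q) = 1 / D" using q by simp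
    show "D * q - q = real m * q" "q - D * q = - (real m * q)" by (simp_all add: D(1) algebra_simps)
    show "real m * q / (D * q) = real m / D" using q by simp
  qed
  \<comment> \<open>The left-hand side of the claim is \<open>Z powr q\<close>.\<close>
  define Z where "Z = (1 / \<sigma>\<^sup>2) * (1 / line_const) * ((1 / D) * (real m / D) ^ m * (1 / \<Lambda>) ^ m) * (pi * exp 1 * D / 2) ^ Suc m"
  have mpos: "0 < real m" using m by simp
  have pow: "x powr (real m * q) = (x ^ m) powr q" "x powr (D * q) = (x ^ Suc m) powr q" if "x > 0" for x
  proof -
    have "x ^ m = x powr real m" "x ^ Suc m = x powr D"
      using that powr_realpow[of x m] powr_realpow[of x "Suc m"] by (simp_all add: D(1) add.commute)
    then show "x powr (real m * q) = (x ^ m) powr q" "x powr (D * q) = (x ^ Suc m) powr q"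
      by (simp_all only: powr_powr)
  qed
  have "radial_bound \<sigma> q (D * q) \<Lambda> * (pi * exp 1 * D / 2) powr (D * q) = Z powr q"
  proof -
    have s1: "\<sigma> powr (- 2 * q) = (1 / \<sigma>\<^sup>2) powr q"
    proof -
      have "(\<sigma>\<^sup>2) powr q = \<sigma> powr (2 * q)" using \<sigma> by (simp add: powr_powr flip: powr_numeral)
      then show ?thesis using \<sigma> by (simp add: powr_divide powr_minus_divide)
    qed
    have s2: "line_const powr (- q) = (1 / line_const) powr q"
      using line_const_pos by (simp add: powr_divide powr_minus_divide)
    have s3: "\<Lambda> powr (- (real m * q)) = ((1 / \<Lambda>) ^ m) powr q"
      using pow(1)[of "1 / \<Lambda>"] \<Lambda> by (simp add: powr_divide powr_minus_divide)
    have s4: "(real m / D) powr (real m * q) = ((real m / D) ^ m) powr q"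
      "(pi * exp 1 * D / 2) powr (D * q) = ((pi * exp 1 * D / 2) ^ Suc m) powr q"
      using mpos D(2) by (intro pow; simp)+
    show ?thesis
      unfolding radial_bound_def frac Z_def s1 s2 s3 s4 by (simp only: powr_mult mult_ac)
  qed
  moreover have "0 < Z" unfolding Z_def using \<sigma> line_const_pos \<Lambda> D mpos by simp
  moreover have "Z < 1"
  proof -
    have "sqrt pi ^ CARD('n) \<le> \<sigma> * ((real m / (2 * exp 1)) powr (real m / 2) * (sphere_const * sqrt pi))"
      using shell_mass_lower_bound[where 'n = 'n] d m by (simp add: \<sigma>_def)
    then have "(sqrt pi ^ CARD('n))\<^sup>2 \<le> (\<sigma> * ((real m / (2 * exp 1)) powr (real m / 2) * (sphere_const * sqrt pi)))\<^sup>2"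
      by (intro power_mono) auto
    also have "(sqrt pi ^ CARD('n))\<^sup>2 = pi ^ Suc m"
      unfolding d power2_eq_square power_mult_distrib[symmetric] by simp
    also have "((real m / (2 * exp 1)) powr (real m / 2))\<^sup>2 = (real m / (2 * exp 1)) ^ m"
      using mpos by (simp add: powr_power powr_realpow)
    then have "(\<sigma> * ((real m / (2 * exp 1)) powr (real m / 2) * (sphere_const * sqrt pi)))\<^sup>2 =
        \<sigma>\<^sup>2 * (real m / (2 * exp 1)) ^ m * (sphere_const\<^sup>2 * pi)"
      by (simp add: power_mult_distrib)
    finally have "pi ^ m \<le> \<sigma>\<^sup>2 * ((real m / (2 * exp 1)) ^ m * sphere_const\<^sup>2)"
      by (simp add: mult_ac)
    then have inv: "1 / \<sigma>\<^sup>2 \<le> (real m / (2 * exp 1)) ^ m * sphere_const\<^sup>2 / pi ^ m"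
      using \<sigma> by (simp add: field_simps)
    define Y where "Y = (1 / line_const) * ((1 / D) * (real m / D) ^ m * (1 / \<Lambda>) ^ m) * (pi * exp 1 * D / 2) ^ Suc m"
    have Y: "0 \<le> Y" unfolding Y_def using line_const_pos \<Lambda> D by simp
    have "Z = (1 / \<sigma>\<^sup>2) * Y" by (simp add: Z_def Y_def)
    also have "\<dots> \<le> (real m / (2 * exp 1)) ^ m * sphere_const\<^sup>2 / pi ^ m * Y"
      by (rule mult_right_mono[OF inv Y])
    also have "\<dots> = sphere_const\<^sup>2 * (pi * exp 1 / 2 / line_const) *
        (real m / (2 * exp 1) / pi * (real m / D) * (1 / \<Lambda>) * (pi * exp 1 * D / 2)) ^ m"
    proof -
      have "T ^ m * C / P ^ m * ((1 / K) * ((1 / D) * V ^ m * W ^ m) * U ^ Suc m) =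
          C * (1 / D * U / K) * (T / P * V * W * U) ^ m" for T C P K V W U :: real
        by (simp add: power_mult_distrib power_divide mult_ac)
      moreover have "1 / D * (pi * exp 1 * D / 2) = pi * exp 1 / 2" using D(2) by simp
      ultimately show ?thesis by (simp only: Y_def)
    qed
    also have "real m / (2 * exp 1) / pi * (real m / D) * (1 / \<Lambda>) * (pi * exp 1 * D / 2) = (p + 2)\<^sup>2 / 16"
      using D(2) mpos p by (simp add: \<Lambda>_def field_simps power2_eq_square)
    also have "pi * exp 1 / 2 / line_const = 2 * pi / 5" by (simp add: line_const_def)
    also have "sphere_const\<^sup>2 * (2 * pi / 5) * ((p + 2)\<^sup>2 / 16) ^ m < 1" by (rule near)
    finally show ?thesis .
  qed
  ultimately have "radial_bound \<sigma> q (D * q) \<Lambda> * (pi * exp 1 * D / 2) powr (D * q) < 1"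
    using powr_less_mono2[of q Z 1] q by simp
  then show ?thesis unfolding \<theta> by (simp only: \<sigma>_def q_def \<Lambda>_def D_def)
qed

text \<open>The quotient of \<open>\<phi>\<close> is a lower bound for the optimal constant, also when that constant is
  infinite.\<close>

lemma no_radial_extremal_by_competitor:
  fixes u \<phi> :: "real ^ 'n::finite \<Rightarrow> real"
  assumes \<phi>: "test_function \<phi>" "0 < ckn_rhs \<theta> a \<phi> (grad \<phi>)"
    "c * ckn_rhs \<theta> a \<phi> (grad \<phi>) < ckn_lhs p a \<phi>" and c: "0 \<le> c"
    and u: "ckn_extremal \<theta> p a u"
    and bound: "\<And>G. D12 a u G \<Longrightarrow> 0 < ckn_rhs \<theta> a u G \<and> ckn_lhs p a u \<le> c * ckn_rhs \<theta> a u G"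
  shows False
proof -
  obtain G where G: "D12 a u G" "ereal (ckn_lhs p a u) = C_CKN TYPE('n) \<theta> p a * ereal (ckn_rhs \<theta> a u G)"
    using u by (auto simp: ckn_extremal_def)
  define R where "R = ckn_lhs p a \<phi> / ckn_rhs \<theta> a \<phi> (grad \<phi>)"
  have "c < R" using \<phi> by (simp add: R_def pos_less_divide_eq)
  have "ereal R \<le> C_CKN TYPE('n) \<theta> p a"
    unfolding C_CKN_def
  proof (rule INF_greatest)
    fix C assume "C \<in> {C. 0 \<le> C \<and> ckn_inequality TYPE('n) \<theta> p a C}"
    then have "ckn_lhs p a \<phi> \<le> C * ckn_rhs \<theta> a \<phi> (grad \<phi>)"
      using test_function_D12[OF \<phi>(1), of a] by (auto simp: ckn_inequality_def)
    then show "ereal R \<le> ereal C" using \<phi>(2) by (simp add: R_def pos_divide_le_eq)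
  qed
  moreover have pos: "0 < ckn_rhs \<theta> a u G" and le: "ckn_lhs p a u \<le> c * ckn_rhs \<theta> a u G"
    using bound[OF G(1)] by auto
  ultimately have "ereal R * ereal (ckn_rhs \<theta> a u G) \<le> ereal (ckn_lhs p a u)"
    unfolding G(2) by (intro ereal_mult_right_mono) auto
  then have "R * ckn_rhs \<theta> a u G \<le> c * ckn_rhs \<theta> a u G" using le by simp
  with pos \<open>c < R\<close> show False by simp
qed

theorem theorem5:
  assumes "CARD('n::finite) \<ge> 2"
  shows "\<exists>\<eta>>0. \<forall>p. 2 < p \<and> p < 2 + \<eta> \<longrightarrow>
    (\<exists>\<epsilon>>0. \<forall>\<theta> a.
        vartheta_exp p CARD('n) \<le> \<theta> \<and> \<theta> < vartheta_exp p CARD('n) + \<epsilon> \<and>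
        a_lower CARD('n) \<theta> p \<le> a \<and> a < a_lower CARD('n) \<theta> p + \<epsilon> \<longrightarrow>
        ckn_admissible CARD('n) \<theta> p a \<and>
        (\<forall>u :: real ^ 'n \<Rightarrow> real. ckn_extremal \<theta> p a u \<longrightarrow> \<not> radially_symmetric u))"
proof -
  define m where "m = CARD('n) - 1"
  have d: "CARD('n) = Suc m" and m: "m \<ge> 1" using assms by (auto simp: m_def)
  let ?near = "\<lambda>p. sphere_const\<^sup>2 * (2 * pi / 5) * ((p + 2)\<^sup>2 / 16) ^ m"
  have "(?near \<longlongrightarrow> ?near 2) (nhds 2)"
    by (intro tendsto_intros filterlim_ident) auto
  then have "\<forall>\<^sub>F p in nhds 2. ?near p < 1"
    by (rule order_tendstoD(2)) (use sphere_const_bound in simp)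
  then obtain \<eta>\<^sub>0 where \<eta>0: "\<eta>\<^sub>0 > 0" "\<And>p. dist p 2 < \<eta>\<^sub>0 \<Longrightarrow> ?near p < 1"
    unfolding eventually_nhds_metric by blast
  \<comment> \<open>The bound \<open>1 / 2\<close> is required by the one-dimensional inequality; \<open>4 / d\<close> keeps \<open>vartheta_exp p d\<close>
    below 1 and \<open>p\<close> below the critical exponent.\<close>
  define \<eta> where "\<eta> = min \<eta>\<^sub>0 (min (1 / 2) (4 / real CARD('n)))"
  have "\<eta> > 0" using \<eta>0 by (simp add: \<eta>_def)
  moreover have "\<exists>\<epsilon>>0. \<forall>\<theta> a.
        vartheta_exp p CARD('n) \<le> \<theta> \<and> \<theta> < vartheta_exp p CARD('n) + \<epsilon> \<and>
        a_lower CARD('n) \<theta> p \<le> a \<and> a < a_lower CARD('n) \<theta> p + \<epsilon> \<longrightarrow>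
        ckn_admissible CARD('n) \<theta> p a \<and>
        (\<forall>u :: real ^ 'n \<Rightarrow> real. ckn_extremal \<theta> p a u \<longrightarrow> \<not> radially_symmetric u)"
    if p: "2 < p" "p < 2 + \<eta>" for p
  proof -
    define q where "q = (p - 2) / (2 * p)"
    define \<theta>\<^sub>0 where "\<theta>\<^sub>0 = vartheta_exp p CARD('n)"
    define a\<^sub>0 where "a\<^sub>0 = a_lower CARD('n) \<theta>\<^sub>0 p"
    define \<sigma> where "\<sigma> = shell_mass TYPE('n)"
    have q: "0 < q" using p by (simp add: q_def)
    have \<theta>0: "\<theta>\<^sub>0 = (real m + 1) * q" by (simp add: \<theta>\<^sub>0_def vartheta_exp_def q_def d)
    have q\<theta>: "q < \<theta>\<^sub>0" using q m by (simp add: \<theta>0)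
    have near: "?near p < 1" using p by (intro \<eta>0) (simp add: dist_real_def \<eta>_def)
    have p52: "p \<le> 5 / 2" using p by (simp add: \<eta>_def)
    have "p - 2 < 4 / real CARD('n)" using p by (simp add: \<eta>_def)
    then have pd: "real CARD('n) * (p - 2) < 4" by (simp add: pos_less_divide_eq mult.commute)
    have \<theta>1: "\<theta>\<^sub>0 < 1" using pd p by (simp add: \<theta>\<^sub>0_def vartheta_exp_def pos_divide_less_eq)
    have k0: "a_crit CARD('n) - a\<^sub>0 = 2 * real m / (p + 2)"
    proof -
      have "2 * p * \<theta>\<^sub>0 / (p - 2) = real m + 1" using p by (simp add: \<theta>0 q_def)
      then show ?thesis by (simp add: a\<^sub>0_def a_lower_def d)
    qed
    have a0: "a\<^sub>0 < a_crit CARD('n)" using k0 m p by (smt (verit) divide_pos_pos of_nat_0_less_iff mult_pos_pos le_simps(3) One_nat_def)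
    define M where "M \<theta> a = radial_bound \<sigma> q \<theta> ((a_crit CARD('n) - a)\<^sup>2)" for \<theta> a
    have M0: "0 \<le> M \<theta> a" for \<theta> a by (simp add: M_def radial_bound_def)
    have lt: "M \<theta>\<^sub>0 a\<^sub>0 * (pi * exp 1 * real CARD('n) / 2) powr \<theta>\<^sub>0 < 1"
      using radial_bound_strict[OF d m p(1) near] by (simp only: M_def k0 \<sigma>_def q_def \<theta>\<^sub>0_def)
    obtain \<phi> :: "real ^ 'n \<Rightarrow> real" where \<phi>: "test_function \<phi>"
      and supp: "\<And>x. \<not> (1 / 2 \<le> norm x \<and> norm x \<le> 2) \<Longrightarrow> \<phi> x = 0 \<and> grad \<phi> x = 0"
      and pos: "0 < (LINT x|lborel. (norm (grad \<phi> x))\<^sup>2 / norm x powr (2 * a\<^sub>0))"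
        "0 < (LINT x|lborel. \<bar>\<phi> x\<bar>\<^sup>2 / norm x powr (2 * (a\<^sub>0 + 1)))"
        "0 < (LINT x|lborel. ckn_density p a\<^sub>0 \<phi> x)"
      and strict: "M \<theta>\<^sub>0 a\<^sub>0 * ckn_rhs \<theta>\<^sub>0 a\<^sub>0 \<phi> (grad \<phi>) < ckn_lhs p a\<^sub>0 \<phi>"
      by (rule concentrated_test_function[where a = a\<^sub>0, OF p(1) M0 lt[unfolded \<theta>\<^sub>0_def], folded \<theta>\<^sub>0_def])
         (rule that; assumption)
    define I\<^sub>1 where "I\<^sub>1 a = (LINT x|lborel. ckn_density p a \<phi> x)" for a
    define I\<^sub>2 where "I\<^sub>2 a = (LINT x|lborel. (norm (grad \<phi> x))\<^sup>2 / norm x powr (2 * a))" for a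
    define I\<^sub>3 where "I\<^sub>3 a = (LINT x|lborel. \<bar>\<phi> x\<bar>\<^sup>2 / norm x powr (2 * (a + 1)))" for a
    let ?F = "nhds (\<theta>\<^sub>0, a\<^sub>0)"
    have lim\<theta>: "(fst \<longlongrightarrow> \<theta>\<^sub>0) ?F" and lima: "(snd \<longlongrightarrow> a\<^sub>0) ?F"
      using tendsto_fst[OF filterlim_ident, of "(\<theta>\<^sub>0, a\<^sub>0)"] tendsto_snd[OF filterlim_ident, of "(\<theta>\<^sub>0, a\<^sub>0)"] by simp_all
    have c1: "isCont (\<lambda>t. LINT x|lborel. \<bar>\<phi> x\<bar> powr p / norm x powr t) t" for t
      by (rule continuous_weighted_integral)
         (use supp p test_function_value_integrable[OF \<phi>, of p] in auto)
    have c2: "isCont (\<lambda>t. LINT x|lborel. (norm (grad \<phi> x))\<^sup>2 / norm x powr t) t" for t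
      by (rule continuous_weighted_integral)
         (use supp test_function_gradient_integrable[OF \<phi>] in auto)
    have c3: "isCont (\<lambda>t. LINT x|lborel. \<bar>\<phi> x\<bar>\<^sup>2 / norm x powr t) t" for t
      by (rule continuous_weighted_integral)
         (use supp test_function_value_integrable[OF \<phi>, of 2] in \<open>auto simp: powr_numeral\<close>)
    have I1: "((\<lambda>x. I\<^sub>1 (snd x)) \<longlongrightarrow> I\<^sub>1 a\<^sub>0) ?F"
      unfolding I\<^sub>1_def ckn_density_def b_exp_def
      by (rule isCont_tendsto_compose[OF c1]) (intro tendsto_intros lima)
    have I2: "((\<lambda>x. I\<^sub>2 (snd x)) \<longlongrightarrow> I\<^sub>2 a\<^sub>0) ?F"
      unfolding I\<^sub>2_def by (rule isCont_tendsto_compose[OF c2]) (intro tendsto_intros lima)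
    have I3: "((\<lambda>x. I\<^sub>3 (snd x)) \<longlongrightarrow> I\<^sub>3 a\<^sub>0) ?F"
      unfolding I\<^sub>3_def by (rule isCont_tendsto_compose[OF c3]) (intro tendsto_intros lima)
    have Ipos: "0 < I\<^sub>1 a\<^sub>0" "0 < I\<^sub>2 a\<^sub>0" "0 < I\<^sub>3 a\<^sub>0" using pos by (simp_all add: I\<^sub>1_def I\<^sub>2_def I\<^sub>3_def)
    have rhs: "ckn_rhs \<theta> a \<phi> (grad \<phi>) = I\<^sub>2 a powr \<theta> * I\<^sub>3 a powr (1 - \<theta>)" for \<theta> a
      by (simp only: ckn_rhs_def I\<^sub>2_def I\<^sub>3_def)
    have lhs: "ckn_lhs p a \<phi> = I\<^sub>1 a powr (2 / p)" for a
      by (simp only: ckn_lhs_def I\<^sub>1_def)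
    have "((\<lambda>x. I\<^sub>1 (snd x) powr (2 / p) - M (fst x) (snd x) * (I\<^sub>2 (snd x) powr fst x * I\<^sub>3 (snd x) powr (1 - fst x)))
        \<longlongrightarrow> I\<^sub>1 a\<^sub>0 powr (2 / p) - M \<theta>\<^sub>0 a\<^sub>0 * (I\<^sub>2 a\<^sub>0 powr \<theta>\<^sub>0 * I\<^sub>3 a\<^sub>0 powr (1 - \<theta>\<^sub>0))) ?F"
      unfolding M_def radial_bound_def
      by (intro tendsto_intros I1 I2 I3 lim\<theta> lima)
         (use Ipos q q\<theta> a0 shell_mass_pos[where 'n = 'n] in \<open>auto simp: \<sigma>_def\<close>)
    then have "\<forall>\<^sub>F x in ?F. 0 < I\<^sub>1 (snd x) powr (2 / p) - M (fst x) (snd x) * (I\<^sub>2 (snd x) powr fst x * I\<^sub>3 (snd x) powr (1 - fst x))"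
      by (rule order_tendstoD(1)) (use strict in \<open>simp add: rhs lhs\<close>)
    moreover have "\<forall>\<^sub>F x in ?F. 0 < I\<^sub>2 (snd x)" "\<forall>\<^sub>F x in ?F. 0 < I\<^sub>3 (snd x)"
      by (rule order_tendstoD(1)[OF I2 Ipos(2)], rule order_tendstoD(1)[OF I3 Ipos(3)])
    moreover have "\<forall>\<^sub>F x in ?F. fst x < 1" "\<forall>\<^sub>F x in ?F. snd x < a_crit CARD('n)"
      by (rule order_tendstoD(2)[OF lim\<theta> \<theta>1], rule order_tendstoD(2)[OF lima a0])
    ultimately have "\<forall>\<^sub>F x in ?F. M (fst x) (snd x) * ckn_rhs (fst x) (snd x) \<phi> (grad \<phi>) < ckn_lhs p (snd x) \<phi> \<and>
        0 < ckn_rhs (fst x) (snd x) \<phi> (grad \<phi>) \<and> fst x < 1 \<and> snd x < a_crit CARD('n)"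
      by eventually_elim (simp add: rhs lhs)
    then obtain r where r: "r > 0" "\<And>\<theta> a. dist (\<theta>, a) (\<theta>\<^sub>0, a\<^sub>0) < r \<Longrightarrow>
        M \<theta> a * ckn_rhs \<theta> a \<phi> (grad \<phi>) < ckn_lhs p a \<phi> \<and>
        0 < ckn_rhs \<theta> a \<phi> (grad \<phi>) \<and> \<theta> < 1 \<and> a < a_crit CARD('n)"
      unfolding eventually_nhds_metric by force
    have "((\<lambda>\<theta>. a_lower CARD('n) \<theta> p) \<longlongrightarrow> a\<^sub>0) (nhds \<theta>\<^sub>0)"
      unfolding a\<^sub>0_def a_lower_def by (intro tendsto_intros filterlim_ident) (use p in auto)
    then have "\<forall>\<^sub>F \<theta> in nhds \<theta>\<^sub>0. dist (a_lower CARD('n) \<theta> p) a\<^sub>0 < r / 3"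
      by (rule tendstoD) (use r in simp)
    then obtain s where s: "s > 0" "\<And>\<theta>. dist \<theta> \<theta>\<^sub>0 < s \<Longrightarrow> dist (a_lower CARD('n) \<theta> p) a\<^sub>0 < r / 3"
      unfolding eventually_nhds_metric by blast
    define \<epsilon> where "\<epsilon> = min s (r / 3)"
    show ?thesis
    proof (intro exI[of _ \<epsilon>] conjI allI impI)
      show "\<epsilon> > 0" using r s by (simp add: \<epsilon>_def)
      fix \<theta> a
      assume "vartheta_exp p CARD('n) \<le> \<theta> \<and> \<theta> < vartheta_exp p CARD('n) + \<epsilon> \<and>
        a_lower CARD('n) \<theta> p \<le> a \<and> a < a_lower CARD('n) \<theta> p + \<epsilon>"
      then have \<theta>: "\<theta>\<^sub>0 \<le> \<theta>" "\<theta> < \<theta>\<^sub>0 + \<epsilon>" and a: "a_lower CARD('n) \<theta> p \<le> a" "a < a_lower CARD('n) \<theta> p + \<epsilon>"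
        by (auto simp: \<theta>\<^sub>0_def)
      have "\<bar>a_lower CARD('n) \<theta> p - a\<^sub>0\<bar> < r / 3"
        using s(2)[of \<theta>] \<theta> by (simp add: dist_real_def \<epsilon>_def)
      moreover have "\<epsilon> \<le> r / 3" by (simp add: \<epsilon>_def)
      ultimately have "\<bar>\<theta> - \<theta>\<^sub>0\<bar> + \<bar>a - a\<^sub>0\<bar> < r" using \<theta> a by linarith
      then have "dist (\<theta>, a) (\<theta>\<^sub>0, a\<^sub>0) < r"
        using sqrt_sum_squares_le_sum_abs[of "\<theta> - \<theta>\<^sub>0" "a - a\<^sub>0"] by (simp add: dist_Pair_Pair dist_real_def)
      from r(2)[OF this] have Q: "M \<theta> a * ckn_rhs \<theta> a \<phi> (grad \<phi>) < ckn_lhs p a \<phi>"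
        "0 < ckn_rhs \<theta> a \<phi> (grad \<phi>)" "\<theta> < 1" "a < a_crit CARD('n)" by auto
      have "ereal p < two_star CARD('n)"
        using pd m p by (auto simp: two_star_def d field_simps)
      with Q \<theta> p show "ckn_admissible CARD('n) \<theta> p a"
        by (simp add: ckn_admissible_def \<theta>\<^sub>0_def)
      fix u :: "real ^ 'n \<Rightarrow> real"
      assume u: "ckn_extremal \<theta> p a u"
      show "\<not> radially_symmetric u"
      proof
        assume rad: "radially_symmetric u"
        have nz: "\<not> (AE x in lborel. u x = 0)" using u by (simp add: ckn_extremal_def)
        have "(p - 2) / (2 * p) < \<theta>" using q\<theta> \<theta> by (simp add: q_def)
        note radial = radial_quotient_bound[OF _ rad nz Q(4) p(1) p52 this]
        show False
          by (rule no_radial_extremal_by_competitor[OF \<phi> Q(2,1) M0 u])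
             (use radial in \<open>simp add: M_def \<sigma>_def q_def\<close>)
      qed
    qed
  qed
  ultimately show ?thesis by blast
qed

end
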